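(* Let $F:M^{n}\to\mathbb{S}^{n+1}\subset\mathbb{E}^{n+2}$ be a connected isoparametric hypersurface in $\mathbb{S}^{n+1}$, with inward unit normal vector field $N$, i.e. $H>0$, and $g$ distinct principal curvatures $k_i$, $i=1,\dots,g$, where $g\in\{1,2,3,4,6\}$, all with multiplicity $m$, i.e. $n=gm$. Then the solution to the IMCF by parallel hypersurfaces with initial condition $F$ is given by $$F^{t}(x)=\cos(\mu(t))F(x)+\sin(\mu(t))N(x),\qquad\forall x\in M,$$ where $$\cos(g\mu(t))=\frac{e^{t/m}+a\sqrt{q(t)}}{a^{2}+1},\qquad \sin(g\mu(t))=\frac{-a\,e^{t/m}+\sqrt{q(t)}}{a^{2}+1},$$ $$q(t)=a^{2}+1-e^{2t/m},\qquad a=\frac1g\sum_{i=1}^g k_i=\frac{H}{n},$$ with $t\in(-\infty,t^{*})$ and $t^{*}=\frac m2\ln(a^{2}+1)$, i.e. $F^t$ is an ancient solution. Moreover, when $t\to-\infty$, $F^t(M)$ converges to an $m(g-1)$-dimensional submanifold of $\mathbb{S}^{n+1}$, and when $t\to t^{*}$ it converges to a minimal hypersurface $F^{t^*}(M)$ of $\mathbb{S}^{n+1}$, whose squared length of the second fundamental form is $|A|^2=mg(g-1)=n(g-1)$ and whose scalar curvature is $R=m(m-1)g^2=n(n-g)$. In particular, $F^{t^*}(M)$ is a totally geodesic submanifold of the sphere when $g=1$, it is a Clifford minimal hypersurface of the sphere when $g=2$, and it is a Cartan type minimal submanifold when $g\in\{3,4,6\}$.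
   Context: For an oriented hypersurface $F:M^n\to\mathbb{S}^{n+1}$ (an immersion into the unit sphere) with unit normal $N$, the second fundamental form is $II_x(v,w)=-\langle dN_x(v),dF_x(w)\rangle$, the principal curvatures $k_1,\dots,k_n$ (counted with multiplicity) are its eigenvalues with respect to the induced metric, and the mean curvature is $H=\sum$ of the $n$ principal curvatures (not averaged; here $H=m\sum_{i=1}^g k_i$ over the distinct ones). "Inward" normal means the choice of unit normal for which $H>0$. $F(M)$ is isoparametric if its principal curvatures are constant. $|A|^2$ is the sum of squares of all $n$ principal curvatures; $R$ is the (unnormalized) scalar curvature of the induced metric. A one-parameter family of hypersurfaces $F^t:M\to\mathbb{S}^{n+1}$, $t\in I$, with $I\subset\mathbb{R}$ an open interval containing $0$, is a solution to the inverse mean curvature flow (IMCF) with initial condition $F$ if $\frac{\partial F^t}{\partial t}(x)=-\frac{1}{H^t(x)}N^t(x)$ for all $(x,t)\in M\times I$ and $F^0=F$, where $H^t$ is the mean curvature of $F^t$ with respect to its inward unit normal $N^t$ and $H^t(x)>0$ for all $(x,t)$. It is a solution by parallel hypersurfaces if there is a (smooth) function $\mu:I\to\mathbb{R}$ (with $\mu(0)=0$) such that $F^t(x)=\cos(\mu(t))F(x)+\sin(\mu(t))N(x)$ for all $t\in I$, $x\in M$; the unit normal of $F^t$ is then $N^t(x)=-\sin(\mu(t))F(x)+\cos(\mu(t))N(x)$. The solution is considered on its maximal interval $I$, and is ancient if $I=(-\infty,t^* )$ with $t^*>0$. Convergence of $F^t(M)$ is pointwise in $x\in M$: $F^t(x)$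 has a limit for every $x$; as $t\to-\infty$ the limit map has constant rank $m(g-1)$ (its image being, locally, a submanifold of that dimension; a point if $g=1$), and as $t\to t^*$ the limit map $F^{t^*}$ is an immersion with zero mean curvature. A Clifford minimal hypersurface (for $g=2$, equal multiplicities) is (an open part of) the product $\mathbb{S}^m_{1/\sqrt2}\times\mathbb{S}^m_{1/\sqrt2}\subset\mathbb{S}^{2m+1}$. A Cartan type minimal submanifold here means a minimal isoparametric hypersurface of the sphere with $g\in\{3,4,6\}$ distinct principal curvatures (all of multiplicity $m$). *)

theory Defs
  imports "HOL-Analysis.Analysis"
begin

section \<open>Smooth maps and smooth manifolds\<close>

text \<open>
  Meaningful for open \<open>S\<close> only.  \<open>Ck_on k S f\<close> says that the iterated directional derivatives of
  \<open>f\<close> along fixed vectors are Frechet differentiable on \<open>S\<close> up to order \<open>k - 1\<close>, and that those of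
  order \<open>k\<close> are continuous on \<open>S\<close>.
\<close>

primrec Ck_on :: "nat \<Rightarrow> 'a::euclidean_space set \<Rightarrow> ('a \<Rightarrow> 'b::euclidean_space) \<Rightarrow> bool" where
  "Ck_on 0 S f \<longleftrightarrow> continuous_on S f"
| "Ck_on (Suc k) S f \<longleftrightarrow>
     (\<forall>x\<in>S. f differentiable (at x)) \<and> (\<forall>v. Ck_on k S (\<lambda>x. frechet_derivative f (at x) v))"

definition smooth_on :: "'a::euclidean_space set \<Rightarrow> ('a \<Rightarrow> 'b::euclidean_space) \<Rightarrow> bool" where
  "smooth_on S f \<longleftrightarrow> (\<forall>k. Ck_on k S f)"

text \<open>
  A chart \<open>(U, \<phi>)\<close> is a homeomorphism from an open subset \<open>U\<close> of the space onto an open subset of the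
  model space \<open>'e\<close>; values of \<open>\<phi>\<close> outside \<open>U\<close> are irrelevant.  The dimension of the manifold is
  \<open>DIM('e)\<close>.  Atlases need not be maximal.
\<close>

type_synonym ('m, 'e) chart = "'m set \<times> ('m \<Rightarrow> 'e)"

definition is_chart :: "'m topology \<Rightarrow> ('m, 'e::euclidean_space) chart \<Rightarrow> bool" where
  "is_chart X c \<longleftrightarrow>
     openin X (fst c) \<and> open (snd c ` fst c) \<and>
     homeomorphic_map (subtopology X (fst c)) (top_of_set (snd c ` fst c)) (snd c)"

definition smooth_manifold :: "'m topology \<Rightarrow> ('m, 'e::euclidean_space) chart set \<Rightarrow> bool" where
  "smooth_manifold X A \<longleftrightarrow>
     Hausdorff_space X \<and> second_countable X \<and>
     (\<forall>c\<in>A. is_chart X c) \<and> (\<Union>c\<in>A. fst c) = topspace X \<and>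
     (\<forall>c\<in>A. \<forall>d\<in>A. smooth_on (snd c ` (fst c \<inter> fst d)) (snd d \<circ> inv_into (fst c) (snd c)))"

definition in_chart :: "('m, 'e::euclidean_space) chart \<Rightarrow> ('m \<Rightarrow> 'b) \<Rightarrow> 'e \<Rightarrow> 'b" where
  "in_chart c F = F \<circ> inv_into (fst c) (snd c)"

definition smooth_map ::
    "('m, 'e::euclidean_space) chart set \<Rightarrow> ('m \<Rightarrow> 'b::euclidean_space) \<Rightarrow> bool" where
  "smooth_map A F \<longleftrightarrow> (\<forall>c\<in>A. smooth_on (snd c ` fst c) (in_chart c F))"

text \<open>
  The differential \<open>dF\<^sub>x\<close>, with tangent vectors at \<open>x\<close> represented by their coordinates in the chart
  \<open>c\<close> around \<open>x\<close>.  All notions below carry such a chart \<open>c\<close> as a parameter; those that are numbers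
  or sets of numbers do not depend on its choice.  In every definition, ``for all \<open>x\<close> in the
  manifold'' reads: for all charts \<open>c\<close> of the atlas and all \<open>x\<close> in the domain of \<open>c\<close>.
\<close>

definition differential ::
    "('m, 'e::euclidean_space) chart \<Rightarrow> ('m \<Rightarrow> 'b::euclidean_space) \<Rightarrow> 'm \<Rightarrow> 'e \<Rightarrow> 'b" where
  "differential c F x = frechet_derivative (in_chart c F) (at (snd c x))"

text \<open>Embedded \<open>d\<close>-dimensional smooth submanifolds of a Euclidean space, by straightening charts.\<close>

definition embedded_submanifold :: "nat \<Rightarrow> 'b::euclidean_space set \<Rightarrow> bool" where
  "embedded_submanifold d S \<longleftrightarrow>
     (\<forall>p\<in>S. \<exists>W (\<Phi> :: 'b \<Rightarrow> 'b) \<Psi> L.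
        open W \<and> p \<in> W \<and> open (\<Phi> ` W) \<and> smooth_on W \<Phi> \<and> smooth_on (\<Phi> ` W) \<Psi> \<and>
        (\<forall>y\<in>W. \<Psi> (\<Phi> y) = y) \<and> subspace L \<and> dim L = d \<and> \<Phi> ` (S \<inter> W) = L \<inter> \<Phi> ` W)"


section \<open>Oriented hypersurfaces of the unit sphere\<close>

text \<open>
  \<open>F\<close> is an immersion of the manifold into the unit sphere of \<open>'b\<close>, and \<open>N\<close> is a unit normal field
  along \<open>F\<close>, tangent to the sphere.  It is a hypersurface of the sphere when
  \<open>DIM('b) = DIM('e) + 2\<close>.
\<close>

definition oriented_hypersurface ::
    "('m, 'e::euclidean_space) chart set \<Rightarrow> ('m \<Rightarrow> 'b::euclidean_space) \<Rightarrow> ('m \<Rightarrow> 'b) \<Rightarrow> bool" where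
  "oriented_hypersurface A F N \<longleftrightarrow>
     DIM('b) = DIM('e) + 2 \<and> smooth_map A F \<and> smooth_map A N \<and>
     (\<forall>c\<in>A. \<forall>x\<in>fst c.
        norm (F x) = 1 \<and> inj (differential c F x) \<and>
        norm (N x) = 1 \<and> N x \<bullet> F x = 0 \<and> (\<forall>v. N x \<bullet> differential c F x v = 0))"

definition first_form ::
    "('m, 'e::euclidean_space) chart \<Rightarrow> ('m \<Rightarrow> 'b::euclidean_space) \<Rightarrow> 'm \<Rightarrow> 'e \<Rightarrow> 'e \<Rightarrow> real" where
  "first_form c F x v w = differential c F x v \<bullet> differential c F x w"

definition second_form ::
    "('m, 'e::euclidean_space) chart \<Rightarrow> ('m \<Rightarrow> 'b::euclidean_space) \<Rightarrow> ('m \<Rightarrow> 'b) \<Rightarrow> 'm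
      \<Rightarrow> 'e \<Rightarrow> 'e \<Rightarrow> real" where
  "second_form c F N x v w = - (differential c N x v \<bullet> differential c F x w)"

definition curvature_space ::
    "('m, 'e::euclidean_space) chart \<Rightarrow> ('m \<Rightarrow> 'b::euclidean_space) \<Rightarrow> ('m \<Rightarrow> 'b) \<Rightarrow> 'm
      \<Rightarrow> real \<Rightarrow> 'e set" where
  "curvature_space c F N x \<kappa> = {v. \<forall>w. second_form c F N x v w = \<kappa> * first_form c F x v w}"

definition principal_curvatures ::
    "('m, 'e::euclidean_space) chart \<Rightarrow> ('m \<Rightarrow> 'b::euclidean_space) \<Rightarrow> ('m \<Rightarrow> 'b) \<Rightarrow> 'm
      \<Rightarrow> real set" where
  "principal_curvatures c F N x = {\<kappa>. \<exists>v\<in>curvature_space c F N x \<kappa>. v \<noteq> 0}"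

definition curvature_mult ::
    "('m, 'e::euclidean_space) chart \<Rightarrow> ('m \<Rightarrow> 'b::euclidean_space) \<Rightarrow> ('m \<Rightarrow> 'b) \<Rightarrow> 'm
      \<Rightarrow> real \<Rightarrow> nat" where
  "curvature_mult c F N x \<kappa> = dim (curvature_space c F N x \<kappa>)"

text \<open>The mean curvature is the sum, not the average, of the principal curvatures.\<close>

definition mean_curvature ::
    "('m, 'e::euclidean_space) chart \<Rightarrow> ('m \<Rightarrow> 'b::euclidean_space) \<Rightarrow> ('m \<Rightarrow> 'b) \<Rightarrow> 'm \<Rightarrow> real" where
  "mean_curvature c F N x =
     (\<Sum>\<kappa>\<in>principal_curvatures c F N x. real (curvature_mult c F N x \<kappa>) * \<kappa>)"

definition sq_norm_second_form ::
    "('m, 'e::euclidean_space) chart \<Rightarrow> ('m \<Rightarrow> 'b::euclidean_space) \<Rightarrow> ('m \<Rightarrow> 'b) \<Rightarrow> 'm \<Rightarrow> real" where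
  "sq_norm_second_form c F N x =
     (\<Sum>\<kappa>\<in>principal_curvatures c F N x. real (curvature_mult c F N x \<kappa>) * \<kappa>\<^sup>2)"

definition isoparametric ::
    "('m, 'e::euclidean_space) chart set \<Rightarrow> ('m \<Rightarrow> 'b::euclidean_space) \<Rightarrow> ('m \<Rightarrow> 'b) \<Rightarrow> bool" where
  "isoparametric A F N \<longleftrightarrow> oriented_hypersurface A F N \<and>
     (\<exists>K \<nu>. \<forall>c\<in>A. \<forall>x\<in>fst c. principal_curvatures c F N x = K \<and>
        (\<forall>\<kappa>\<in>K. curvature_mult c F N x \<kappa> = \<nu> \<kappa>))"

definition minimal_hypersurface ::
    "('m, 'e::euclidean_space) chart set \<Rightarrow> ('m \<Rightarrow> 'b::euclidean_space) \<Rightarrow> ('m \<Rightarrow> 'b) \<Rightarrow> bool" where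
  "minimal_hypersurface A F N \<longleftrightarrow> oriented_hypersurface A F N \<and>
     (\<forall>c\<in>A. \<forall>x\<in>fst c. mean_curvature c F N x = 0)"

definition totally_geodesic ::
    "('m, 'e::euclidean_space) chart set \<Rightarrow> ('m \<Rightarrow> 'b::euclidean_space) \<Rightarrow> ('m \<Rightarrow> 'b) \<Rightarrow> bool" where
  "totally_geodesic A F N \<longleftrightarrow> oriented_hypersurface A F N \<and>
     (\<forall>c\<in>A. \<forall>x\<in>fst c. \<forall>v w. second_form c F N x v w = 0)"

text \<open>
  Open parts of the product of two \<open>m\<close>-spheres of radius \<open>1/\<surd>2\<close> lying in orthogonal
  \<open>(m+1)\<close>-dimensional subspaces of the \<open>(2m+2)\<close>-dimensional space \<open>'b\<close>.
\<close>

definition clifford_hypersurface :: "nat \<Rightarrow> 'b::euclidean_space set \<Rightarrow> bool" where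
  "clifford_hypersurface m S \<longleftrightarrow> DIM('b) = 2 * m + 2 \<and>
     (\<exists>V W. subspace V \<and> subspace W \<and> dim V = m + 1 \<and> dim W = m + 1 \<and>
        (\<forall>v\<in>V. \<forall>w\<in>W. v \<bullet> w = 0) \<and>
        openin (top_of_set {v + w | v w. v \<in> V \<and> w \<in> W \<and> norm v = 1 / sqrt 2 \<and> norm w = 1 / sqrt 2}) S)"

definition cartan_type ::
    "('m, 'e::euclidean_space) chart set \<Rightarrow> ('m \<Rightarrow> 'b::euclidean_space) \<Rightarrow> ('m \<Rightarrow> 'b)
      \<Rightarrow> nat \<Rightarrow> nat \<Rightarrow> bool" where
  "cartan_type A F N g m \<longleftrightarrow> g \<in> {3, 4, 6} \<and>
     minimal_hypersurface A F N \<and> isoparametric A F N \<and>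
     (\<forall>c\<in>A. \<forall>x\<in>fst c. card (principal_curvatures c F N x) = g \<and>
        (\<forall>\<kappa>\<in>principal_curvatures c F N x. curvature_mult c F N x \<kappa> = m))"


section \<open>Scalar curvature of a Riemannian metric in coordinates\<close>

text \<open>
  A metric on an open subset of \<open>'e\<close> is given as \<open>G y u v\<close> with \<open>y\<close> the base point.  All formulas
  below are for constant coordinate vector fields \<open>u, v, w\<close>, so that Lie brackets vanish.
  \<open>sharp B \<alpha>\<close> is the vector dual to the linear form \<open>\<alpha>\<close> with respect to the inner product \<open>B\<close>.
\<close>

definition sharp :: "('e \<Rightarrow> 'e \<Rightarrow> real) \<Rightarrow> ('e \<Rightarrow> real) \<Rightarrow> 'e::euclidean_space" where
  "sharp B \<alpha> = (THE z. \<forall>w. B z w = \<alpha> w)"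

definition deriv_along :: "('e::euclidean_space \<Rightarrow> 'b::euclidean_space) \<Rightarrow> 'e \<Rightarrow> 'e \<Rightarrow> 'b" where
  "deriv_along f y u = frechet_derivative f (at y) u"

text \<open>\<open>christoffel G y u v\<close> is \<open>\<nabla>\<^sub>u v\<close> for the Levi-Civita connection, by the Koszul formula.\<close>

definition christoffel ::
    "('e \<Rightarrow> 'e \<Rightarrow> 'e \<Rightarrow> real) \<Rightarrow> 'e \<Rightarrow> 'e \<Rightarrow> 'e \<Rightarrow> 'e::euclidean_space" where
  "christoffel G y u v = sharp (G y) (\<lambda>w.
     (deriv_along (\<lambda>z. G z v w) y u + deriv_along (\<lambda>z. G z u w) y v
      - deriv_along (\<lambda>z. G z u v) y w) / 2)"

text \<open>\<open>R(u,v)w = \<nabla>\<^sub>u \<nabla>\<^sub>v w - \<nabla>\<^sub>v \<nabla>\<^sub>u w\<close>.\<close>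

definition riemann ::
    "('e \<Rightarrow> 'e \<Rightarrow> 'e \<Rightarrow> real) \<Rightarrow> 'e \<Rightarrow> 'e \<Rightarrow> 'e \<Rightarrow> 'e \<Rightarrow> 'e::euclidean_space" where
  "riemann G y u v w =
     deriv_along (\<lambda>z. christoffel G z v w) y u - deriv_along (\<lambda>z. christoffel G z u w) y v
     + christoffel G y u (christoffel G y v w) - christoffel G y v (christoffel G y u w)"

text \<open>
  \<open>Ric(v,w)\<close> is the trace of \<open>u \<mapsto> R(u,v)w\<close>, and the scalar curvature is the trace of the Ricci
  endomorphism.  A trace may be computed in any basis, here the standard one.
\<close>

definition ricci ::
    "('e \<Rightarrow> 'e \<Rightarrow> 'e \<Rightarrow> real) \<Rightarrow> 'e \<Rightarrow> 'e \<Rightarrow> 'e::euclidean_space \<Rightarrow> real" where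
  "ricci G y v w = (\<Sum>b\<in>Basis. riemann G y b v w \<bullet> b)"

definition metric_scalar_curvature ::
    "('e \<Rightarrow> 'e \<Rightarrow> 'e \<Rightarrow> real) \<Rightarrow> 'e::euclidean_space \<Rightarrow> real" where
  "metric_scalar_curvature G y = (\<Sum>b\<in>Basis. sharp (G y) (ricci G y b) \<bullet> b)"

definition scalar_curvature ::
    "('m, 'e::euclidean_space) chart \<Rightarrow> ('m \<Rightarrow> 'b::euclidean_space) \<Rightarrow> 'm \<Rightarrow> real" where
  "scalar_curvature c F x =
     metric_scalar_curvature (\<lambda>y. first_form c F (inv_into (fst c) (snd c) y)) (snd c x)"


section \<open>Inverse mean curvature flow\<close>

text \<open>
  The family \<open>Nt\<close> consists of the inward unit normals of \<open>Ft\<close>: positivity of the mean curvature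
  determines them.
\<close>

definition imcf_solution ::
    "('m, 'e::euclidean_space) chart set \<Rightarrow> ('m \<Rightarrow> 'b::euclidean_space) \<Rightarrow> real set
      \<Rightarrow> (real \<Rightarrow> 'm \<Rightarrow> 'b) \<Rightarrow> (real \<Rightarrow> 'm \<Rightarrow> 'b) \<Rightarrow> bool" where
  "imcf_solution A F I Ft Nt \<longleftrightarrow>
     open I \<and> is_interval I \<and> 0 \<in> I \<and>
     (\<forall>t\<in>I. oriented_hypersurface A (Ft t) (Nt t) \<and>
        (\<forall>c\<in>A. \<forall>x\<in>fst c.
           mean_curvature c (Ft t) (Nt t) x > 0 \<and>
           ((\<lambda>s. Ft s x) has_vector_derivative
              (- (1 / mean_curvature c (Ft t) (Nt t) x)) *\<^sub>R Nt t x) (at t))) \<and>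
     (\<forall>c\<in>A. \<forall>x\<in>fst c. Ft 0 x = F x)"

definition parallel_imcf_solution ::
    "('m, 'e::euclidean_space) chart set \<Rightarrow> ('m \<Rightarrow> 'b::euclidean_space) \<Rightarrow> ('m \<Rightarrow> 'b) \<Rightarrow> real set
      \<Rightarrow> (real \<Rightarrow> real) \<Rightarrow> (real \<Rightarrow> 'm \<Rightarrow> 'b) \<Rightarrow> (real \<Rightarrow> 'm \<Rightarrow> 'b) \<Rightarrow> bool" where
  "parallel_imcf_solution A F N I \<mu> Ft Nt \<longleftrightarrow>
     imcf_solution A F I Ft Nt \<and> smooth_on I \<mu> \<and> \<mu> 0 = 0 \<and>
     (\<forall>t\<in>I. \<forall>c\<in>A. \<forall>x\<in>fst c. Ft t x = cos (\<mu> t) *\<^sub>R F x + sin (\<mu> t) *\<^sub>R N x)"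

end

(*
  If a principal curvature is written as cot b_i, the parallel hypersurface at distance u has the
  principal curvatures cot (b_i - u).  Cartan's identity forces the product of the factors
  cos u - k_i sin u to be cos (g u) - a sin (g u), so the mean curvature of the parallel hypersurface
  is n cot (g (b - u)) for a single angle b, and the flow reduces to d/dt ln sin (g (b - mu)) = 1/m.
  At the backward limit sin (g (b - mu)) vanishes and exactly one principal direction collapses; at
  the forward limit the cotangent vanishes, which is minimality.  Cartan's identity itself is derived
  from the focal maps by the constant rank theorem.
*)

theory Submission
  imports Defs
begin

section \<open>Calculus of smooth maps\<close>

text \<open>Cartan's identity makes the row and column sums of the weights
  \<open>(1 + k i * k j) / (k i - k j)\<close> vanish. They govern the sum over pairs in the second
  derivative of the product of the factors \<open>cos u - k i * sin u\<close>, so the product solves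
  h'' = -g^2 h, and h(0) = 1, h'(0) = -g a determine it. The same sum over pairs yields the sum of
  squares of the curvatures of a parallel hypersurface, hence |A|^2 at the forward limit; the Gauss
  equation turns this into R. With cot \<phi>0 = a the product is sqrt (a^2 + 1) sin (\<phi>0 - g
  u). The angle \<theta> = \<phi>0 - g \<mu> runs from 0 to pi/2 while t runs from minus infinity to
  \<open>ts\<close>. Any other parallel solution is confined to this range of angles: immersion
  excludes zeros of the sine, positive mean curvature excludes zeros of the cosine. So uniqueness
  and maximality of the interval come from one argument. For g = 2 the minimal limit has the
  curvatures 1 and -1; the reflection exchanging F and N is then constant in the ambient space, and
  its eigenspaces carry the two sphere factors.\<close>

abbreviation dd :: "('a::euclidean_space \<Rightarrow> 'b::euclidean_space) \<Rightarrow> 'a \<Rightarrow> 'a \<Rightarrow> 'b" where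
  "dd f x \<equiv> frechet_derivative f (at x)"

lemma dd_eq: "(f has_derivative f') (at x) \<Longrightarrow> dd f x = f'"
  using frechet_derivative_at by metis

lemma has_derivative_dd: "f differentiable (at x) \<Longrightarrow> (f has_derivative dd f x) (at x)"
  by (simp add: frechet_derivative_works)

lemma has_derivative_cong_open:
  assumes "open S" "x \<in> S" "\<And>y. y \<in> S \<Longrightarrow> f y = g y"
  shows "(f has_derivative D) (at x) \<longleftrightarrow> (g has_derivative D) (at x)"
  using assms has_derivative_transform_within_open[of f D x UNIV S g]
    has_derivative_transform_within_open[of g D x UNIV S f] by auto

lemma dd_cong:
  assumes "open S" "x \<in> S" "\<And>y. y \<in> S \<Longrightarrow> f y = g y"
  shows "dd f x = dd g x"
  unfolding frechet_derivative_def using has_derivative_cong_open[OF assms] by simp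

lemma differentiable_cong_open:
  assumes "open S" "x \<in> S" "\<And>y. y \<in> S \<Longrightarrow> f y = g y"
  shows "f differentiable (at x) \<longleftrightarrow> g differentiable (at x)"
  unfolding differentiable_def using has_derivative_cong_open[OF assms] by simp

section \<open>Closure properties of the classes C^k\<close>

lemma Ck_on_cong:
  assumes "open S" "\<And>y. y \<in> S \<Longrightarrow> f y = g y"
  shows "Ck_on k S f \<longleftrightarrow> Ck_on k S g"
  using assms(2)
proof (induction k arbitrary: f g)
  case 0
  then show ?case by (simp cong: continuous_on_cong)
next
  case (Suc k)
  have "Ck_on k S (\<lambda>x. dd f x v) \<longleftrightarrow> Ck_on k S (\<lambda>x. dd g x v)" for v
    by (rule Suc.IH) (use dd_cong[OF assms(1) _ Suc.prems] in auto)
  moreover have "(\<forall>x\<in>S. f differentiable (at x)) \<longleftrightarrow> (\<forall>x\<in>S. g differentiable (at x))"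
    using differentiable_cong_open[OF assms(1) _ Suc.prems] by auto
  ultimately show ?case by simp
qed

text \<open>Lets later proofs name a derivative by a formula; on an open set it agrees with
  \<open>frechet_derivative\<close> at every point, so the regularity of one is that of the
  other.\<close>

lemma Ck_on_SucI:
  assumes "open S" "\<And>x. x \<in> S \<Longrightarrow> (f has_derivative f' x) (at x)"
    "\<And>v. Ck_on k S (\<lambda>x. f' x v)"
  shows "Ck_on (Suc k) S f"
proof -
  have "Ck_on k S (\<lambda>x. dd f x v)" for v
    using Ck_on_cong[OF assms(1), of "\<lambda>x. dd f x v" "\<lambda>x. f' x v" k] assms(2,3) dd_eq
    by metis
  then show ?thesis using assms(2) by (auto simp: differentiable_def)
qed

lemma Ck_on_SucD: "Ck_on (Suc k) S f \<Longrightarrow> Ck_on k S f"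
proof (induction k arbitrary: f)
  case 0
  then show ?case
    by (auto intro!: continuous_at_imp_continuous_on differentiable_imp_continuous_within)
next
  case (Suc k)
  then show ?case by (metis Ck_on.simps(2))
qed

lemma Ck_on_Suc_has_derivative:
  "Ck_on (Suc k) S f \<Longrightarrow> x \<in> S \<Longrightarrow> (f has_derivative dd f x) (at x)"
  by (simp add: has_derivative_dd)

lemma Ck_on_le: "Ck_on k S f \<Longrightarrow> j \<le> k \<Longrightarrow> Ck_on j S f"
  by (induction k) (use Ck_on_SucD le_Suc_eq in blast)+

lemma Ck_on_continuous: "Ck_on k S f \<Longrightarrow> continuous_on S f"
  using Ck_on_le[of k S f 0] by simp

lemma Ck_on_subset: "Ck_on k S f \<Longrightarrow> T \<subseteq> S \<Longrightarrow> Ck_on k T f"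
  by (induction k arbitrary: f) (auto intro: continuous_on_subset)

lemma Ck_on_const: "open S \<Longrightarrow> Ck_on k S (\<lambda>x. c)"
proof (induction k arbitrary: c)
  case (Suc k)
  then show ?case by (intro Ck_on_SucI[where f' = "\<lambda>_ _. 0"]) auto
qed auto

lemma Ck_on_bounded_linear:
  assumes "bounded_linear L" "open S"
  shows "Ck_on k S f \<Longrightarrow> Ck_on k S (\<lambda>x. L (f x))"
proof (induction k arbitrary: f)
  case 0
  then show ?case using assms by (auto intro: bounded_linear.continuous_on)
next
  case (Suc k)
  then show ?case
    by (intro Ck_on_SucI[where f' = "\<lambda>x v. L (dd f x v)", OF assms(2)]
        bounded_linear.has_derivative[OF assms(1)] Ck_on_Suc_has_derivative) auto
qed

lemma Ck_on_add:
  assumes "open S"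
  shows "Ck_on k S f \<Longrightarrow> Ck_on k S g \<Longrightarrow> Ck_on k S (\<lambda>x. f x + g x)"
proof (induction k arbitrary: f g)
  case 0
  then show ?case by (auto intro: continuous_intros)
next
  case (Suc k)
  then show ?case
    by (intro Ck_on_SucI[where f' = "\<lambda>x v. dd f x v + dd g x v", OF assms] has_derivative_add
        Ck_on_Suc_has_derivative) auto
qed

lemma Ck_on_sum:
  assumes "open S"
  shows "(\<And>i. i \<in> I \<Longrightarrow> Ck_on k S (f i)) \<Longrightarrow> Ck_on k S (\<lambda>x. \<Sum>i\<in>I. f i x)"
  by (induction I rule: infinite_finite_induct) (auto intro: Ck_on_const Ck_on_add assms)

lemma Ck_on_bilinear:
  assumes "bounded_bilinear b" "open S"
  shows "Ck_on k S f \<Longrightarrow> Ck_on k S g \<Longrightarrow> Ck_on k S (\<lambda>x. b (f x) (g x))"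
proof (induction k arbitrary: f g)
  case 0
  then show ?case using assms by (auto intro: bounded_bilinear.continuous_on)
next
  case (Suc k)
  have "Ck_on k S f" "Ck_on k S g" using Suc.prems Ck_on_SucD by blast+
  then show ?case using Suc
    by (intro Ck_on_SucI[where f' = "\<lambda>x v. b (f x) (dd g x v) + b (dd f x v) (g x)", OF assms(2)]
        bounded_bilinear.FDERIV[OF assms(1)] Ck_on_Suc_has_derivative Ck_on_add[OF assms(2)]) auto
qed

lemma linear_Basis_expand:
  fixes L :: "'a::euclidean_space \<Rightarrow> 'b::real_vector"
  assumes "linear L"
  shows "L v = (\<Sum>b\<in>Basis. (v \<bullet> b) *\<^sub>R L b)"
proof -
  have "L v = L (\<Sum>b\<in>Basis. (v \<bullet> b) *\<^sub>R b)" by (simp add: euclidean_representation)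
  then show ?thesis by (simp add: linear_sum[OF assms] linear_cmul[OF assms])
qed

text \<open>The chain rule evaluates the derivative of g in a direction that moves with x, whereas
  the induction hypothesis knows fixed directions only. Expanding in the basis gives a finite sum of
  products to which it applies.\<close>

lemma Ck_on_compose:
  assumes "open S" "open T" "f ` S \<subseteq> T"
  shows "Ck_on k T g \<Longrightarrow> Ck_on k S f \<Longrightarrow> Ck_on k S (\<lambda>x. g (f x))"
proof (induction k arbitrary: g)
  case 0
  then show ?case using assms(3) by (auto intro: continuous_on_compose2)
next
  case (Suc k)
  have f: "Ck_on k S f" using Suc.prems Ck_on_SucD by blast
  show ?case
  proof (rule Ck_on_SucI[OF assms(1)])
    show "((\<lambda>x. g (f x)) has_derivative (\<lambda>v. \<Sum>b\<in>Basis. (dd f x v \<bullet> b) *\<^sub>R dd g (f x) b)) (at x)"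
      if "x \<in> S" for x
    proof -
      have g: "(g has_derivative dd g (f x)) (at (f x))"
        using Suc.prems(1) assms(3) that by (intro Ck_on_Suc_has_derivative) auto
      have "((\<lambda>x. g (f x)) has_derivative (\<lambda>v. dd g (f x) (dd f x v))) (at x)"
        using has_derivative_compose[OF Ck_on_Suc_has_derivative[OF Suc.prems(2) that] g] .
      then show ?thesis
        by (subst (asm) linear_Basis_expand[OF has_derivative_linear[OF g]])
    qed
    show "Ck_on k S (\<lambda>x. \<Sum>b\<in>Basis. (dd f x v \<bullet> b) *\<^sub>R dd g (f x) b)" for v
    proof (rule Ck_on_sum[OF assms(1)])
      fix b :: 'b assume "b \<in> Basis"
      have "Ck_on k S (\<lambda>x. dd f x v \<bullet> b)"
        using Suc.prems(2) by (intro Ck_on_bounded_linear[OF bounded_linear_inner_left assms(1)]) simp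
      moreover have "Ck_on k S (\<lambda>x. dd g (f x) b)"
        by (intro Suc.IH f) (use Suc.prems(1) in auto)
      ultimately show "Ck_on k S (\<lambda>x. (dd f x v \<bullet> b) *\<^sub>R dd g (f x) b)"
        by (rule Ck_on_bilinear[OF bounded_bilinear_scaleR assms(1)])
    qed
  qed
qed

section \<open>Smooth maps and rules for their derivatives\<close>

lemma smooth_on_Ck: "smooth_on S f \<Longrightarrow> Ck_on k S f" by (simp add: smooth_on_def)

lemma smooth_on_has_derivative: "smooth_on S f \<Longrightarrow> x \<in> S \<Longrightarrow> (f has_derivative dd f x) (at x)"
  using Ck_on_Suc_has_derivative smooth_on_Ck by blast

lemma smooth_on_differentiable: "smooth_on S f \<Longrightarrow> x \<in> S \<Longrightarrow> f differentiable (at x)"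
  using smooth_on_has_derivative differentiable_def by blast

lemma smooth_on_linear_dd: "smooth_on S f \<Longrightarrow> x \<in> S \<Longrightarrow> linear (dd f x)"
  using smooth_on_has_derivative has_derivative_linear by blast

lemma smooth_on_continuous: "smooth_on S f \<Longrightarrow> continuous_on S f"
  using Ck_on_continuous smooth_on_Ck by blast

lemma smooth_on_dd: "smooth_on S f \<Longrightarrow> smooth_on S (\<lambda>x. dd f x v)"
  unfolding smooth_on_def by (metis Ck_on.simps(2))

lemma smooth_on_cong:
  "open S \<Longrightarrow> (\<And>y. y \<in> S \<Longrightarrow> f y = g y) \<Longrightarrow> smooth_on S f \<longleftrightarrow> smooth_on S g"
  unfolding smooth_on_def using Ck_on_cong by blast

lemma smooth_on_subset: "smooth_on S f \<Longrightarrow> T \<subseteq> S \<Longrightarrow> smooth_on T f"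
  unfolding smooth_on_def using Ck_on_subset by blast

lemma smooth_on_const: "open S \<Longrightarrow> smooth_on S (\<lambda>x. c)"
  unfolding smooth_on_def using Ck_on_const by blast

lemma smooth_on_bounded_linear:
  "bounded_linear L \<Longrightarrow> open S \<Longrightarrow> smooth_on S f \<Longrightarrow> smooth_on S (\<lambda>x. L (f x))"
  unfolding smooth_on_def using Ck_on_bounded_linear by blast

lemma smooth_on_id: "open S \<Longrightarrow> smooth_on S (\<lambda>x. x)"
proof -
  assume S: "open S"
  have "Ck_on k S (\<lambda>x. x)" for k
    by (cases k) (use S in \<open>auto intro!: Ck_on_SucI[where f' = "\<lambda>_ v. v"] Ck_on_const\<close>)
  then show ?thesis by (simp add: smooth_on_def)
qed

lemma smooth_on_linear: "linear L \<Longrightarrow> open S \<Longrightarrow> smooth_on S L"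
  using smooth_on_bounded_linear[of L S "\<lambda>x. x"] smooth_on_id linear_conv_bounded_linear by auto

lemma smooth_on_add:
  "open S \<Longrightarrow> smooth_on S f \<Longrightarrow> smooth_on S g \<Longrightarrow> smooth_on S (\<lambda>x. f x + g x)"
  unfolding smooth_on_def using Ck_on_add by blast

lemma smooth_on_sum:
  "open S \<Longrightarrow> (\<And>i. i \<in> I \<Longrightarrow> smooth_on S (f i)) \<Longrightarrow> smooth_on S (\<lambda>x. \<Sum>i\<in>I. f i x)"
  unfolding smooth_on_def by (simp add: Ck_on_sum)

lemma smooth_on_bilinear:
  "bounded_bilinear b \<Longrightarrow> open S \<Longrightarrow> smooth_on S f \<Longrightarrow> smooth_on S g \<Longrightarrow> smooth_on S (\<lambda>x. b (f x) (g x))"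
  unfolding smooth_on_def using Ck_on_bilinear by blast

lemmas smooth_on_inner = smooth_on_bilinear[OF bounded_bilinear_inner]
lemmas smooth_on_scaleR = smooth_on_bilinear[OF bounded_bilinear_scaleR]
lemmas smooth_on_cmul = smooth_on_bounded_linear[OF bounded_linear_scaleR_right]

lemma smooth_on_minus: "open S \<Longrightarrow> smooth_on S f \<Longrightarrow> smooth_on S (\<lambda>x. - f x)"
  using smooth_on_cmul[of S f "-1"] by simp

lemma smooth_on_diff:
  "open S \<Longrightarrow> smooth_on S f \<Longrightarrow> smooth_on S g \<Longrightarrow> smooth_on S (\<lambda>x. f x - g x)"
  using smooth_on_add[of S f "\<lambda>x. - g x"] smooth_on_minus[of S g] by simp

lemma smooth_on_compose:
  "open S \<Longrightarrow> open T \<Longrightarrow> f ` S \<subseteq> T \<Longrightarrow> smooth_on T g \<Longrightarrow> smooth_on S f \<Longrightarrow> smooth_on S (\<lambda>x. g (f x))"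
  unfolding smooth_on_def using Ck_on_compose by blast

lemma dd_compose:
  assumes "smooth_on T g" "smooth_on S f" "x \<in> S" "f x \<in> T"
  shows "dd (\<lambda>x. g (f x)) x v = dd g (f x) (dd f x v)"
  using dd_eq[OF has_derivative_compose[OF smooth_on_has_derivative[OF assms(2,3)]
        smooth_on_has_derivative[OF assms(1,4)]]] by simp

lemma dd_inner:
  assumes "f differentiable (at x)" "g differentiable (at x)"
  shows "dd (\<lambda>y. f y \<bullet> g y) x v = dd f x v \<bullet> g x + f x \<bullet> dd g x v"
  using dd_eq[OF has_derivative_inner[OF has_derivative_dd[OF assms(1)] has_derivative_dd[OF assms(2)]]]
  by simp

lemma dd_add:
  assumes "f differentiable (at x)" "g differentiable (at x)"
  shows "dd (\<lambda>y. f y + g y) x v = dd f x v + dd g x v"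
  using dd_eq[OF has_derivative_add[OF has_derivative_dd[OF assms(1)] has_derivative_dd[OF assms(2)]]]
  by simp

lemma dd_diff:
  assumes "f differentiable (at x)" "g differentiable (at x)"
  shows "dd (\<lambda>y. f y - g y) x v = dd f x v - dd g x v"
  using dd_eq[OF has_derivative_diff[OF has_derivative_dd[OF assms(1)] has_derivative_dd[OF assms(2)]]]
  by simp

lemma dd_bounded_linear:
  assumes "bounded_linear L" "f differentiable (at x)"
  shows "dd (\<lambda>y. L (f y)) x v = L (dd f x v)"
  using dd_eq[OF bounded_linear.has_derivative[OF assms(1) has_derivative_dd[OF assms(2)]]] by simp

lemmas dd_cmul = dd_bounded_linear[OF bounded_linear_scaleR_right]

lemma dd_const_on:
  assumes "open S" "x \<in> S" "\<And>y. y \<in> S \<Longrightarrow> f y = c"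
  shows "dd f x v = 0"
  using dd_cong[OF assms(1,2), of f "\<lambda>_. c"] assms(3) by simp

text \<open>
  The map \<open>(z, v) \<mapsto> (z, K z\<^sub>0 (M z v))\<close> has the inverse \<open>(z, v) \<mapsto> (z, K z (M z\<^sub>0 v))\<close>; invariance
  of domain makes the latter continuous and the inverse function theorem differentiable, so that no
  norm estimates for \<open>K\<close> are needed.
\<close>

lemma Ck_on_linear_solve:
  fixes M :: "'z::euclidean_space \<Rightarrow> 'a::euclidean_space \<Rightarrow> 'b::euclidean_space"
  assumes "open S" and lin: "\<And>z. z \<in> S \<Longrightarrow> linear (M z)"
    and KM: "\<And>z v. z \<in> S \<Longrightarrow> K z (M z v) = v" and MK: "\<And>z w. z \<in> S \<Longrightarrow> M z (K z w) = w"
    and "\<And>v. Ck_on k S (\<lambda>z. M z v)"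
  shows "Ck_on k S (\<lambda>z. K z w)"
  using assms(5)
proof (induction k arbitrary: w)
  have linK: "linear (K z)" if "z \<in> S" for z
  proof (rule linearI)
    show "K z (x + y) = K z x + K z y" for x y
      using KM[OF that, of "K z x + K z y"] MK[OF that] linear_add[OF lin[OF that]] by simp
    show "K z (c *\<^sub>R x) = c *\<^sub>R K z x" for c x
      using KM[OF that, of "c *\<^sub>R K z x"] MK[OF that] linear_cmul[OF lin[OF that]] by simp
  qed
  \<comment> \<open>Written in the basis so that z and v are separated: continuity and derivative
    then follow from those of the maps \<open>\<lambda>z. M z b\<close> with fixed b.\<close>
  define \<Theta> where "\<Theta> z0 = (\<lambda>(z, v). (z, \<Sum>b\<in>Basis. (v \<bullet> b) *\<^sub>R K z0 (M z b)))" for z0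
  define \<Xi> where "\<Xi> z0 = (\<lambda>(z, v). (z, K z (M z0 v)))" for z0
  have \<Theta>: "\<Theta> z0 (z, v) = (z, K z0 (M z v))" if "z0 \<in> S" "z \<in> S" for z0 z v
    using linear_Basis_expand[OF linear_compose[OF lin[OF that(2)] linK[OF that(1)]], of v]
    by (simp add: \<Theta>_def o_def)
  have \<Xi>\<Theta>: "\<Xi> z0 (\<Theta> z0 p) = p" if "z0 \<in> S" "p \<in> S \<times> UNIV" for z0 p
    using that by (auto simp: \<Theta> \<Xi>_def KM MK)
  have \<Theta>im: "\<Theta> z0 ` (S \<times> UNIV) = S \<times> UNIV" if "z0 \<in> S" for z0
  proof -
    have "(z, v) = \<Theta> z0 (z, K z (M z0 v))" if "z \<in> S" for z v
      using that \<open>z0 \<in> S\<close> by (simp add: \<Theta> KM MK)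
    then show ?thesis using \<Theta> that by (force simp: image_iff)
  qed
  have blK: "bounded_linear (K z)" if "z \<in> S" for z
    using linK that linear_conv_bounded_linear by blast
  have cont\<Theta>: "continuous_on (S \<times> UNIV) (\<Theta> z0)" if "z0 \<in> S" "\<And>v. continuous_on S (\<lambda>z. M z v)" for z0
  proof -
    have "continuous_on (S \<times> UNIV) (\<lambda>p. K z0 (M (fst p) b))" for b
      using that by (intro bounded_linear.continuous_on[OF blK]
         continuous_on_compose2[OF that(2)] continuous_on_fst continuous_on_id) auto
    then show ?thesis unfolding \<Theta>_def case_prod_beta by (intro continuous_intros)
  qed
  { case 0
    show ?case
    proof (cases "S = {}")
      case False
      then obtain z0 where z0: "z0 \<in> S" by auto
      have inj: "inj_on (\<Theta> z0) (S \<times> UNIV)" using \<Xi>\<Theta>[OF z0] by (metis inj_onI)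
      have op: "open (S \<times> (UNIV::'a set))" using assms(1) by (simp add: open_Times)
      have cM: "\<And>v. continuous_on S (\<lambda>z. M z v)" using 0 by simp
      \<comment> \<open>Composition with \<open>K z0\<close> has made \<open>\<Theta> z0\<close> an
        injective map of one space into itself, as invariance of domain requires.\<close>
      have "continuous_on (\<Theta> z0 ` (S \<times> UNIV)) (\<Xi> z0)"
        by (rule continuous_on_inverse_open[OF op cont\<Theta>[OF z0 cM] _ \<Xi>\<Theta>[OF z0]]) simp
      then have "continuous_on S (\<lambda>z. \<Xi> z0 (z, K z0 w))"
        unfolding \<Theta>im[OF z0] by (rule continuous_on_compose2) (auto intro: continuous_intros)
      then have "continuous_on S (\<lambda>z. snd (\<Xi> z0 (z, K z0 w)))" by (rule continuous_on_snd)
      then show ?thesis by (simp add: \<Xi>_def MK z0)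
    qed auto }
  { case (Suc k)
    have Mder: "((\<lambda>z. M z v) has_derivative dd (\<lambda>z. M z v) z) (at z)" if "z \<in> S" for z v
      using Suc.prems Ck_on_Suc_has_derivative that by blast
    have cM: "continuous_on S (\<lambda>z. M z v)" for v using Suc.prems Ck_on_continuous by blast
    have diff: "(\<lambda>z. K z w) differentiable (at z0)" if z0: "z0 \<in> S" for z0 w
    proof -
      \<comment> \<open>The off-diagonal block of the derivative of \<open>\<Theta> z0\<close> at
        \<open>(z0, K z0 w)\<close>. The diagonal blocks are identities because \<open>K z0\<close>
        inverts \<open>M z0\<close>, so the derivative is inverted by changing the sign of
        A.\<close>
      define A where "A u = (\<Sum>b\<in>Basis. (K z0 w \<bullet> b) *\<^sub>R K z0 (dd (\<lambda>z. M z b) z0 u))" for u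
      have linA: "linear A" unfolding A_def
        using linear_compose[OF has_derivative_linear[OF Mder[OF z0]] linK[OF z0]]
        by (intro linear_compose_sum ballI linear_compose_scale_right) (auto simp: o_def)
      have id: "(\<Sum>b\<in>Basis. (v \<bullet> b) *\<^sub>R K z0 (M z0 b)) = v" for v
        by (simp add: KM z0 euclidean_representation)
      have der: "(\<Theta> z0 has_derivative (\<lambda>(u, v). (u, v + A u))) (at (z0, K z0 w))"
      proof -
        have "((\<lambda>p. M (fst p) b) has_derivative (\<lambda>u. dd (\<lambda>z. M z b) z0 (fst u))) (at (z0, K z0 w))" for b
          by (rule has_derivative_compose[OF has_derivative_fst[OF has_derivative_ident]])
             (use Mder[OF z0] in simp)
        then have "((\<lambda>p. K z0 (M (fst p) b)) has_derivative (\<lambda>u. K z0 (dd (\<lambda>z. M z b) z0 (fst u))))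
            (at (z0, K z0 w))" for b
          by (rule bounded_linear.has_derivative[OF blK[OF z0]])
        then have "((\<lambda>p. (fst p, \<Sum>b\<in>Basis. (snd p \<bullet> b) *\<^sub>R K z0 (M (fst p) b))) has_derivative
           (\<lambda>u. (fst u, \<Sum>b\<in>Basis. (K z0 w \<bullet> b) *\<^sub>R K z0 (dd (\<lambda>z. M z b) z0 (fst u))
               + (snd u \<bullet> b) *\<^sub>R K z0 (M z0 b)))) (at (z0, K z0 w))"
          by (auto intro!: derivative_eq_intros simp: A_def sum.distrib id)
        then show ?thesis by (simp add: \<Theta>_def case_prod_beta' sum.distrib id A_def add.commute)
      qed
      have "(\<Xi> z0 has_derivative (\<lambda>(u, v). (u, v - A u))) (at (\<Theta> z0 (z0, K z0 w)))"
        by (rule has_derivative_inverse_strong[OF _ _ cont\<Theta>[OF z0 cM] \<Xi>\<Theta>[OF z0] der])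
          (auto simp: z0 assms(1) open_Times)
      then have X: "(\<Xi> z0 has_derivative (\<lambda>(u, v). (u, v - A u))) (at (z0, K z0 w))"
        by (simp add: \<Theta> z0 MK)
      have "((\<lambda>z. snd (\<Xi> z0 (z, K z0 w))) has_derivative (\<lambda>u. - A u)) (at z0)"
      proof -
        have "((\<lambda>z. (z, K z0 w)) has_derivative (\<lambda>u. (u, 0))) (at z0)"
          by (intro has_derivative_Pair has_derivative_ident has_derivative_const)
        from has_derivative_snd[OF has_derivative_compose[where f = "\<lambda>z. (z, K z0 w)" and g = "\<Xi> z0", OF this X]]
        show ?thesis by simp
      qed
      then show ?thesis by (auto simp: \<Xi>_def MK z0 differentiable_def)
    qed
    \<comment> \<open>The formula -K (dM u) K w for the derivative of an inverse, expanded in bases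
      so that only \<open>\<lambda>z. K z c\<close> with fixed c occurs and the induction hypothesis
      applies.\<close>
    define K' where "K' z u = - (\<Sum>b\<in>Basis. (K z w \<bullet> b) *\<^sub>R (\<Sum>c\<in>Basis. (dd (\<lambda>z. M z b) z u \<bullet> c) *\<^sub>R K z c))"
      for z u
    have K': "dd (\<lambda>z. K z w) z u = K' z u" if z: "z \<in> S" for z u
    proof -
      have dK: "((\<lambda>z. K z w) has_derivative dd (\<lambda>z. K z w) z) (at z)"
        using diff[OF z] has_derivative_dd by blast
      have "((\<lambda>z. \<Sum>b\<in>Basis. (K z w \<bullet> b) *\<^sub>R M z b) has_derivative (\<lambda>u. \<Sum>b\<in>Basis. (K z w \<bullet> b) *\<^sub>R dd (\<lambda>z. M z b) z u
           + (dd (\<lambda>z. K z w) z u \<bullet> b) *\<^sub>R M z b)) (at z)"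
        by (auto intro!: derivative_eq_intros dK Mder[OF z])
      moreover have "((\<lambda>z. \<Sum>b\<in>Basis. (K z w \<bullet> b) *\<^sub>R M z b) has_derivative (\<lambda>u. 0)) (at z)"
      proof -
        have "(\<Sum>b\<in>Basis. (K y w \<bullet> b) *\<^sub>R M y b) = w" if "y \<in> S" for y
          using linear_Basis_expand[OF lin[OF that], of "K y w"] MK that by simp
        then show ?thesis
          using has_derivative_cong_open[OF assms(1) z, of _ "\<lambda>_. w"] by simp
      qed
      ultimately have "(\<Sum>b\<in>Basis. (K z w \<bullet> b) *\<^sub>R dd (\<lambda>z. M z b) z u
           + (dd (\<lambda>z. K z w) z u \<bullet> b) *\<^sub>R M z b) = 0"
        using has_derivative_unique[THEN fun_cong, of _ _ _ _ u] by blast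
      then have "(\<Sum>b\<in>Basis. (K z w \<bullet> b) *\<^sub>R dd (\<lambda>z. M z b) z u)
           + (\<Sum>b\<in>Basis. (dd (\<lambda>z. K z w) z u \<bullet> b) *\<^sub>R M z b) = 0"
        by (simp only: sum.distrib)
      then have "M z (dd (\<lambda>z. K z w) z u) = - (\<Sum>b\<in>Basis. (K z w \<bullet> b) *\<^sub>R dd (\<lambda>z. M z b) z u)"
        using linear_Basis_expand[OF lin[OF z], of "dd (\<lambda>z. K z w) z u"]
        by (simp add: eq_neg_iff_add_eq_0 add.commute)
      then have "dd (\<lambda>z. K z w) z u = K z (- (\<Sum>b\<in>Basis. (K z w \<bullet> b) *\<^sub>R dd (\<lambda>z. M z b) z u))"
        using KM[OF z] by metis
      also have "\<dots> = - (\<Sum>b\<in>Basis. (K z w \<bullet> b) *\<^sub>R K z (dd (\<lambda>z. M z b) z u))"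
        by (simp add: linear_neg[OF linK[OF z]] linear_sum[OF linK[OF z]] linear_cmul[OF linK[OF z]])
      finally show ?thesis
        unfolding K'_def by (simp only: linear_Basis_expand[OF linK[OF z], symmetric])
    qed
    show ?case
    proof (rule Ck_on_SucI[OF assms(1)])
      show "((\<lambda>z. K z w) has_derivative K' z) (at z)" if "z \<in> S" for z
      proof -
        have "dd (\<lambda>z. K z w) z = K' z" using K'[OF that] by (rule ext)
        then show ?thesis using has_derivative_dd[OF diff[OF that, of w]] by simp
      qed
      have IH: "Ck_on k S (\<lambda>z. K z c)" for c
        using Suc Ck_on_SucD by blast
      show "Ck_on k S (\<lambda>z. K' z u)" for u
        unfolding K'_def
        by (intro Ck_on_bounded_linear[OF bounded_linear_minus] bounded_linear_ident
            Ck_on_sum Ck_on_bilinear[OF bounded_bilinear_scaleR]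
            Ck_on_bounded_linear[OF bounded_linear_inner_left] IH assms(1))
           (use Suc.prems in auto)
    qed }
qed

lemma smooth_on_linear_solve:
  fixes M :: "'z::euclidean_space \<Rightarrow> 'a::euclidean_space \<Rightarrow> 'b::euclidean_space"
  assumes "open S" "\<And>z. z \<in> S \<Longrightarrow> linear (M z)"
    "\<And>z v. z \<in> S \<Longrightarrow> K z (M z v) = v" "\<And>z w. z \<in> S \<Longrightarrow> M z (K z w) = w"
    "\<And>v. smooth_on S (\<lambda>z. M z v)"
  shows "smooth_on S (\<lambda>z. K z w)"
  unfolding smooth_on_def using Ck_on_linear_solve[OF assms(1-4)] smooth_on_Ck[OF assms(5)] by simp

text \<open>The C^1 theorem is bootstrapped: the derivative of \<psi> at z is the inverse of
  \<open>dd f (\<psi> z)\<close>, and by \<open>Ck_on_linear_solve\<close> this inverse is as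
  regular in z as \<psi> itself.\<close>

lemma smooth_inverse_function:
  fixes f :: "'a::euclidean_space \<Rightarrow> 'a"
  assumes "open S" "smooth_on S f" "x0 \<in> S" "inj (dd f x0)"
  obtains U V \<psi> where "open U" "U \<subseteq> S" "x0 \<in> U" "open V" "f ` U = V" "\<psi> ` V = U"
    "\<And>x. x \<in> U \<Longrightarrow> \<psi> (f x) = x" "\<And>z. z \<in> V \<Longrightarrow> f (\<psi> z) = z" "smooth_on V \<psi>"
    "\<And>z v. z \<in> V \<Longrightarrow> dd f (\<psi> z) (dd \<psi> z v) = v" "\<And>z v. z \<in> V \<Longrightarrow> dd \<psi> z (dd f (\<psi> z) v) = v"
proof -
  define f' where "f' x = Blinfun (dd f x)" for x
  have f': "blinfun_apply (f' x) = dd f x" if "x \<in> S" for x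
    unfolding f'_def using bounded_linear_Blinfun_apply smooth_on_has_derivative[OF assms(2) that]
      has_derivative_bounded_linear by blast
  obtain L where L: "linear L" "L \<circ> dd f x0 = id"
    using linear_injective_left_inverse[OF smooth_on_linear_dd[OF assms(2,3)] assms(4)] by blast
  have inv: "Blinfun L o\<^sub>L f' x0 = id_blinfun"
    using L by (intro blinfun_eqI)
      (auto simp: f'[OF assms(3)] bounded_linear_Blinfun_apply linear_conv_bounded_linear fun_eq_iff)
  have cont: "continuous_on S f'"
  proof (rule continuous_on_blinfun_componentwise)
    fix i :: 'a assume "i \<in> Basis"
    have "continuous_on S (\<lambda>x. dd f x i)"
      using smooth_on_continuous[OF smooth_on_dd[OF assms(2)]] .
    then show "continuous_on S (\<lambda>x. blinfun_apply (f' x) i)"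
      using f' by (simp cong: continuous_on_cong)
  qed
  have der: "(f has_derivative blinfun_apply (f' x)) (at x)" if "x \<in> S" for x
    using f'[OF that] smooth_on_has_derivative[OF assms(2) that] by simp
  obtain U V \<psi> \<psi>' where UV: "open U" "U \<subseteq> S" "x0 \<in> U" "open V" "f x0 \<in> V" "homeomorphism U V f \<psi>"
    and d: "\<And>y. y \<in> V \<Longrightarrow> (\<psi> has_derivative (\<psi>' y)) (at y)"
    "\<And>y. y \<in> V \<Longrightarrow> \<psi>' y = Hilbert_Choice.inv (blinfun_apply (f'(\<psi> y)))"
    "\<And>y. y \<in> V \<Longrightarrow> bij (blinfun_apply (f'(\<psi> y)))"
    using inverse_function_theorem[OF assms(1) der cont assms(3) inv] by metis
  have \<psi>: "\<psi> ` V = U" "f ` U = V" "\<And>x. x \<in> U \<Longrightarrow> \<psi> (f x) = x" "\<And>z. z \<in> V \<Longrightarrow> f (\<psi> z) = z"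
    using UV(6) by (auto simp: homeomorphism_def)
  have \<psi>S: "\<psi> z \<in> S" if "z \<in> V" for z using \<psi>(1) UV(2) that by auto
  have inv1: "dd f (\<psi> z) (\<psi>' z v) = v" "\<psi>' z (dd f (\<psi> z) v) = v" if "z \<in> V" for z v
    using d(2,3)[OF that] f'[OF \<psi>S[OF that]]
    by (auto simp: bij_is_surj surj_f_inv_f bij_is_inj inv_f_f)
  have "Ck_on k V \<psi>" for k
  proof (induction k)
    case 0
    then show ?case using UV(6) by (simp add: homeomorphism_def)
  next
    case (Suc k)
    show ?case
    proof (rule Ck_on_SucI[OF UV(4) d(1)])
      show "Ck_on k V (\<lambda>z. \<psi>' z v)" for v
      proof (rule Ck_on_linear_solve[where M = "\<lambda>z. dd f (\<psi> z)", OF UV(4)])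
        show "Ck_on k V (\<lambda>z. dd f (\<psi> z) v)" for v
          by (rule Ck_on_compose[OF UV(4) assms(1)])
            (use Suc \<psi>S smooth_on_Ck[OF smooth_on_dd[OF assms(2)]] in auto)
      qed (use inv1 smooth_on_linear_dd[OF assms(2) \<psi>S] in auto)
    qed
  qed
  then have "smooth_on V \<psi>" by (simp add: smooth_on_def)
  moreover have "dd \<psi> z = \<psi>' z" if "z \<in> V" for z using d(1)[OF that] dd_eq by blast
  ultimately show thesis
    using that[of U V \<psi>] UV \<psi> inv1 by metis
qed

section \<open>Symmetry of second derivatives\<close>

lemma has_vector_derivative_line:
  fixes f :: "'a::euclidean_space \<Rightarrow> 'b::euclidean_space"
  assumes "f differentiable (at (c + s *\<^sub>R u))"
  shows "((\<lambda>s. f (c + s *\<^sub>R u)) has_vector_derivative dd f (c + s *\<^sub>R u) u) (at s)"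
proof -
  have "((\<lambda>s. f (c + s *\<^sub>R u)) has_derivative (\<lambda>h. dd f (c + s *\<^sub>R u) (h *\<^sub>R u))) (at s)"
    by (rule has_derivative_compose[where g = f and f = "\<lambda>s. c + s *\<^sub>R u",
          OF _ has_derivative_dd[OF assms]])
      (auto intro!: derivative_eq_intros)
  then show ?thesis
    using linear_cmul[OF has_derivative_linear[OF has_derivative_dd[OF assms]]]
    by (simp add: has_vector_derivative_def)
qed

text \<open>The mean value theorem, applied along u and then along v. The second difference is
  symmetric in u and v although the right side is not, which is how mixed derivatives get
  compared.\<close>

lemma second_difference_mean_value:
  fixes f :: "'a::euclidean_space \<Rightarrow> real"
  assumes "smooth_on S f" "h > 0"
    and "\<And>s t. 0 \<le> s \<Longrightarrow> s \<le> h \<Longrightarrow> 0 \<le> t \<Longrightarrow> t \<le> h \<Longrightarrow> x + s *\<^sub>R u + t *\<^sub>R v \<in> S"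
  obtains s t where "0 < s" "s < h" "0 < t" "t < h"
    "f (x + h *\<^sub>R u + h *\<^sub>R v) - f (x + h *\<^sub>R u) - f (x + h *\<^sub>R v) + f x
      = h * (h * dd (\<lambda>y. dd f y u) (x + s *\<^sub>R u + t *\<^sub>R v) v)"
proof -
  have line: "((\<lambda>s. \<phi> (c + s *\<^sub>R w)) has_real_derivative dd \<phi> (c + s *\<^sub>R w) w) (at s)"
    if "smooth_on S \<phi>" "c + s *\<^sub>R w \<in> S" for \<phi> :: "'a \<Rightarrow> real" and c s w
    using has_vector_derivative_line[OF smooth_on_differentiable[OF that]]
    by (simp add: has_real_derivative_iff_has_vector_derivative)
  define p where "p s = f ((x + h *\<^sub>R v) + s *\<^sub>R u) - f (x + s *\<^sub>R u)" for s
  have "DERIV p s :> dd f ((x + h *\<^sub>R v) + s *\<^sub>R u) u - dd f (x + s *\<^sub>R u) u"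
    if "0 \<le> s" "s \<le> h" for s
    unfolding p_def using that assms(2) assms(3)[of s h] assms(3)[of s 0]
    by (intro DERIV_diff line assms(1)) (auto simp: algebra_simps)
  then obtain s where s: "0 < s" "s < h"
    "p h - p 0 = h * (dd f ((x + h *\<^sub>R v) + s *\<^sub>R u) u - dd f (x + s *\<^sub>R u) u)"
    using MVT2[OF assms(2), of p "\<lambda>s. dd f ((x + h *\<^sub>R v) + s *\<^sub>R u) u - dd f (x + s *\<^sub>R u) u"] by auto
  have "DERIV (\<lambda>t. dd f ((x + s *\<^sub>R u) + t *\<^sub>R v) u) t :>
      dd (\<lambda>y. dd f y u) ((x + s *\<^sub>R u) + t *\<^sub>R v) v" if "0 \<le> t" "t \<le> h" for t
    using that s assms(3)[of s t] by (intro line[OF smooth_on_dd[OF assms(1)]]) auto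
  then obtain t where t: "0 < t" "t < h"
    "dd f ((x + s *\<^sub>R u) + h *\<^sub>R v) u - dd f ((x + s *\<^sub>R u) + 0 *\<^sub>R v) u
       = h * dd (\<lambda>y. dd f y u) ((x + s *\<^sub>R u) + t *\<^sub>R v) v"
    using MVT2[OF assms(2), of "\<lambda>t. dd f ((x + s *\<^sub>R u) + t *\<^sub>R v) u"
        "\<lambda>t. dd (\<lambda>y. dd f y u) ((x + s *\<^sub>R u) + t *\<^sub>R v) v"]
    by (auto simp del: scale_zero_left)
  show thesis
    by (rule that[OF s(1,2) t(1,2)]) (use s(3) t(3) in \<open>simp add: p_def algebra_simps\<close>)
qed

lemma dd_symmetric_real:
  fixes f :: "'a::euclidean_space \<Rightarrow> real"
  assumes "open S" "smooth_on S f" "x \<in> S"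
  shows "dd (\<lambda>y. dd f y u) x v = dd (\<lambda>y. dd f y v) x u"
proof -
  define G where "G u v y = dd (\<lambda>y. dd f y u) y v" for u v y
  have cont: "isCont (G u v) x" for u v
    using smooth_on_continuous[OF smooth_on_dd[OF smooth_on_dd[OF assms(2), of u], of v]] assms(1,3)
    unfolding G_def[abs_def] by (simp add: continuous_on_eq_continuous_at)
  have "dist (G u v x) (G v u x) < e" if "e > 0" for e
  proof -
    have e2: "e / 2 > 0" using that by simp
    obtain r1 where r1: "r1 > 0" "\<And>y. dist y x < r1 \<Longrightarrow> dist (G u v y) (G u v x) < e / 2"
      using cont[of u v] e2 unfolding continuous_at_eps_delta by meson
    obtain r2 where r2: "r2 > 0" "\<And>y. dist y x < r2 \<Longrightarrow> dist (G v u y) (G v u x) < e / 2"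
      using cont[of v u] e2 unfolding continuous_at_eps_delta by meson
    obtain r3 where r3: "r3 > 0" "ball x r3 \<subseteq> S" using assms(1,3) open_contains_ball by blast
    define r where "r = min r1 (min r2 r3)"
    \<comment> \<open>Small enough for the whole parallelogram spanned by h u and h v to stay within
      r of x; the added 1 covers u = v = 0.\<close>
    define h where "h = r / (2 * (norm u + norm v + 1))"
    have r: "r > 0" using r1 r2 r3 by (simp add: r_def)
    have h: "h > 0" using r by (simp add: h_def add_nonneg_pos)
    have hr: "h * (norm u + norm v) < r"
    proof -
      have "h * (norm u + norm v) \<le> h * (norm u + norm v + 1)" using h by simp
      also have "h * (norm u + norm v + 1) = r / 2"
      proof -
        have "norm u + norm v + 1 \<noteq> 0" using norm_ge_zero[of u] norm_ge_zero[of v] by linarith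
        then show ?thesis unfolding h_def by (simp add: divide_eq_eq)
      qed
      finally show ?thesis using r by simp
    qed
    have close: "dist (x + s *\<^sub>R a + t *\<^sub>R b) x < r"
      if "0 \<le> s" "s \<le> h" "0 \<le> t" "t \<le> h" "(a, b) \<in> {(u, v), (v, u)}" for s t a b
    proof -
      have "norm (s *\<^sub>R a + t *\<^sub>R b) \<le> s * norm a + t * norm b"
        using norm_triangle_ineq[of "s *\<^sub>R a" "t *\<^sub>R b"] that by simp
      also have "\<dots> \<le> h * norm a + h * norm b"
        using that by (intro add_mono mult_right_mono) auto
      also have "\<dots> < r" using hr that(5) by (auto simp: algebra_simps)
      finally show ?thesis by (simp add: dist_norm)
    qed
    have inS: "x + s *\<^sub>R a + t *\<^sub>R b \<in> S"
      if "0 \<le> s" "s \<le> h" "0 \<le> t" "t \<le> h" "(a, b) \<in> {(u, v), (v, u)}" for s t a b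
      using close[OF that] r3(2) by (auto simp: r_def dist_commute)
    obtain s t where st: "0 < s" "s < h" "0 < t" "t < h"
      "f (x + h *\<^sub>R u + h *\<^sub>R v) - f (x + h *\<^sub>R u) - f (x + h *\<^sub>R v) + f x
        = h * (h * G u v (x + s *\<^sub>R u + t *\<^sub>R v))"
      unfolding G_def using second_difference_mean_value[OF assms(2) h, of x u v] inS by blast
    obtain s' t' where st': "0 < s'" "s' < h" "0 < t'" "t' < h"
      "f (x + h *\<^sub>R v + h *\<^sub>R u) - f (x + h *\<^sub>R v) - f (x + h *\<^sub>R u) + f x
        = h * (h * G v u (x + s' *\<^sub>R v + t' *\<^sub>R u))"
      unfolding G_def using second_difference_mean_value[OF assms(2) h, of x v u] inS by blast
    have "h * (h * G u v (x + s *\<^sub>R u + t *\<^sub>R v)) = h * (h * G v u (x + s' *\<^sub>R v + t' *\<^sub>R u))"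
      using st(5) st'(5) by (simp add: algebra_simps)
    then have "G u v (x + s *\<^sub>R u + t *\<^sub>R v) = G v u (x + s' *\<^sub>R v + t' *\<^sub>R u)" using h by simp
    moreover have "dist (G u v (x + s *\<^sub>R u + t *\<^sub>R v)) (G u v x) < e / 2"
      using close[of s t u v] st by (intro r1) (auto simp: r_def)
    moreover have "dist (G v u (x + s' *\<^sub>R v + t' *\<^sub>R u)) (G v u x) < e / 2"
      using close[of s' t' v u] st' by (intro r2) (auto simp: r_def)
    ultimately show ?thesis by (smt (verit) dist_commute dist_triangle field_sum_of_halves)
  qed
  then have "dist (G u v x) (G v u x) \<le> 0" by (metis less_irrefl not_le)
  then show ?thesis by (simp add: G_def)
qed

lemma dd_symmetric:
  assumes "open S" "smooth_on S f" "x \<in> S"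
  shows "dd (\<lambda>y. dd f y u) x v = dd (\<lambda>y. dd f y v) x u"
proof (rule euclidean_eqI)
  fix b :: 'b assume "b \<in> Basis"
  have fb: "smooth_on S (\<lambda>y. f y \<bullet> b)"
    using smooth_on_bounded_linear[OF bounded_linear_inner_left assms(1,2)] .
  have "dd (\<lambda>y. dd f y u) x v \<bullet> b = dd (\<lambda>y. dd (\<lambda>z. f z \<bullet> b) y u) x v" for u v
  proof -
    have "dd (\<lambda>z. f z \<bullet> b) y u = dd f y u \<bullet> b" if "y \<in> S" for y
      by (rule dd_bounded_linear[OF bounded_linear_inner_left smooth_on_differentiable[OF assms(2) that]])
    then have "dd (\<lambda>y. dd (\<lambda>z. f z \<bullet> b) y u) x = dd (\<lambda>y. dd f y u \<bullet> b) x"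
      by (intro dd_cong[OF assms(1,3)])
    then show ?thesis
      using dd_bounded_linear[OF bounded_linear_inner_left
          smooth_on_differentiable[OF smooth_on_dd[OF assms(2)] assms(3)]] by metis
  qed
  then show "dd (\<lambda>y. dd f y u) x v \<bullet> b = dd (\<lambda>y. dd f y v) x u \<bullet> b"
    using dd_symmetric_real[OF assms(1) fb assms(3)] by metis
qed

text \<open>Bootstrapping: if \<phi> is C^k, then so is its derivative \<open>G (\<phi> t)\<close>,
  and \<phi> is C^(k+1).\<close>

lemma smooth_on_ode:
  fixes \<phi> G :: "real \<Rightarrow> real"
  assumes "open S" "open T" "\<phi> ` S \<subseteq> T" "smooth_on T G"
    "\<And>t. t \<in> S \<Longrightarrow> (\<phi> has_real_derivative G (\<phi> t)) (at t)"
  shows "smooth_on S \<phi>"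
proof -
  have "Ck_on k S \<phi>" for k
  proof (induction k)
    case 0
    have "continuous_on S \<phi>"
      by (rule continuous_at_imp_continuous_on) (use assms(5) DERIV_isCont in blast)
    then show ?case by simp
  next
    case (Suc k)
    show ?case
    proof (rule Ck_on_SucI[OF assms(1)])
      show "(\<phi> has_derivative (\<lambda>v. v *\<^sub>R G (\<phi> t))) (at t)" if "t \<in> S" for t
        by (rule has_derivative_eq_rhs[OF assms(5)[OF that, unfolded has_field_derivative_def]]) auto
      show "Ck_on k S (\<lambda>t. v *\<^sub>R G (\<phi> t))" for v
        by (rule Ck_on_bounded_linear[OF bounded_linear_scaleR_right assms(1)
              Ck_on_compose[OF assms(1-3) smooth_on_Ck[OF assms(4)] Suc]])
    qed
  qed
  then show ?thesis by (simp add: smooth_on_def)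
qed

text \<open>Only the derivative along the segment has to vanish. This is what a map of constant rank
  offers, whose derivative is zero merely on a kernel.\<close>

lemma convex_dd_zero_eq:
  assumes "convex V" "smooth_on V f" "z \<in> V" "z' \<in> V"
    "\<And>w. w \<in> V \<Longrightarrow> dd f w (z' - z) = 0"
  shows "f z = f z'"
proof -
  have mem: "z + s *\<^sub>R (z' - z) \<in> V" if "s \<in> {0..1}" for s
    using convexD_alt[OF assms(1,3,4), of s] that by (simp add: algebra_simps)
  have "((\<lambda>s. f (z + s *\<^sub>R (z' - z))) has_derivative (\<lambda>h. 0)) (at s within {0..1})" if "s \<in> {0..1}" for s
    using has_vector_derivative_line[OF smooth_on_differentiable[OF assms(2) mem[OF that]]]
      assms(5)[OF mem[OF that]]
    by (auto simp: has_vector_derivative_def intro: has_derivative_at_withinI)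
  then obtain c where "\<forall>s\<in>{0..1}. f (z + s *\<^sub>R (z' - z)) = c"
    using has_derivative_zero_constant[of "{0..1::real}" "\<lambda>s. f (z + s *\<^sub>R (z' - z))"] by auto
  from bspec[OF this, of 0] bspec[OF this, of 1] show ?thesis by simp
qed

lemma dd_inner_const:
  assumes "open S" "y \<in> S" "smooth_on S f" "smooth_on S h" "\<And>z. z \<in> S \<Longrightarrow> f z \<bullet> h z = c"
  shows "dd f y v \<bullet> h y + f y \<bullet> dd h y v = 0"
  using dd_inner[OF smooth_on_differentiable[OF assms(3,2)] smooth_on_differentiable[OF assms(4,2)], of v]
    dd_const_on[OF assms(1,2), of "\<lambda>z. f z \<bullet> h z" c v] assms(5) by simp

lemma dd_lincomb:
  assumes "f differentiable (at y)" "h differentiable (at y)"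
  shows "dd (\<lambda>y. a *\<^sub>R f y + b *\<^sub>R h y) y v = a *\<^sub>R dd f y v + b *\<^sub>R dd h y v"
proof -
  have "((\<lambda>y. a *\<^sub>R f y + b *\<^sub>R h y) has_derivative (\<lambda>v. a *\<^sub>R dd f y v + b *\<^sub>R dd h y v)) (at y)"
    by (intro has_derivative_add has_derivative_scaleR_right has_derivative_dd assms)
  from dd_eq[OF this] show ?thesis by simp
qed

lemma dd_zero_if_constant_on_line:
  fixes f :: "'a::euclidean_space \<Rightarrow> 'b::euclidean_space"
  assumes "open V" "z \<in> V" "f differentiable (at z)"
    and const: "\<And>s. z + s *\<^sub>R d \<in> V \<Longrightarrow> f (z + s *\<^sub>R d) = f z"
  shows "dd f z d = 0"
proof -
  have "((\<lambda>s. f (z + s *\<^sub>R d)) has_vector_derivative dd f z d) (at 0)"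
    using has_vector_derivative_line[of f z 0 d] assms(3) by simp
  moreover have "((\<lambda>s. f (z + s *\<^sub>R d)) has_vector_derivative 0) (at 0)"
  proof (rule has_vector_derivative_transform_within_open)
    show "((\<lambda>s. f z) has_vector_derivative 0) (at 0)" by simp
    show "open ((\<lambda>s::real. z + s *\<^sub>R d) -` V)"
      by (intro open_vimage assms(1) continuous_intros)
    show "(0::real) \<in> (\<lambda>s. z + s *\<^sub>R d) -` V" using assms(2) by simp
  qed (use const in auto)
  ultimately show ?thesis using vector_derivative_unique_at by blast
qed

lemma dd_translate:
  assumes "f differentiable (at (z + c))"
  shows "dd (\<lambda>z. f (z + c)) z = dd f (z + c)"
proof -
  have "((\<lambda>z. z + c) has_derivative (\<lambda>v. v)) (at z)" by (auto intro!: derivative_eq_intros)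
  from has_derivative_compose[where g = f and f = "\<lambda>z. z + c", OF this has_derivative_dd[OF assms]]
  show ?thesis by (rule dd_eq)
qed

lemma smooth_linear_app:
  fixes L :: "'z::euclidean_space \<Rightarrow> 'a::euclidean_space \<Rightarrow> 'b::euclidean_space"
  assumes "open S" "\<And>z. z \<in> S \<Longrightarrow> linear (L z)" "\<And>b. smooth_on S (\<lambda>z. L z b)" "smooth_on S X"
  shows "smooth_on S (\<lambda>z. L z (X z))"
proof -
  have "smooth_on S (\<lambda>z. \<Sum>b\<in>Basis. (X z \<bullet> b) *\<^sub>R L z b)"
    by (intro smooth_on_sum smooth_on_scaleR smooth_on_inner smooth_on_const assms)
  then show ?thesis
    using smooth_on_cong[OF assms(1), of "\<lambda>z. L z (X z)" "\<lambda>z. \<Sum>b\<in>Basis. (X z \<bullet> b) *\<^sub>R L z b"]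
      linear_Basis_expand[OF assms(2)] by blast
qed

text \<open>Product rule for a moving linear map applied to a moving vector, with regularity of the
  map known only on fixed vectors.\<close>

lemma dd_linear_app:
  fixes L :: "'z::euclidean_space \<Rightarrow> 'a::euclidean_space \<Rightarrow> 'b::euclidean_space"
  assumes "open S" "y \<in> S" "\<And>z. z \<in> S \<Longrightarrow> linear (L z)" "\<And>b. smooth_on S (\<lambda>z. L z b)" "smooth_on S X"
  shows "dd (\<lambda>z. L z (X z)) y u = dd (\<lambda>z. L z (X y)) y u + L y (dd X y u)"
proof -
  have dL: "((\<lambda>z. L z b) has_derivative dd (\<lambda>z. L z b) y) (at y)" for b
    by (rule smooth_on_has_derivative[OF assms(4,2)])
  have main: "dd (\<lambda>z. L z (Y z)) y u = (\<Sum>b\<in>Basis. (Y y \<bullet> b) *\<^sub>R dd (\<lambda>z. L z b) y u) + L y (dd Y y u)"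
    if Y: "smooth_on S Y" for Y
  proof -
    have "((\<lambda>z. \<Sum>b\<in>Basis. (Y z \<bullet> b) *\<^sub>R L z b) has_derivative
        (\<lambda>u. \<Sum>b\<in>Basis. (Y y \<bullet> b) *\<^sub>R dd (\<lambda>z. L z b) y u + (dd Y y u \<bullet> b) *\<^sub>R L y b)) (at y)"
      by (auto intro!: derivative_eq_intros dL smooth_on_has_derivative[OF Y assms(2)])
    then have "((\<lambda>z. L z (Y z)) has_derivative
        (\<lambda>u. \<Sum>b\<in>Basis. (Y y \<bullet> b) *\<^sub>R dd (\<lambda>z. L z b) y u + (dd Y y u \<bullet> b) *\<^sub>R L y b)) (at y)"
      using has_derivative_cong_open[OF assms(1,2), of "\<lambda>z. L z (Y z)"
          "\<lambda>z. \<Sum>b\<in>Basis. (Y z \<bullet> b) *\<^sub>R L z b"] linear_Basis_expand[OF assms(3)] by blast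
    then have "dd (\<lambda>z. L z (Y z)) y u
        = (\<Sum>b\<in>Basis. (Y y \<bullet> b) *\<^sub>R dd (\<lambda>z. L z b) y u + (dd Y y u \<bullet> b) *\<^sub>R L y b)"
      by (rule fun_cong[OF dd_eq])
    then show ?thesis
      using linear_Basis_expand[OF assms(3)[OF assms(2)], of "dd Y y u"] by (simp add: sum.distrib)
  qed
  \<comment> \<open>The second use of \<open>main\<close>, with the constant field
    \<open>X y\<close>, identifies the sum over the basis as the derivative with the vector
    frozen.\<close>
  show ?thesis
    using main[OF assms(5)] main[OF smooth_on_const[OF assms(1)], of "X y"]
      linear_0[OF assms(3)[OF assms(2)]] by simp
qed

section \<open>Maps of constant rank\<close>

text \<open>A right inverse C of A on its range gives the first identity, and C A C gives both. It
  stands in for a choice of complements of kernel and image.\<close>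

lemma linear_generalized_inverse:
  fixes A :: "'a::euclidean_space \<Rightarrow> 'b::euclidean_space"
  assumes "linear A"
  obtains B where "linear B" "\<And>v. A (B (A v)) = A v" "\<And>w. B (A (B w)) = B w"
proof -
  obtain C where C: "linear C" "\<And>w. w \<in> range A \<Longrightarrow> A (C w) = w"
    using linear_exists_right_inverse_on[OF assms subspace_UNIV] by blast
  have "linear (C \<circ> A \<circ> C)" by (intro linear_compose C(1) assms)
  then show thesis
    by (rule that[of "C \<circ> A \<circ> C"]) (auto simp: C(2))
qed

text \<open>A right inverse C of B on the image of T is injective and maps into T, so by dimension
  it fills T; hence t = C (B t).\<close>

lemma linear_zero_of_dim_image:
  fixes B :: "'b::euclidean_space \<Rightarrow> 'a::euclidean_space"
  assumes "linear B" "subspace T" "dim (B ` T) = dim T" "t \<in> T" "B t = 0"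
  shows "t = 0"
proof -
  obtain C where C: "range C \<subseteq> T" "linear C" "\<And>w. w \<in> B ` T \<Longrightarrow> B (C w) = w"
    using linear_exists_right_inverse_on[OF assms(1,2)] by blast
  have sub: "subspace (B ` T)" by (rule linear_subspace_image[OF assms(1,2)])
  have "inj_on C (B ` T)" by (metis C(3) inj_onI)
  then have "dim (C ` (B ` T)) = dim T"
    using dim_image_eq[OF C(2)] sub span_eq_iff assms(3) by metis
  moreover have "C ` (B ` T) \<subseteq> T" using C(1) by auto
  ultimately have "C ` (B ` T) = T"
    using subspace_dim_equal[of "C ` (B ` T)" T] linear_subspace_image[OF C(2) sub] assms(2) by simp
  then obtain w where "w \<in> B ` T" "t = C w" using assms(4) by auto
  then show ?thesis using C assms(5) linear_0 by metis
qed

text \<open>A is injective on the orthogonal complement of its kernel and already attains its whole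
  range there.\<close>

lemma dim_kernel_range:
  fixes A :: "'a::euclidean_space \<Rightarrow> 'b::euclidean_space"
  assumes "linear A"
  shows "dim {v. A v = 0} + dim (range A) = DIM('a)"
proof -
  define K where "K = {v. A v = 0}"
  define C where "C = {y. \<forall>x\<in>K. orthogonal x y}"
  have K: "subspace K" unfolding K_def by (rule linear_subspace_kernel[OF assms])
  have C: "subspace C" unfolding C_def
    by (auto simp: subspace_def orthogonal_def inner_add_right)
  have "dim C + dim K = DIM('a)"
    using dim_subspace_orthogonal_to_vectors[OF K subspace_UNIV] by (simp add: C_def)
  moreover have "dim (A ` C) = dim C"
  proof (rule dim_image_eq[OF assms])
    have "inj_on A C"
    proof (rule inj_onI)
      fix x y assume xy: "x \<in> C" "y \<in> C" "A x = A y"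
      then have "x - y \<in> K" "x - y \<in> C"
        using C by (auto simp: K_def linear_diff[OF assms] subspace_diff)
      then show "x = y" by (auto simp: C_def orthogonal_def)
    qed
    then show "inj_on A (span C)" using C span_eq_iff by metis
  qed
  moreover have "A ` C = range A"
  proof -
    have "A v \<in> A ` C" for v
    proof -
      obtain y z where yz: "y \<in> span K" "\<And>w. w \<in> span K \<Longrightarrow> orthogonal z w" "v = y + z"
        using orthogonal_subspace_decomp_exists[of K v] by metis
      moreover have "span K = K" using K span_eq_iff by blast
      ultimately have "z \<in> C" "A y = 0"
        by (auto simp: C_def orthogonal_commute) (simp add: K_def)
      then show ?thesis using yz(3) by (simp add: linear_add[OF assms])
    qed
    then show ?thesis by auto
  qed
  ultimately show ?thesis by (simp add: K_def)
qed

text \<open>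
  With \<open>A\<close> the derivative at the base point and \<open>\<Lambda>\<close> a generalized inverse of \<open>A\<close>, the map
  \<open>y \<mapsto> \<Lambda> (f y) + (y - P y)\<close>, \<open>P = \<Lambda> A\<close>, has the identity as derivative there, and in the
  coordinates given by its inverse \<open>\<psi>\<close> the map \<open>f\<close> depends on the \<open>P\<close>-component only.
\<close>

lemma constant_rank:
  fixes f :: "'a::euclidean_space \<Rightarrow> 'b::euclidean_space"
  assumes "open \<Omega>" "smooth_on \<Omega> f" "y0 \<in> \<Omega>"
    and rank: "\<And>y. y \<in> \<Omega> \<Longrightarrow> dim (range (dd f y)) = r"
  obtains V :: "'a set" and \<psi> z0 A \<Lambda> where "open V" "convex V" "z0 \<in> V" "smooth_on V \<psi>" "\<psi> z0 = y0" "\<psi> ` V \<subseteq> \<Omega>"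
    "open (\<psi> ` V)" "\<And>z. z \<in> V \<Longrightarrow> bij (dd \<psi> z)"
    "linear A" "linear \<Lambda>" "\<And>v. A (\<Lambda> (A v)) = A v" "\<And>w. \<Lambda> (A (\<Lambda> w)) = \<Lambda> w"
    "dim (range A) = r"
    "\<And>z. z \<in> V \<Longrightarrow> \<Lambda> (f (\<psi> z)) = \<Lambda> (A z)"
    "\<And>z z'. z \<in> V \<Longrightarrow> z' \<in> V \<Longrightarrow> \<Lambda> (A z) = \<Lambda> (A z') \<Longrightarrow> f (\<psi> z) = f (\<psi> z')"
    "\<And>z. z \<in> V \<Longrightarrow> z0 + \<Lambda> (A (z - z0)) \<in> V"
proof -
  define A where "A = dd f y0"
  have A: "linear A" unfolding A_def by (rule smooth_on_linear_dd[OF assms(2,3)])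
  obtain \<Lambda> where \<Lambda>: "linear \<Lambda>" "\<And>v. A (\<Lambda> (A v)) = A v" "\<And>w. \<Lambda> (A (\<Lambda> w)) = \<Lambda> w"
    using linear_generalized_inverse[OF A] by blast
  define P where "P v = \<Lambda> (A v)" for v
  have P: "linear P" unfolding P_def[abs_def] using linear_compose[OF A \<Lambda>(1)] by (simp add: o_def)
  note blL = linear_conv_bounded_linear[THEN iffD1, OF \<Lambda>(1)]
  note blP = linear_conv_bounded_linear[THEN iffD1, OF P]
  define \<phi> where "\<phi> y = \<Lambda> (f y) + (y - P y)" for y
  have sm: "smooth_on \<Omega> \<phi>" unfolding \<phi>_def
    by (intro smooth_on_add smooth_on_diff smooth_on_id smooth_on_bounded_linear[OF blL]
        smooth_on_linear[OF P] assms(1,2))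
  have d\<phi>: "dd \<phi> y v = \<Lambda> (dd f y v) + (v - P v)" if "y \<in> \<Omega>" for y v
  proof -
    have "(\<phi> has_derivative (\<lambda>v. \<Lambda> (dd f y v) + (v - P v))) (at y)"
      unfolding \<phi>_def
      by (intro has_derivative_add has_derivative_diff has_derivative_ident
          bounded_linear.has_derivative[OF blL] bounded_linear_imp_has_derivative blP
          smooth_on_has_derivative[OF assms(2) that])
    then show ?thesis using dd_eq by metis
  qed
  have "dd \<phi> y0 v = v" for v using d\<phi>[OF assms(3)] by (simp add: A_def P_def)
  then have inj: "inj (dd \<phi> y0)" by (simp add: inj_def)
  obtain U V \<psi> where UV: "open U" "U \<subseteq> \<Omega>" "y0 \<in> U" "open V" "\<phi> ` U = V" "\<psi> ` V = U"
    "\<And>x. x \<in> U \<Longrightarrow> \<psi> (\<phi> x) = x" "\<And>z. z \<in> V \<Longrightarrow> \<phi> (\<psi> z) = z" "smooth_on V \<psi>"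
    "\<And>z v. z \<in> V \<Longrightarrow> dd \<phi> (\<psi> z) (dd \<psi> z v) = v" "\<And>z v. z \<in> V \<Longrightarrow> dd \<psi> z (dd \<phi> (\<psi> z) v) = v"
    by (rule smooth_inverse_function[OF assms(1) sm assms(3) inj], rule that)
  define z0 where "z0 = \<phi> y0"
  have "z0 \<in> V" using UV(3,5) z0_def by auto
  then obtain e where e: "e > 0" "ball z0 e \<subseteq> V" using UV(4) open_contains_ball by blast
  \<comment> \<open>Shrunk so that the retraction \<open>z0 + P (z - z0)\<close> of z stays in the
    set, which lets every level of P be represented in the slice through z0. Both conditions are
    convex, as the argument along segments requires.\<close>
  define V' where "V' = ball z0 e \<inter> {z. z0 + P (z - z0) \<in> ball z0 e}"
  have V'V: "V' \<subseteq> V" using e by (auto simp: V'_def)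
  have oV': "open V'"
  proof -
    have "continuous_on UNIV (\<lambda>z. z0 + P (z - z0))"
      by (intro continuous_intros bounded_linear.continuous_on[OF blP])
    then have "open ((\<lambda>z. z0 + P (z - z0)) -` ball z0 e)"
      by (rule open_vimage[OF open_ball])
    then show ?thesis unfolding V'_def by (auto simp: vimage_def)
  qed
  have cV': "convex V'"
  proof -
    have "{z. z0 + P (z - z0) \<in> ball z0 e} = (\<lambda>z. P z) -` ((\<lambda>w. (P z0 - z0) + w) ` ball z0 e)"
    proof (intro equalityI subsetI)
      fix z assume "z \<in> {z. z0 + P (z - z0) \<in> ball z0 e}"
      then have "P z = (P z0 - z0) + (z0 + P (z - z0))" "z0 + P (z - z0) \<in> ball z0 e"
        by (simp_all add: linear_diff[OF P])
      then show "z \<in> (\<lambda>z. P z) -` ((\<lambda>w. (P z0 - z0) + w) ` ball z0 e)" by blast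
    next
      fix z assume "z \<in> (\<lambda>z. P z) -` ((\<lambda>w. (P z0 - z0) + w) ` ball z0 e)"
      then obtain w where "w \<in> ball z0 e" "P z = (P z0 - z0) + w" by blast
      moreover from this have "z0 + P (z - z0) = w" by (simp add: linear_diff[OF P])
      ultimately show "z \<in> {z. z0 + P (z - z0) \<in> ball z0 e}" by simp
    qed
    then show ?thesis unfolding V'_def
      by (auto intro!: convex_Int convex_linear_vimage[OF P] convex_translation)
  qed
  have \<psi>\<Omega>: "\<psi> z \<in> \<Omega>" if "z \<in> V" for z using UV(2,6) that by auto
  have PL: "P (\<Lambda> w) = \<Lambda> w" for w by (simp add: P_def \<Lambda>)
  have Lf: "\<Lambda> (f (\<psi> z)) = P z" if "z \<in> V" for z
  proof -
    have "P z = P (\<phi> (\<psi> z))" using UV(8)[OF that] by simp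
    also have "\<dots> = \<Lambda> (f (\<psi> z))"
      unfolding \<phi>_def linear_add[OF P] linear_diff[OF P] PL by (simp add: P_def \<Lambda>)
    finally show ?thesis by simp
  qed
  \<comment> \<open>The constancy of the rank enters here: \<Lambda> maps the range of
    \<open>dd f (\<psi> z)\<close> onto \<open>range P\<close>, and both have dimension r, so
    \<Lambda> is injective on it. Since \<Lambda> sends the derivative along d to P d = 0, that
    derivative vanishes.\<close>
  have dzero: "dd (\<lambda>z. f (\<psi> z)) z d = 0" if z: "z \<in> V" and "P d = 0" for z d
  proof -
    define w where "w = dd \<psi> z d"
    have Ldd: "\<Lambda> (dd f (\<psi> z) v) = P (dd \<phi> (\<psi> z) v)" for v
      unfolding d\<phi>[OF \<psi>\<Omega>[OF z]] linear_add[OF P] linear_diff[OF P] PL by (simp add: P_def \<Lambda>)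
    have "range (\<lambda>v. P (dd \<phi> (\<psi> z) v)) = range P"
    proof (intro equalityI subsetI)
      fix p assume "p \<in> range P"
      then obtain v where "p = P v" by auto
      then have "p = P (dd \<phi> (\<psi> z) (dd \<psi> z v))" using UV(10)[OF z] by simp
      then show "p \<in> range (\<lambda>v. P (dd \<phi> (\<psi> z) v))" by blast
    qed auto
    then have im: "\<Lambda> ` range (dd f (\<psi> z)) = range P"
      by (simp add: image_image Ldd)
    have rP: "dim (range P) = r"
    proof -
      have "range A = A ` range P" using \<Lambda>(2) by (auto simp: P_def image_image)
      then have "dim (range A) \<le> dim (range P)" using dim_image_le[OF A] by metis
      moreover have "range P = \<Lambda> ` range A" by (auto simp: P_def)
      then have "dim (range P) \<le> dim (range A)" using dim_image_le[OF \<Lambda>(1)] by metis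
      ultimately show ?thesis using rank[OF assms(3)] A_def by simp
    qed
    have lf: "linear (dd f (\<psi> z))" by (rule smooth_on_linear_dd[OF assms(2) \<psi>\<Omega>[OF z]])
    have "\<Lambda> (dd f (\<psi> z) w) = 0" using Ldd[of w] UV(10)[OF z] that(2) by (simp add: w_def)
    then have "dd f (\<psi> z) w = 0"
      using linear_zero_of_dim_image[OF \<Lambda>(1) linear_subspace_image[OF lf subspace_UNIV]]
        im rP rank[OF \<psi>\<Omega>[OF z]] by simp
    then show ?thesis using dd_compose[OF assms(2) UV(9) z \<psi>\<Omega>[OF z]] by (simp add: w_def)
  qed
  have smf\<psi>: "smooth_on V (\<lambda>z. f (\<psi> z))"
    by (rule smooth_on_compose[OF UV(4) assms(1) _ assms(2) UV(9)]) (use \<psi>\<Omega> in auto)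
  show thesis
  proof (rule that[of V' z0 \<psi> A \<Lambda>])
    show "open V'" "convex V'" by fact+
    show "z0 \<in> V'" using e by (simp add: V'_def linear_0[OF P])
    show "smooth_on V' \<psi>" using UV(9) V'V smooth_on_subset by blast
    show "\<psi> z0 = y0" using UV(3,7) by (simp add: z0_def)
    show "\<psi> ` V' \<subseteq> \<Omega>" using \<psi>\<Omega> V'V by auto
    have "\<psi> ` V' = U \<inter> \<phi> -` V'"
      using UV(5-8) V'V by (auto simp: image_iff) (metis image_eqI subsetD)+
    moreover have "open (U \<inter> \<phi> -` V')"
      using continuous_open_preimage[of U \<phi> V'] UV(1,2) oV' smooth_on_continuous[OF sm]
        continuous_on_subset by blast
    ultimately show "open (\<psi> ` V')" by simp
    show "bij (dd \<psi> z)" if "z \<in> V'" for z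
      using UV(10,11) that V'V by (intro bij_betw_byWitness[where f' = "dd \<phi> (\<psi> z)"]) auto
    show "linear A" "linear \<Lambda>" "\<And>v. A (\<Lambda> (A v)) = A v" "\<And>w. \<Lambda> (A (\<Lambda> w)) = \<Lambda> w" by fact+
    show "dim (range A) = r" using rank[OF assms(3)] A_def by simp
    show "\<Lambda> (f (\<psi> z)) = \<Lambda> (A z)" if "z \<in> V'" for z using Lf that V'V by (auto simp: P_def)
    show "f (\<psi> z) = f (\<psi> z')" if "z \<in> V'" "z' \<in> V'" "\<Lambda> (A z) = \<Lambda> (A z')" for z z'
    proof (rule convex_dd_zero_eq[OF cV' smooth_on_subset[OF smf\<psi> V'V] that(1,2)])
      fix w assume "w \<in> V'"
      then show "dd (\<lambda>z. f (\<psi> z)) w (z' - z) = 0"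
        using dzero V'V that(3) by (auto simp: P_def[symmetric] linear_diff[OF P])
    qed
    show "z0 + \<Lambda> (A (z - z0)) \<in> V'" if "z \<in> V'" for z
    proof -
      have "P (P v) = P v" for v by (simp add: P_def \<Lambda>)
      then show ?thesis using that by (simp add: V'_def P_def[symmetric])
    qed
  qed
qed

text \<open>The image is a graph over \<open>range A\<close>: its points are
  \<open>A (\<Lambda> w) + s w\<close>, where \<open>s w\<close> depends on
  \<open>\<Lambda> w\<close> only. Subtracting s straightens the graph, and adding s undoes this
  because \<Lambda> annihilates s.\<close>

lemma embedded_submanifold_constant_rank_image:
  fixes f :: "'a::euclidean_space \<Rightarrow> 'b::euclidean_space"
  assumes "open \<Omega>" "smooth_on \<Omega> f" "y0 \<in> \<Omega>"
    and rank: "\<And>y. y \<in> \<Omega> \<Longrightarrow> dim (range (dd f y)) = r"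
  obtains U where "open U" "y0 \<in> U" "U \<subseteq> \<Omega>" "embedded_submanifold r (f ` U)"
proof -
  obtain V :: "'a set" and \<psi> z0 A \<Lambda> where V: "open V" "convex V" "z0 \<in> V" "smooth_on V \<psi>" "\<psi> z0 = y0" "\<psi> ` V \<subseteq> \<Omega>"
    "open (\<psi> ` V)" "\<And>z. z \<in> V \<Longrightarrow> bij (dd \<psi> z)"
    and A: "linear A" and L: "linear \<Lambda>" and AL: "\<And>v. A (\<Lambda> (A v)) = A v"
    and LA: "\<And>w. \<Lambda> (A (\<Lambda> w)) = \<Lambda> w" and r: "dim (range A) = r"
    and Lf: "\<And>z. z \<in> V \<Longrightarrow> \<Lambda> (f (\<psi> z)) = \<Lambda> (A z)"
    and dep: "\<And>z z'. z \<in> V \<Longrightarrow> z' \<in> V \<Longrightarrow> \<Lambda> (A z) = \<Lambda> (A z') \<Longrightarrow> f (\<psi> z) = f (\<psi> z')"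
    and VP: "\<And>z. z \<in> V \<Longrightarrow> z0 + \<Lambda> (A (z - z0)) \<in> V"
    by (rule constant_rank[OF assms(1-3)], erule assms(4), rule that)
  \<comment> \<open>The point of the slice through z0 with projection \<open>\<Lambda> w\<close>:
    its complementary component is that of z0.\<close>
  define \<sigma> where "\<sigma> w = \<Lambda> w + (z0 - \<Lambda> (A z0))" for w
  have \<sigma>: "continuous_on UNIV \<sigma>" "smooth_on UNIV \<sigma>" unfolding \<sigma>_def
    by (auto intro!: continuous_on_add continuous_on_const smooth_on_add smooth_on_const
        smooth_on_linear[OF L] smooth_on_continuous[OF smooth_on_linear[OF L]])
  define s where "s w = f (\<psi> (\<sigma> w)) - A (\<Lambda> w)" for w
  define W where "W = \<sigma> -` V"
  have W: "open W" unfolding W_def by (rule open_vimage[OF V(1) \<sigma>(1)])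
  have L\<sigma>: "\<Lambda> (A (\<sigma> w)) = \<Lambda> w" for w
    by (simp add: \<sigma>_def linear_add[OF A] linear_add[OF L] linear_diff[OF A] linear_diff[OF L] LA)
  have sm: "smooth_on W s"
  proof -
    have *: "smooth_on W (\<lambda>w. \<psi> (\<sigma> w))"
      by (rule smooth_on_compose[OF W V(1) _ V(4) smooth_on_subset[OF \<sigma>(2)]]) (auto simp: W_def)
    have "smooth_on W (\<lambda>w. f (\<psi> (\<sigma> w)))"
      by (rule smooth_on_compose[OF W assms(1) _ assms(2) *]) (use V(6) in \<open>auto simp: W_def\<close>)
    then show ?thesis unfolding s_def
      using smooth_on_linear[OF linear_compose[OF L A] W]
      by (intro smooth_on_diff W) (simp_all add: o_def)
  qed
  have Ls: "\<Lambda> (s w) = 0" if "w \<in> W" for w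
    using Lf[of "\<sigma> w"] that by (simp add: s_def linear_diff[OF L] L\<sigma> LA W_def)
  have \<sigma>s: "\<sigma> (w - s w) = \<sigma> w" "\<sigma> (w + s w) = \<sigma> w" if "w \<in> W" for w
    using Ls[OF that] by (simp_all add: \<sigma>_def linear_diff[OF L] linear_add[OF L])
  have ss: "s (w - s w) = s w" "s (w + s w) = s w" if "w \<in> W" for w
    using Ls[OF that] \<sigma>s[OF that] by (simp_all add: s_def linear_diff[OF L] linear_add[OF L] linear_0[OF A])
  have WW: "w - s w \<in> W" "w + s w \<in> W" if "w \<in> W" for w
    using \<sigma>s[OF that] that by (simp_all add: W_def)
  have imW: "(\<lambda>w. w - s w) ` W = W"
  proof
    show "W \<subseteq> (\<lambda>w. w - s w) ` W"
    proof
      fix w assume "w \<in> W"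
      then show "w \<in> (\<lambda>w. w - s w) ` W" using WW ss by (intro image_eqI[of _ _ "w + s w"]) auto
    qed
  qed (use WW in auto)
  have fV: "f (\<psi> z) = A (\<Lambda> (f (\<psi> z))) + s (f (\<psi> z))" "f (\<psi> z) \<in> W" if "z \<in> V" for z
  proof -
    \<comment> \<open>This is the retraction of z, which stays in V. It has the same projection as
      z, so \<open>f (\<psi> z)\<close> takes the same value at both points.\<close>
    have eq: "\<sigma> (f (\<psi> z)) = z0 + \<Lambda> (A (z - z0))"
      unfolding \<sigma>_def Lf[OF that] by (simp add: linear_diff[OF A] linear_diff[OF L])
    then have *: "\<sigma> (f (\<psi> z)) \<in> V" using VP[OF that] by simp
    then show "f (\<psi> z) \<in> W" by (simp add: W_def)
    have "f (\<psi> (\<sigma> (f (\<psi> z)))) = f (\<psi> z)"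
      by (rule dep[OF * that]) (simp add: L\<sigma> Lf[OF that])
    then show "f (\<psi> z) = A (\<Lambda> (f (\<psi> z))) + s (f (\<psi> z))" by (simp add: s_def)
  qed
  have "embedded_submanifold r (f ` (\<psi> ` V))"
    unfolding embedded_submanifold_def
  proof (intro ballI exI conjI)
    fix p assume "p \<in> f ` \<psi> ` V"
    then show "p \<in> W" using fV(2) by auto
    show "open W" by fact
    show "open ((\<lambda>w. w - s w) ` W)" using W imW by simp
    show "smooth_on W (\<lambda>w. w - s w)" by (intro smooth_on_diff W smooth_on_id sm)
    show "smooth_on ((\<lambda>w. w - s w) ` W) (\<lambda>w. w + s w)"
      unfolding imW by (intro smooth_on_add W smooth_on_id sm)
    show "y - s y + s (y - s y) = y" if "y \<in> W" for y using ss that by simp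
    show "subspace (range A)" by (rule linear_subspace_image[OF A subspace_UNIV])
    show "dim (range A) = r" by fact
    show "(\<lambda>w. w - s w) ` (f ` \<psi> ` V \<inter> W) = range A \<inter> (\<lambda>w. w - s w) ` W"
    proof (intro equalityI subsetI)
      fix q assume "q \<in> (\<lambda>w. w - s w) ` (f ` \<psi> ` V \<inter> W)"
      then obtain z where z: "z \<in> V" "q = f (\<psi> z) - s (f (\<psi> z))" by auto
      then have "q = A (\<Lambda> (f (\<psi> z)))" using fV(1) by (metis add_diff_cancel_right')
      then show "q \<in> range A \<inter> (\<lambda>w. w - s w) ` W" using z fV(2) by (metis IntI rangeI imageI)
    next
      fix q assume q: "q \<in> range A \<inter> (\<lambda>w. w - s w) ` W"
      then obtain w where w: "w \<in> W" "q = w - s w" by auto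
      have "q = A (\<Lambda> q)" using q AL by (metis IntD1 imageE)
      also have "\<Lambda> q = \<Lambda> w" using w Ls by (simp add: linear_diff[OF L])
      finally have "w = f (\<psi> (\<sigma> w))" using w(2) by (simp add: s_def)
      then show "q \<in> (\<lambda>w. w - s w) ` (f ` \<psi> ` V \<inter> W)" using w by (auto simp: W_def)
    qed
  qed
  then show thesis
    using that[of "\<psi> ` V"] V(3,5-7) by blast
qed

section \<open>Orthonormal bases and traces\<close>

definition onb :: "'a::euclidean_space set \<Rightarrow> 'a set \<Rightarrow> bool" where
  "onb B T \<longleftrightarrow> finite B \<and> (\<forall>b\<in>B. b \<bullet> b = 1) \<and> (\<forall>b\<in>B. \<forall>c\<in>B. b \<noteq> c \<longrightarrow> b \<bullet> c = 0) \<and> span B = T"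

lemma onb_exists:
  fixes T :: "'a::euclidean_space set"
  assumes "subspace T"
  obtains B where "onb B T" "card B = dim T" "B \<subseteq> T"
proof -
  obtain B where "B \<subseteq> T" "pairwise orthogonal B" "\<And>x. x \<in> B \<Longrightarrow> norm x = 1"
      "independent B" "card B = dim T" "span B = T"
    using orthonormal_basis_subspace[OF assms] by metis
  then show thesis
    by (intro that[of B])
      (auto simp: onb_def norm_eq_1 pairwise_def orthogonal_def independent_imp_finite)
qed

lemma onb_independent: "onb B T \<Longrightarrow> independent B"
  by (rule pairwise_orthogonal_independent) (auto simp: onb_def pairwise_def orthogonal_def)

lemma onb_card: "onb B T \<Longrightarrow> card B = dim T"
  using onb_independent[of B T] dim_eq_card_independent[of B] dim_span[of B]
  by (simp add: onb_def)

lemma onb_expand: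
  assumes "onb B T" "t \<in> T"
  shows "t = (\<Sum>b\<in>B. (t \<bullet> b) *\<^sub>R b)"
proof -
  obtain u where u: "(\<Sum>b\<in>B. u b *\<^sub>R b) = t"
    using assms span_finite[of B] by (auto simp: onb_def)
  have "t \<bullet> c = u c" if "c \<in> B" for c
  proof -
    have "t \<bullet> c = (\<Sum>b\<in>B. u b * (b \<bullet> c))"
      unfolding u[symmetric] by (simp add: inner_sum_left)
    also have "\<dots> = (\<Sum>b\<in>B. if b = c then u b else 0)"
      using assms(1) that by (intro sum.cong) (auto simp: onb_def)
    finally show ?thesis using assms(1) that by (simp add: onb_def)
  qed
  then show ?thesis using u by (simp cong: sum.cong)
qed

text \<open>Allows a trace to be formed in one fixed basis and evaluated in a basis of principal
  directions that varies with the point.\<close>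

lemma onb_trace:
  fixes \<beta> :: "'a::euclidean_space \<Rightarrow> 'a \<Rightarrow> real"
  assumes "onb B T" "onb C T" "\<And>x. linear (\<beta> x)" "\<And>y. linear (\<lambda>x. \<beta> x y)"
  shows "(\<Sum>b\<in>B. \<beta> b b) = (\<Sum>c\<in>C. \<beta> c c)"
proof -
  have BT: "B \<subseteq> T" using assms(1) span_superset[of B] by (simp add: onb_def)
  have CT: "C \<subseteq> T" using assms(2) span_superset[of C] by (simp add: onb_def)
  have "\<beta> b b = (\<Sum>c\<in>C. \<Sum>d\<in>C. (b \<bullet> c) * (b \<bullet> d) * \<beta> c d)" if "b \<in> B" for b
  proof -
    have b: "b = (\<Sum>c\<in>C. (b \<bullet> c) *\<^sub>R c)" using onb_expand[OF assms(2)] BT that by auto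
    have "\<beta> b b = (\<Sum>c\<in>C. (b \<bullet> c) * \<beta> c b)"
      by (subst b) (simp add: linear_sum[OF assms(4)] linear_cmul[OF assms(4)])
    also have "\<dots> = (\<Sum>c\<in>C. (b \<bullet> c) * (\<Sum>d\<in>C. (b \<bullet> d) * \<beta> c d))"
    proof (rule sum.cong[OF refl])
      fix c
      have "\<beta> c b = (\<Sum>d\<in>C. (b \<bullet> d) * \<beta> c d)"
        by (subst b) (simp add: linear_sum[OF assms(3)] linear_cmul[OF assms(3)])
      then show "(b \<bullet> c) * \<beta> c b = (b \<bullet> c) * (\<Sum>d\<in>C. (b \<bullet> d) * \<beta> c d)" by simp
    qed
    finally show ?thesis by (simp add: sum_distrib_left mult.assoc)
  qed
  then have "(\<Sum>b\<in>B. \<beta> b b) = (\<Sum>b\<in>B. \<Sum>c\<in>C. \<Sum>d\<in>C. (b \<bullet> c) * (b \<bullet> d) * \<beta> c d)" by simp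
  also have "\<dots> = (\<Sum>c\<in>C. \<Sum>d\<in>C. (\<Sum>b\<in>B. (b \<bullet> c) * (b \<bullet> d)) * \<beta> c d)"
    by (subst sum.swap, rule sum.cong[OF refl], subst sum.swap) (simp add: sum_distrib_right)
  also have "\<dots> = (\<Sum>c\<in>C. \<Sum>d\<in>C. (if c = d then 1 else 0) * \<beta> c d)"
  proof (intro sum.cong refl)
    fix c d assume cd: "c \<in> C" "d \<in> C"
    have "c \<bullet> d = (\<Sum>b\<in>B. (b \<bullet> c) * (b \<bullet> d))"
    proof -
      have "c \<bullet> d = (\<Sum>b\<in>B. (c \<bullet> b) *\<^sub>R b) \<bullet> d"
        using onb_expand[OF assms(1), of c] CT cd(1) by (metis subsetD)
      then show ?thesis by (simp add: inner_sum_left inner_commute[of c])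
    qed
    then show "(\<Sum>b\<in>B. (b \<bullet> c) * (b \<bullet> d)) * \<beta> c d = (if c = d then 1 else 0) * \<beta> c d"
      using assms(2) cd by (auto simp: onb_def)
  qed
  also have "\<dots> = (\<Sum>c\<in>C. \<beta> c c)"
  proof (rule sum.cong[OF refl])
    fix c assume "c \<in> C"
    moreover have "(\<Sum>d\<in>C. (if c = d then 1 else 0) * \<beta> c d) = (\<Sum>d\<in>C. if c = d then \<beta> c d else 0)"
      by (rule sum.cong) auto
    ultimately show "(\<Sum>d\<in>C. (if c = d then 1 else 0) * \<beta> c d) = \<beta> c c"
      using assms(2) by (simp add: onb_def)
  qed
  finally show ?thesis .
qed

section \<open>Local geometry of hypersurfaces of the sphere\<close>

text \<open>The coordinate expression of an oriented hypersurface in a single chart. Everything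
  differential is proved at this level and carried to manifolds chart by chart.\<close>

locale hsurf =
  fixes \<Omega> :: "'e::euclidean_space set" and F N :: "'e \<Rightarrow> 'b::euclidean_space"
  assumes open_dom: "open \<Omega>" and dim_eq: "DIM('b) = DIM('e) + 2"
    and smF: "smooth_on \<Omega> F" and smN: "smooth_on \<Omega> N"
    and FF: "y \<in> \<Omega> \<Longrightarrow> F y \<bullet> F y = 1" and NN: "y \<in> \<Omega> \<Longrightarrow> N y \<bullet> N y = 1"
    and NF: "y \<in> \<Omega> \<Longrightarrow> N y \<bullet> F y = 0"
    and NdF: "y \<in> \<Omega> \<Longrightarrow> N y \<bullet> dd F y v = 0"
    and injF: "y \<in> \<Omega> \<Longrightarrow> inj (dd F y)"
begin

lemma linF: "y \<in> \<Omega> \<Longrightarrow> linear (dd F y)" using smooth_on_linear_dd[OF smF] .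
lemma linN: "y \<in> \<Omega> \<Longrightarrow> linear (dd N y)" using smooth_on_linear_dd[OF smN] .

lemma dF_eq_0_iff: "y \<in> \<Omega> \<Longrightarrow> dd F y v = 0 \<longleftrightarrow> v = 0"
  using injF linF linear_injective_0 linear_0 by blast

lemma FdF: "y \<in> \<Omega> \<Longrightarrow> F y \<bullet> dd F y v = 0"
  using dd_inner_const[OF open_dom _ smF smF FF, of y v] by (simp add: inner_commute)

lemma NdN: "y \<in> \<Omega> \<Longrightarrow> N y \<bullet> dd N y v = 0"
  using dd_inner_const[OF open_dom _ smN smN NN, of y v] by (simp add: inner_commute)

lemma FdN: "y \<in> \<Omega> \<Longrightarrow> F y \<bullet> dd N y v = 0"
  using dd_inner_const[OF open_dom _ smN smF NF, of y v] NdF[of y v] by (simp add: inner_commute)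

lemma dim_range_dF: "y \<in> \<Omega> \<Longrightarrow> dim (range (dd F y)) = DIM('e)"
  using dim_image_eq[OF linF, of y UNIV] injF by simp

text \<open>F and N span a plane; its orthogonal complement contains the tangent space and has the
  same dimension.\<close>

lemma range_dF:
  assumes "y \<in> \<Omega>" "w \<bullet> F y = 0" "w \<bullet> N y = 0"
  shows "w \<in> range (dd F y)"
proof -
  define P where "P = span {F y, N y}"
  define C where "C = {w. \<forall>x\<in>P. orthogonal x w}"
  have C: "subspace C" by (auto simp: C_def subspace_def orthogonal_def inner_add_right)
  have FN: "F y \<noteq> N y" "F y \<noteq> 0" "N y \<noteq> 0" using NF[OF assms(1)] FF[OF assms(1)] NN[OF assms(1)] by auto
  have "pairwise orthogonal {F y, N y}"
    using NF[OF assms(1)] by (auto simp: pairwise_def orthogonal_def inner_commute)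
  then have "independent {F y, N y}" using FN by (intro pairwise_orthogonal_independent) auto
  then have "dim P = 2" using dim_eq_card_independent FN by (fastforce simp: P_def)
  moreover have "dim C + dim P = DIM('b)"
    using dim_subspace_orthogonal_to_vectors[of P UNIV] by (simp add: P_def C_def)
  ultimately have "dim C = dim (range (dd F y))" using dim_range_dF[OF assms(1)] dim_eq by simp
  moreover have "w \<in> C" if "w \<bullet> F y = 0" "w \<bullet> N y = 0" for w
  proof -
    have "orthogonal w x" if "x \<in> P" for x
      using that orthogonal_to_span[of x "{F y, N y}" w] \<open>w \<bullet> F y = 0\<close> \<open>w \<bullet> N y = 0\<close>
      unfolding P_def by (auto simp: orthogonal_def)
    then show ?thesis by (simp add: C_def orthogonal_commute)
  qed
  moreover from this have "range (dd F y) \<subseteq> C"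
    using FdF[OF assms(1)] NdF[OF assms(1)] by (auto simp: inner_commute)
  ultimately have "range (dd F y) = C"
    using subspace_dim_equal[OF linear_subspace_image[OF linF[OF assms(1)] subspace_UNIV] C] by simp
  then show ?thesis using \<open>\<And>w. w \<bullet> F y = 0 \<Longrightarrow> w \<bullet> N y = 0 \<Longrightarrow> w \<in> C\<close> assms(2,3) by simp
qed

lemma dN_range: "y \<in> \<Omega> \<Longrightarrow> dd N y v \<in> range (dd F y)"
  by (rule range_dF) (simp_all add: FdN NdN inner_commute)

text \<open>Differentiating N . dF = 0 expresses both sides by second derivatives of F, which
  commute.\<close>

lemma dN_dF_sym:
  assumes "y \<in> \<Omega>"
  shows "dd N y v \<bullet> dd F y w = dd N y w \<bullet> dd F y v"
proof -
  have "dd N y v \<bullet> dd F y w + N y \<bullet> dd (\<lambda>z. dd F z w) y v = 0" for v w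
    by (rule dd_inner_const[OF open_dom assms smN smooth_on_dd[OF smF] NdF])
  from this[of v w] this[of w v] dd_symmetric[OF open_dom smF assms, of v w] show ?thesis by simp
qed

lemma zero_if_orthogonal_range:
  assumes "y \<in> \<Omega>" "w \<in> range (dd F y)" "\<And>v. w \<bullet> dd F y v = 0"
  shows "w = 0"
  using assms by (metis imageE inner_eq_zero_iff)

lemma eq_0_if_orthogonal:
  assumes "y \<in> \<Omega>" "w \<bullet> F y = 0" "w \<bullet> N y = 0" "\<And>v. w \<bullet> dd F y v = 0"
  shows "w = 0"
  using zero_if_orthogonal_range range_dF assms by blast

text \<open>Principal directions by the vector equation of Rodrigues. Being linear in F and N, it
  passes directly to parallel hypersurfaces.\<close>

definition PD :: "real \<Rightarrow> 'e \<Rightarrow> 'e set" where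
  "PD \<kappa> y = {v. dd N y v = - \<kappa> *\<^sub>R dd F y v}"

lemma subspace_PD: "y \<in> \<Omega> \<Longrightarrow> subspace (PD \<kappa> y)"
  using linear_0[OF linF] linear_0[OF linN] linear_add[OF linF] linear_add[OF linN]
    linear_cmul[OF linF] linear_cmul[OF linN]
  by (auto simp: subspace_def PD_def scaleR_add_right)

text \<open>Testing against tangent vectors loses nothing, since dN takes its values in the tangent
  space.\<close>

lemma PD_eq_form:
  assumes "y \<in> \<Omega>"
  shows "{v. \<forall>w. - (dd N y v \<bullet> dd F y w) = \<kappa> * (dd F y v \<bullet> dd F y w)} = PD \<kappa> y"
proof -
  have "dd N y v = - \<kappa> *\<^sub>R dd F y v" if *: "\<forall>w. - (dd N y v \<bullet> dd F y w) = \<kappa> * (dd F y v \<bullet> dd F y w)" for v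
  proof -
    have "dd N y v + \<kappa> *\<^sub>R dd F y v = 0"
    proof (rule zero_if_orthogonal_range[OF assms])
      show "dd N y v + \<kappa> *\<^sub>R dd F y v \<in> range (dd F y)"
        using dN_range[OF assms] linear_subspace_image[OF linF[OF assms] subspace_UNIV]
        by (auto intro!: subspace_add subspace_mul)
      show "(dd N y v + \<kappa> *\<^sub>R dd F y v) \<bullet> dd F y w = 0" for w
        using *[rule_format, of w] by (simp add: inner_add_left)
    qed
    then show ?thesis by (simp add: eq_neg_iff_add_eq_0)
  qed
  moreover have "- (dd N y v \<bullet> dd F y w) = \<kappa> * (dd F y v \<bullet> dd F y w)"
    if "dd N y v = - \<kappa> *\<^sub>R dd F y v" for v w
    unfolding that by simp
  ultimately show ?thesis unfolding PD_def by (intro Collect_cong iffI) metis+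
qed

lemma PD_orthogonal:
  assumes "y \<in> \<Omega>" "v \<in> PD \<kappa> y" "w \<in> PD \<kappa>' y" "\<kappa> \<noteq> \<kappa>'"
  shows "dd F y v \<bullet> dd F y w = 0"
  using dN_dF_sym[OF assms(1), of v w] assms(2-4) by (simp add: PD_def inner_commute)

end

section \<open>Isoparametric hypersurfaces and their principal frames\<close>

locale isosurf = hsurf +
  fixes k :: "nat \<Rightarrow> real" and g m :: nat
  assumes inj_k: "inj_on k {1..g}" and dim_gm: "DIM('a) = g * m"
    and dim_PD: "y \<in> \<Omega> \<Longrightarrow> i \<in> {1..g} \<Longrightarrow> dim (PD (k i) y) = m"
begin

lemma m_pos: "m > 0" and g_pos: "g > 0"
  using dim_gm DIM_positive[where 'a = 'a] by (cases m; cases g; simp)+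

text \<open>Bases of the images of the eigenspaces are mutually orthogonal for distinct curvatures
  and have g m elements together; this is the dimension of the tangent space, so they exhaust
  it.\<close>

lemma frame:
  assumes y: "y \<in> \<Omega>"
  obtains B where "\<And>i. i \<in> {1..g} \<Longrightarrow> onb (B i) (dd F y ` PD (k i) y)"
    "\<And>i. i \<in> {1..g} \<Longrightarrow> card (B i) = m" "\<And>i. i \<in> {1..g} \<Longrightarrow> B i \<subseteq> dd F y ` PD (k i) y"
    "\<And>i j. i \<in> {1..g} \<Longrightarrow> j \<in> {1..g} \<Longrightarrow> i \<noteq> j \<Longrightarrow> B i \<inter> B j = {}"
    "\<And>i j b c. i \<in> {1..g} \<Longrightarrow> j \<in> {1..g} \<Longrightarrow> i \<noteq> j \<Longrightarrow> b \<in> B i \<Longrightarrow> c \<in> B j \<Longrightarrow> b \<bullet> c = 0"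
    "onb (\<Union>i\<in>{1..g}. B i) (range (dd F y))"
proof -
  have sub: "subspace (dd F y ` PD (k i) y)" for i
    by (rule linear_subspace_image[OF linF[OF y] subspace_PD[OF y]])
  have dimT: "dim (dd F y ` PD (k i) y) = m" if "i \<in> {1..g}" for i
    using dim_image_eq[OF linF[OF y], of "PD (k i) y"] injF[OF y] dim_PD[OF y that]
    by (metis inj_on_subset top_greatest)
  have "\<exists>B. onb B (dd F y ` PD (k i) y) \<and> card B = dim (dd F y ` PD (k i) y) \<and> B \<subseteq> dd F y ` PD (k i) y" for i
    using onb_exists[OF sub] by metis
  then obtain B where B: "\<And>i. onb (B i) (dd F y ` PD (k i) y)"
    "\<And>i. card (B i) = dim (dd F y ` PD (k i) y)" "\<And>i. B i \<subseteq> dd F y ` PD (k i) y"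
    by metis
  have orth: "b \<bullet> c = 0"
    if ij: "i \<in> {1..g}" "j \<in> {1..g}" "i \<noteq> j" "b \<in> B i" "c \<in> B j" for i j b c
  proof -
    obtain v w where vw: "b = dd F y v" "v \<in> PD (k i) y" "c = dd F y w" "w \<in> PD (k j) y"
      using B(3)[of i] B(3)[of j] ij(4,5) by blast
    have "k i \<noteq> k j" using inj_onD[OF inj_k] ij(1-3) by blast
    then show ?thesis using PD_orthogonal[OF y vw(2,4)] vw(1,3) by simp
  qed
  have b1: "b \<bullet> b = 1" if "b \<in> B i" for b i using B(1)[of i] that by (simp add: onb_def)
  have disj: "B i \<inter> B j = {}" if "i \<in> {1..g}" "j \<in> {1..g}" "i \<noteq> j" for i j
    using orth[OF that] b1 by force
  define U where "U = (\<Union>i\<in>{1..g}. B i)"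
  have finB: "finite (B i)" for i using B(1) by (simp add: onb_def)
  have U: "finite U" "U \<subseteq> range (dd F y)" using finB B(3) unfolding U_def by (simp, blast)
  have Uorth: "\<forall>b\<in>U. \<forall>c\<in>U. b \<noteq> c \<longrightarrow> b \<bullet> c = 0"
  proof (intro ballI impI)
    fix b c assume bc: "b \<in> U" "c \<in> U" "b \<noteq> c"
    then obtain i j where ij: "i \<in> {1..g}" "b \<in> B i" "j \<in> {1..g}" "c \<in> B j" by (auto simp: U_def)
    show "b \<bullet> c = 0"
    proof (cases "i = j")
      case True
      then show ?thesis using B(1)[of i] ij bc(3) by (auto simp: onb_def)
    qed (use orth ij in auto)
  qed
  have onbU: "onb U (span U)"
    using U Uorth b1 by (auto simp: onb_def U_def)
  have "card U = (\<Sum>i\<in>{1..g}. card (B i))"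
    unfolding U_def by (rule card_UN_disjoint) (use finB disj in auto)
  also have "\<dots> = g * m" using B(2) dimT by simp
  finally have "dim (span U) = DIM('a)" using onb_card[OF onbU] dim_gm by simp
  then have "span U = range (dd F y)"
    using subspace_dim_equal[OF subspace_span[of U] linear_subspace_image[OF linF[OF y] subspace_UNIV]]
      dim_range_dF[OF y] span_minimal[OF U(2) linear_subspace_image[OF linF[OF y] subspace_UNIV]]
    by simp
  then have "onb U (range (dd F y))" using onbU by simp
  then show thesis
    using that[of B] B dimT disj orth unfolding U_def by simp
qed

lemma span_PD:
  assumes y: "y \<in> \<Omega>"
  shows "span (\<Union>i\<in>{1..g}. PD (k i) y) = UNIV"
proof -
  obtain B where B: "\<And>i. i \<in> {1..g} \<Longrightarrow> B i \<subseteq> dd F y ` PD (k i) y"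
    "onb (\<Union>i\<in>{1..g}. B i) (range (dd F y))"
    using frame[OF y] by metis
  have "range (dd F y) \<subseteq> span (dd F y ` (\<Union>i\<in>{1..g}. PD (k i) y))"
  proof -
    have "(\<Union>i\<in>{1..g}. B i) \<subseteq> dd F y ` (\<Union>i\<in>{1..g}. PD (k i) y)" using B(1) by fast
    from span_mono[OF this] show ?thesis using B(2) by (simp add: onb_def)
  qed
  also have "\<dots> = dd F y ` span (\<Union>i\<in>{1..g}. PD (k i) y)"
    by (rule linear_span_image[OF linF[OF y]])
  finally have "UNIV \<subseteq> span (\<Union>i\<in>{1..g}. PD (k i) y)"
    using inj_image_subset_iff[OF injF[OF y]] by blast
  then show ?thesis by blast
qed

lemma linear_zero_if_zero_on_PD:
  assumes "y \<in> \<Omega>" "linear L" "\<And>i v. i \<in> {1..g} \<Longrightarrow> v \<in> PD (k i) y \<Longrightarrow> L v = 0"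
  shows "L v = 0"
proof (rule linear_eq_0_on_span[OF assms(2)])
  show "v \<in> span (\<Union>i\<in>{1..g}. PD (k i) y)" using span_PD[OF assms(1)] by simp
qed (use assms(3) in blast)

lemma principal_set:
  assumes y: "y \<in> \<Omega>"
  shows "{\<kappa>. \<exists>v\<in>PD \<kappa> y. v \<noteq> 0} = k ` {1..g}"
proof (intro equalityI subsetI)
  fix \<kappa> assume "\<kappa> \<in> {\<kappa>. \<exists>v\<in>PD \<kappa> y. v \<noteq> 0}"
  then obtain v where v: "v \<in> PD \<kappa> y" "v \<noteq> 0" by auto
  show "\<kappa> \<in> k ` {1..g}"
  proof (rule ccontr)
    assume \<kappa>: "\<kappa> \<notin> k ` {1..g}"
    have "dd F y v \<bullet> dd F y w = 0" for w
    proof (rule linear_zero_if_zero_on_PD[OF y, of "\<lambda>w. dd F y v \<bullet> dd F y w"])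
      show "dd F y v \<bullet> dd F y w = 0" if "i \<in> {1..g}" "w \<in> PD (k i) y" for i w
        by (rule PD_orthogonal[OF y v(1) that(2)]) (use \<kappa> that(1) in blast)
      show "linear (\<lambda>w. dd F y v \<bullet> dd F y w)"
        using linF[OF y] by (intro linearI) (simp_all add: linear_add linear_cmul inner_add_right)
    qed
    then show False using dF_eq_0_iff[OF y] v(2) by (metis inner_eq_zero_iff)
  qed
next
  fix \<kappa> assume "\<kappa> \<in> k ` {1..g}"
  then have "dim (PD \<kappa> y) > 0" using dim_PD[OF y] m_pos by auto
  then have "\<not> PD \<kappa> y \<subseteq> {0}" using dim_eq_0 by (metis less_irrefl)
  then show "\<kappa> \<in> {\<kappa>. \<exists>v\<in>PD \<kappa> y. v \<noteq> 0}" by blast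
qed

end

section \<open>Parallel hypersurfaces and focal maps\<close>

context isosurf
begin

lemma dd_FN:
  "y \<in> \<Omega> \<Longrightarrow> dd (\<lambda>y. a *\<^sub>R F y + b *\<^sub>R N y) y v = a *\<^sub>R dd F y v + b *\<^sub>R dd N y v"
  by (rule dd_lincomb[OF smooth_on_differentiable[OF smF] smooth_on_differentiable[OF smN]])

lemma smooth_FN: "smooth_on \<Omega> (\<lambda>y. a *\<^sub>R F y + b *\<^sub>R N y)"
  by (intro smooth_on_add smooth_on_cmul open_dom smF smN)

lemma not_PD:
  assumes "y \<in> \<Omega>" "\<kappa> \<notin> k ` {1..g}" "v \<in> PD \<kappa> y"
  shows "v = 0"
  using principal_set[OF assms(1)] assms(2,3) by blast

text \<open>The new pair is a rotation of (F, N) with constant coefficients, so Rodrigues' equation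
  keeps its eigenspaces and only the eigenvalue changes. A vector killed by the new differential
  would be principal with curvature cot \<mu>, which the hypothesis rules out.\<close>

lemma parallel_isosurf:
  assumes c: "\<And>i. i \<in> {1..g} \<Longrightarrow> cos \<mu> - k i * sin \<mu> \<noteq> 0"
  shows "isosurf \<Omega> (\<lambda>y. cos \<mu> *\<^sub>R F y + sin \<mu> *\<^sub>R N y) (\<lambda>y. - sin \<mu> *\<^sub>R F y + cos \<mu> *\<^sub>R N y)
    (\<lambda>i. (k i * cos \<mu> + sin \<mu>) / (cos \<mu> - k i * sin \<mu>)) g m"
proof -
  let ?F = "\<lambda>y. cos \<mu> *\<^sub>R F y + sin \<mu> *\<^sub>R N y" and ?N = "\<lambda>y. - sin \<mu> *\<^sub>R F y + cos \<mu> *\<^sub>R N y"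
  let ?k = "\<lambda>i. (k i * cos \<mu> + sin \<mu>) / (cos \<mu> - k i * sin \<mu>)"
  have cs: "cos \<mu> * cos \<mu> + sin \<mu> * sin \<mu> = 1" using sin_cos_squared_add2[of \<mu>] by (simp add: power2_eq_square)
  have hs: "hsurf \<Omega> ?F ?N"
  proof
    show "open \<Omega>" "DIM('b) = DIM('a) + 2" by (fact open_dom dim_eq)+
    show "smooth_on \<Omega> ?F" "smooth_on \<Omega> ?N" by (rule smooth_FN)+
    fix y assume y: "y \<in> \<Omega>"
    note ips = FF[OF y] NN[OF y] NF[OF y] NdF[OF y] FdF[OF y] NdN[OF y] FdN[OF y]
    show "?F y \<bullet> ?F y = 1" "?N y \<bullet> ?N y = 1" "?N y \<bullet> ?F y = 0"
      using cs by (simp_all add: inner_add_left inner_add_right inner_diff_left inner_diff_right ips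
          inner_commute[of "F y" "N y"])
    show "?N y \<bullet> dd ?F y v = 0" for v
      unfolding dd_FN[OF y]
      by (simp add: inner_add_left inner_add_right inner_diff_left inner_diff_right ips)
    have "v = 0" if "dd ?F y v = 0" for v
    proof (cases "sin \<mu> = 0")
      case True
      then have "cos \<mu> \<noteq> 0" using cs by auto
      then show ?thesis using that True dF_eq_0_iff[OF y] unfolding dd_FN[OF y] by simp
    next
      case False
      have "sin \<mu> *\<^sub>R dd N y v = - cos \<mu> *\<^sub>R dd F y v"
        using that unfolding dd_FN[OF y] by (simp add: add_eq_0_iff)
      then have "(1 / sin \<mu>) *\<^sub>R (sin \<mu> *\<^sub>R dd N y v) = (1 / sin \<mu>) *\<^sub>R (- cos \<mu> *\<^sub>R dd F y v)" by simp
      then have "v \<in> PD (cos \<mu> / sin \<mu>) y" using False by (simp add: PD_def)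
      moreover have "cos \<mu> / sin \<mu> \<notin> k ` {1..g}"
      proof
        assume "cos \<mu> / sin \<mu> \<in> k ` {1..g}"
        then obtain i where "i \<in> {1..g}" "cos \<mu> / sin \<mu> = k i" by auto
        then show False using c[of i] False by (auto simp: divide_eq_eq)
      qed
      ultimately show ?thesis using not_PD[OF y] by blast
    qed
    moreover have "linear (dd ?F y)" using smooth_on_linear_dd[OF smooth_FN y] .
    ultimately show "inj (dd ?F y)" using linear_injective_0 by blast
  qed
  have PDeq: "hsurf.PD ?F ?N (?k i) y = PD (k i) y" if "y \<in> \<Omega>" "i \<in> {1..g}" for y i
  proof -
    define C where "C = cos \<mu> - k i * sin \<mu>"
    have C: "C \<noteq> 0" using c[OF that(2)] by (simp add: C_def)
    \<comment> \<open>The coefficients of dN and dF after multiplying the new eigenvalue equation by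
      C. They are 1 and \<open>k i\<close>, so this is the old equation.\<close>
    have e1: "C * cos \<mu> + (k i * cos \<mu> + sin \<mu>) * sin \<mu> = 1"
      using cs unfolding C_def by algebra
    have e2: "- C * sin \<mu> + (k i * cos \<mu> + sin \<mu>) * cos \<mu> = k i"
      using cs unfolding C_def by algebra
    have "v \<in> hsurf.PD ?F ?N (?k i) y \<longleftrightarrow> v \<in> PD (k i) y" for v
    proof -
      have "v \<in> hsurf.PD ?F ?N (?k i) y \<longleftrightarrow> dd ?N y v + ?k i *\<^sub>R dd ?F y v = 0"
        unfolding hsurf.PD_def[OF hs] by (simp add: eq_neg_iff_add_eq_0)
      also have "\<dots> \<longleftrightarrow> C *\<^sub>R (dd ?N y v + ?k i *\<^sub>R dd ?F y v) = 0" using C by simp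
      also have "C *\<^sub>R (dd ?N y v + ?k i *\<^sub>R dd ?F y v)
          = C *\<^sub>R dd ?N y v + (k i * cos \<mu> + sin \<mu>) *\<^sub>R dd ?F y v"
        using C by (simp add: scaleR_add_right C_def[symmetric])
      also have "\<dots> = (- C * sin \<mu> + (k i * cos \<mu> + sin \<mu>) * cos \<mu>) *\<^sub>R dd F y v
          + (C * cos \<mu> + (k i * cos \<mu> + sin \<mu>) * sin \<mu>) *\<^sub>R dd N y v"
        unfolding dd_FN[OF that(1)] by (simp add: algebra_simps)
      also have "\<dots> = 0 \<longleftrightarrow> v \<in> PD (k i) y"
        unfolding e1 e2 PD_def by (simp add: eq_neg_iff_add_eq_0 add.commute)
      finally show ?thesis .
    qed
    then show ?thesis by blast
  qed
  show ?thesis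
  proof (intro isosurf.intro hs isosurf_axioms.intro)
    show "inj_on ?k {1..g}"
    proof (rule inj_onI)
      fix i j assume ij: "i \<in> {1..g}" "j \<in> {1..g}" "?k i = ?k j"
      have "(k i * cos \<mu> + sin \<mu>) * (cos \<mu> - k j * sin \<mu>) = (k j * cos \<mu> + sin \<mu>) * (cos \<mu> - k i * sin \<mu>)"
        using ij(3) c[OF ij(1)] c[OF ij(2)] by (simp add: frac_eq_eq)
      then have "k i = k j" using cs by algebra
      then show "i = j" using inj_k ij by (auto dest: inj_onD)
    qed
    show "DIM('a) = g * m" by (fact dim_gm)
    show "dim (hsurf.PD ?F ?N (?k i) y) = m" if "y \<in> \<Omega>" "i \<in> {1..g}" for y i
      using PDeq[OF that] dim_PD[OF that] by simp
  qed
qed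

lemma focal_kernel:
  assumes "y \<in> \<Omega>" "b \<noteq> 0" "a = k i * b"
  shows "{v. dd (\<lambda>y. a *\<^sub>R F y + b *\<^sub>R N y) y v = 0} = PD (k i) y"
proof -
  have "a *\<^sub>R dd F y v + b *\<^sub>R dd N y v = b *\<^sub>R (dd N y v + k i *\<^sub>R dd F y v)" for v
    using assms(3) by (simp add: scaleR_add_right mult.commute)
  then show ?thesis
    unfolding dd_FN[OF assms(1)] PD_def using assms(2) by (auto simp: eq_neg_iff_add_eq_0)
qed

lemma focal_rank:
  assumes "y \<in> \<Omega>" "b \<noteq> 0" "a = k i * b" "i \<in> {1..g}"
  shows "dim (range (dd (\<lambda>y. a *\<^sub>R F y + b *\<^sub>R N y) y)) = m * (g - 1)"
  using dim_kernel_range[OF smooth_on_linear_dd[OF smooth_FN assms(1)], of a b]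
    focal_kernel[OF assms(1-3)] dim_PD[OF assms(1,4)] dim_gm
  by (simp add: algebra_simps diff_mult_distrib2)

end

section \<open>Cartan's identity\<close>

text \<open>
  The focal map \<open>f = k\<^sub>i F + N\<close> collapses the \<open>k\<^sub>i\<close>-curvature leaves, while the normal
  \<open>\<eta> = - F + k\<^sub>i N\<close> moves on a sphere in the fixed normal space of the focal submanifold.  The trace
  of the shape operator of the focal submanifold is linear in the normal vector and has the value
  \<open>m (\<Sum>j\<noteq>i. (1 + k\<^sub>i k\<^sub>j) / (k\<^sub>i - k\<^sub>j))\<close> at every \<open>\<eta>\<close>; a linear function which is constant on an open
  part of a sphere vanishes.
\<close>

lemma (in isosurf) cartan_identity:
  assumes y0: "y0 \<in> \<Omega>" and i: "i \<in> {1..g}"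
  shows "(\<Sum>j\<in>{1..g} - {i}. (1 + k i * k j) / (k i - k j)) = 0"
proof -
  define \<kappa> where "\<kappa> = k i"
  \<comment> \<open>A focal map and its normal, both scaled by sqrt (1 + \<kappa>^2). The explicit
    factors 1 and -1 keep them in the form covered by \<open>dd_FN\<close>.\<close>
  define f where "f y = \<kappa> *\<^sub>R F y + 1 *\<^sub>R N y" for y
  define \<eta> where "\<eta> y = (-1) *\<^sub>R F y + \<kappa> *\<^sub>R N y" for y
  have smf: "smooth_on \<Omega> f" and sm\<eta>: "smooth_on \<Omega> \<eta>"
    unfolding f_def[abs_def] \<eta>_def[abs_def] by (rule smooth_FN)+
  have df: "dd f y v = \<kappa> *\<^sub>R dd F y v + dd N y v" if "y \<in> \<Omega>" for y v
    using dd_FN[OF that, of \<kappa> 1 v] by (simp add: f_def[abs_def])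
  have d\<eta>: "dd \<eta> y v = - dd F y v + \<kappa> *\<^sub>R dd N y v" if "y \<in> \<Omega>" for y v
    using dd_FN[OF that, of "-1" \<kappa> v] by (simp add: \<eta>_def[abs_def])
  have ker: "dd f y v = 0 \<longleftrightarrow> v \<in> PD \<kappa> y" if "y \<in> \<Omega>" for y v
    using focal_kernel[OF that, of 1 \<kappa> i] by (auto simp: f_def[abs_def] \<kappa>_def)
  have rank: "dim (range (dd f y)) = m * (g - 1)" if "y \<in> \<Omega>" for y
    using focal_rank[OF that, of 1 \<kappa> i] i by (simp add: f_def[abs_def] \<kappa>_def)
  have d\<eta>_PD: "dd \<eta> y v = - (1 + \<kappa> * c) *\<^sub>R dd F y v" if "y \<in> \<Omega>" "v \<in> PD c y" for y v c
    using that(2) unfolding d\<eta>[OF that(1)] PD_def by (simp add: algebra_simps)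
  have df_PD: "dd f y v = (\<kappa> - c) *\<^sub>R dd F y v" if "y \<in> \<Omega>" "v \<in> PD c y" for y v c
    using that(2) unfolding df[OF that(1)] PD_def by (simp add: algebra_simps)
  have \<kappa>1: "1 + \<kappa> * \<kappa> > 0" by (rule add_pos_nonneg) auto
  obtain V :: "'a set" and \<psi> z0 A \<Lambda> where V: "open V" "convex V" "z0 \<in> V" "smooth_on V \<psi>" "\<psi> z0 = y0" "\<psi> ` V \<subseteq> \<Omega>"
    and bij: "\<And>z. z \<in> V \<Longrightarrow> bij (dd \<psi> z)"
    and A: "linear A" and L: "linear \<Lambda>"
    and LA: "\<And>w. \<Lambda> (A (\<Lambda> w)) = \<Lambda> w"
    and Lf: "\<And>z. z \<in> V \<Longrightarrow> \<Lambda> (f (\<psi> z)) = \<Lambda> (A z)"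
    and dep: "\<And>z z'. z \<in> V \<Longrightarrow> z' \<in> V \<Longrightarrow> \<Lambda> (A z) = \<Lambda> (A z') \<Longrightarrow> f (\<psi> z) = f (\<psi> z')"
    by (rule constant_rank[OF open_dom smf y0], erule rank, rule that)
  define P where "P v = \<Lambda> (A v)" for v
  have P: "linear P" unfolding P_def[abs_def] using linear_compose[OF A L] by (simp add: o_def)
  define \<rho> where "\<rho> z = f (\<psi> z)" for z
  define E where "E z = \<eta> (\<psi> z)" for z
  have \<psi>\<Omega>: "\<psi> z \<in> \<Omega>" if "z \<in> V" for z using V(6) that by auto
  have sm\<rho>: "smooth_on V \<rho>" and smE: "smooth_on V E" unfolding \<rho>_def[abs_def] E_def[abs_def]
    using smooth_on_compose[OF V(1) open_dom V(6) smf V(4)]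
      smooth_on_compose[OF V(1) open_dom V(6) sm\<eta> V(4)] by auto
  have d\<rho>: "dd \<rho> z v = dd f (\<psi> z) (dd \<psi> z v)" if "z \<in> V" for z v
    unfolding \<rho>_def[abs_def] by (rule dd_compose[OF smf V(4) that \<psi>\<Omega>[OF that]])
  have dE: "dd E z v = dd \<eta> (\<psi> z) (dd \<psi> z v)" if "z \<in> V" for z v
    unfolding E_def[abs_def] by (rule dd_compose[OF sm\<eta> V(4) that \<psi>\<Omega>[OF that]])
  have \<rho>dep: "\<rho> z = \<rho> z'" if "z \<in> V" "z' \<in> V" "P (z' - z) = 0" for z z'
    unfolding \<rho>_def by (rule dep) (use that in \<open>auto simp: P_def[symmetric] linear_diff[OF P]\<close>)
  have L\<rho>: "\<Lambda> (dd \<rho> z b) = P b" if "z \<in> V" for z b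
  proof -
    have "dd (\<lambda>z. \<Lambda> (\<rho> z)) z b = \<Lambda> (dd \<rho> z b)"
      using dd_bounded_linear[OF _ smooth_on_differentiable[OF sm\<rho> that]] L linear_conv_bounded_linear by blast
    moreover have "dd (\<lambda>z. \<Lambda> (\<rho> z)) z = dd P z"
      by (rule dd_cong[OF V(1) that]) (simp add: \<rho>_def Lf P_def)
    moreover have "dd P z = P"
      by (rule dd_eq) (use P linear_conv_bounded_linear bounded_linear_imp_has_derivative in blast)
    ultimately show ?thesis by simp
  qed
  have d\<rho>0: "dd \<rho> z d = 0" if "z \<in> V" "P d = 0" for z d
    by (rule dd_zero_if_constant_on_line[OF V(1) that(1) smooth_on_differentiable[OF sm\<rho> that(1)]])
      (rule \<rho>dep[symmetric], use that in \<open>auto simp: linear_cmul[OF P]\<close>)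
  \<comment> \<open>\<rho> is constant along the fibres of P, so its derivatives in all directions,
    transversal ones included, agree at points of one fibre.\<close>
  have line1: "dd \<rho> (z + c) = dd \<rho> z" if "z \<in> V" "z + c \<in> V" "P c = 0" for z c
  proof -
    have op: "open (V \<inter> (\<lambda>z. z + c) -` V)"
      by (intro open_Int open_vimage V(1) continuous_intros)
    have "dd \<rho> (z + c) = dd (\<lambda>z. \<rho> (z + c)) z"
      using dd_translate[OF smooth_on_differentiable[OF sm\<rho> that(2)]] by simp
    also have "\<dots> = dd \<rho> z"
      by (rule dd_cong[OF op]) (use that \<rho>dep in auto)
    finally show ?thesis .
  qed
  have line2: "dd (\<lambda>z. dd \<rho> z a) (z + c) = dd (\<lambda>z. dd \<rho> z a) z" if "z \<in> V" "z + c \<in> V" "P c = 0" for z c a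
  proof -
    have op: "open (V \<inter> (\<lambda>z. z + c) -` V)"
      by (intro open_Int open_vimage V(1) continuous_intros)
    have "dd (\<lambda>z. dd \<rho> z a) (z + c) = dd (\<lambda>z. dd \<rho> (z + c) a) z"
      using dd_translate[OF smooth_on_differentiable[OF smooth_on_dd[OF sm\<rho>] that(2)]] by simp
    also have "\<dots> = dd (\<lambda>z. dd \<rho> z a) z"
      by (rule dd_cong[OF op]) (use that line1 in auto)
    finally show ?thesis .
  qed
  have f\<eta>: "\<eta> y \<bullet> f y = 0" "\<eta> y \<bullet> dd f y v = 0" "\<eta> y \<bullet> \<eta> y = 1 + \<kappa> * \<kappa>" if "y \<in> \<Omega>" for y v
    unfolding df[OF that] f_def \<eta>_def
    by (simp_all add: inner_add_left inner_add_right inner_diff_left inner_diff_right inner_commute[of "F y" "N y"] FF[OF that] NN[OF that] NF[OF that]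
        NdF[OF that] FdF[OF that] NdN[OF that] FdN[OF that])
  have Ed\<rho>: "E z \<bullet> dd \<rho> z b = 0" if "z \<in> V" for z b
    unfolding d\<rho>[OF that] E_def by (rule f\<eta>(2)[OF \<psi>\<Omega>[OF that]])
  have Ed\<rho>': "dd E z a \<bullet> dd \<rho> z b + E z \<bullet> dd (\<lambda>z. dd \<rho> z b) z a = 0" if "z \<in> V" for z a b
    by (rule dd_inner_const[OF V(1) that smE smooth_on_dd[OF sm\<rho>] Ed\<rho>])
  define T where "T = range (dd \<rho> z0)"
  have T: "subspace T"
    unfolding T_def by (rule linear_subspace_image[OF smooth_on_linear_dd[OF sm\<rho> V(3)] subspace_UNIV])
  obtain C where C: "onb C T" "C \<subseteq> T" using onb_exists[OF T] by metis
  \<comment> \<open>\<open>\<Lambda> c\<close> is a coordinate lift of the tangent vector c of the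
    focal submanifold. Pairing \<zeta> with a normal gives the trace of the shape operator in that
    direction, and one \<zeta> serves the whole fibre through z0.\<close>
  define \<zeta> where "\<zeta> = (\<Sum>c\<in>C. dd (\<lambda>z. dd \<rho> z (\<Lambda> c)) z0 (\<Lambda> c))"
  define S where "S = (\<Sum>j\<in>{1..g} - {i}. (1 + k i * k j) / (k i - k j))"
  have T_eq: "T = range (dd f (\<psi> z))" and T_L: "\<And>t. t \<in> T \<Longrightarrow> dd \<rho> z (\<Lambda> t) = t"
    and E\<zeta>: "E z \<bullet> \<zeta> = real m * S" if z: "z \<in> V" "P (z - z0) = 0" for z
  proof -
    have l1: "dd \<rho> z = dd \<rho> z0" and l2: "\<And>a. dd (\<lambda>z. dd \<rho> z a) z = dd (\<lambda>z. dd \<rho> z a) z0"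
      using line1[of z0 "z - z0"] line2[of z0 "z - z0"] z V(3) by auto
    show Teq: "T = range (dd f (\<psi> z))"
    proof -
      have "range (dd \<rho> z) = dd f (\<psi> z) ` range (dd \<psi> z)" using d\<rho>[OF z(1)] by auto
      then show ?thesis using bij[OF z(1)] l1 by (simp add: T_def bij_is_surj)
    qed
    show TL: "dd \<rho> z (\<Lambda> t) = t" if t: "t \<in> T" for t
    proof -
      obtain b where b: "t = dd \<rho> z b" using t l1 T_def by auto
      have "dd \<rho> z (\<Lambda> t) - t = dd \<rho> z (P b - b)"
        unfolding b L\<rho>[OF z(1)] by (simp add: linear_diff[OF smooth_on_linear_dd[OF sm\<rho> z(1)]])
      also have "\<dots> = 0"
        by (rule d\<rho>0[OF z(1)]) (simp add: linear_diff[OF P], simp add: P_def LA)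
      finally show ?thesis by simp
    qed
    define y where "y = \<psi> z"
    have y: "y \<in> \<Omega>" using \<psi>\<Omega>[OF z(1)] by (simp add: y_def)
    obtain B where B: "\<And>i. i \<in> {1..g} \<Longrightarrow> onb (B i) (dd F y ` PD (k i) y)"
      "\<And>i. i \<in> {1..g} \<Longrightarrow> card (B i) = m" "\<And>i. i \<in> {1..g} \<Longrightarrow> B i \<subseteq> dd F y ` PD (k i) y"
      "\<And>i j. i \<in> {1..g} \<Longrightarrow> j \<in> {1..g} \<Longrightarrow> i \<noteq> j \<Longrightarrow> B i \<inter> B j = {}"
      "onb (\<Union>i\<in>{1..g}. B i) (range (dd F y))"
      using frame[OF y] by metis
    define U where "U = (\<Union>j\<in>{1..g} - {i}. B j)"
    have finB: "finite (B j)" if "j \<in> {1..g}" for j using B(1)[OF that] by (simp add: onb_def)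
    have UT: "U \<subseteq> T"
    proof
      fix t assume "t \<in> U"
      then obtain j where j: "j \<in> {1..g}" "j \<noteq> i" "t \<in> B j" unfolding U_def by blast
      then obtain w where w: "w \<in> PD (k j) y" "t = dd F y w" using B(3) by blast
      have "\<kappa> \<noteq> k j" using inj_k i j by (auto simp: \<kappa>_def dest: inj_onD)
      then have "t = dd f y ((1 / (\<kappa> - k j)) *\<^sub>R w)"
        using df_PD[OF y w(1)] w(2) by (simp add: linear_cmul[OF smooth_on_linear_dd[OF smf y]])
      then show "t \<in> T" using Teq y_def by blast
    qed
    have onbU: "onb U T"
    proof -
      have fin: "finite U" using finB by (simp add: U_def)
      have U1: "onb U (span U)" using B(5) fin by (auto simp: onb_def U_def)
      have "card U = (\<Sum>j\<in>{1..g} - {i}. card (B j))"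
        unfolding U_def by (rule card_UN_disjoint) (use finB B(4) in auto)
      also have "\<dots> = m * (g - 1)" using B(2) i by simp
      finally have "dim (span U) = dim T" using onb_card[OF U1] rank[OF y] Teq y_def by simp
      then have "span U = T"
        using subspace_dim_equal[OF subspace_span[of U] T span_minimal[OF UT T]] by simp
      then show ?thesis using U1 by simp
    qed
    have val: "- (dd E z (\<Lambda> t) \<bullet> t) = (1 + k i * k j) / (k i - k j)" if j: "j \<in> {1..g} - {i}" "t \<in> B j" for t j
    proof -
      obtain w where w: "w \<in> PD (k j) y" "t = dd F y w" using B(3) j by blast
      have ne: "\<kappa> \<noteq> k j" using inj_k i j by (auto simp: \<kappa>_def dest: inj_onD)
      \<comment> \<open>The principal lift of t. The lift v used in the trace differs from it by a
        vector of the collapsed eigenspace, whose image under d\<eta> is orthogonal to t.\<close>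
      define w' where "w' = (1 / (\<kappa> - k j)) *\<^sub>R w"
      define v where "v = dd \<psi> z (\<Lambda> t)"
      have w': "w' \<in> PD (k j) y" unfolding w'_def by (rule subspace_mul[OF subspace_PD[OF y] w(1)])
      have Fw': "dd F y w' = (1 / (\<kappa> - k j)) *\<^sub>R t"
        unfolding w'_def w(2) by (rule linear_cmul[OF linF[OF y]])
      have tT: "t \<in> T" using UT j unfolding U_def by blast
      have "dd f y v = t" using TL[OF tT] d\<rho>[OF z(1)] by (simp add: v_def y_def)
      moreover have "dd f y w' = t" using df_PD[OF y w'] Fw' ne by simp
      ultimately have "dd f y (v - w') = 0"
        by (simp add: linear_diff[OF smooth_on_linear_dd[OF smf y]])
      then have vw: "v - w' \<in> PD \<kappa> y" using ker[OF y] by simp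
      have orth: "dd F y (v - w') \<bullet> t = 0"
        unfolding w(2) by (rule PD_orthogonal[OF y vw w(1) ne])
      have tt: "t \<bullet> t = 1" using B(1) j by (auto simp: onb_def)
      have "dd E z (\<Lambda> t) = dd \<eta> y (w' + (v - w'))" using dE[OF z(1)] by (simp add: v_def y_def)
      also have "\<dots> = dd \<eta> y w' + dd \<eta> y (v - w')"
        by (rule linear_add[OF smooth_on_linear_dd[OF sm\<eta> y]])
      finally have "dd E z (\<Lambda> t) \<bullet> t = - (1 + \<kappa> * k j) * ((1 / (\<kappa> - k j)) * (t \<bullet> t))"
        unfolding d\<eta>_PD[OF y w'] d\<eta>_PD[OF y vw] Fw' by (simp add: inner_add_left orth)
      then show ?thesis by (simp add: tt \<kappa>_def minus_divide_left)
    qed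
    have "E z \<bullet> \<zeta> = (\<Sum>c\<in>C. - (dd E z (\<Lambda> c) \<bullet> c))"
      unfolding \<zeta>_def inner_sum_right
    proof (rule sum.cong[OF refl])
      fix c assume "c \<in> C"
      then have "dd \<rho> z (\<Lambda> c) = c" using TL C(2) by auto
      then show "E z \<bullet> dd (\<lambda>z. dd \<rho> z (\<Lambda> c)) z0 (\<Lambda> c) = - (dd E z (\<Lambda> c) \<bullet> c)"
        using Ed\<rho>'[OF z(1), of "\<Lambda> c" "\<Lambda> c"] l2 by simp
    qed
    also have "\<dots> = (\<Sum>t\<in>U. - (dd E z (\<Lambda> t) \<bullet> t))"
    proof (rule onb_trace[OF C(1) onbU, of "\<lambda>s t. - (dd E z (\<Lambda> s) \<bullet> t)"])
      show "linear (\<lambda>t. - (dd E z (\<Lambda> s) \<bullet> t))" for s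
        by (intro linearI) (simp_all add: inner_add_right)
      show "linear (\<lambda>s. - (dd E z (\<Lambda> s) \<bullet> t))" for t
        by (intro linearI) (simp_all add: linear_add[OF L] linear_cmul[OF L] inner_add_left
            linear_add[OF smooth_on_linear_dd[OF smE z(1)]] linear_cmul[OF smooth_on_linear_dd[OF smE z(1)]])
    qed
    also have "\<dots> = (\<Sum>j\<in>{1..g} - {i}. \<Sum>t\<in>B j. - (dd E z (\<Lambda> t) \<bullet> t))"
      unfolding U_def by (rule sum.UNION_disjoint) (use finB B(4) in auto)
    also have "\<dots> = (\<Sum>j\<in>{1..g} - {i}. \<Sum>t\<in>B j. (1 + k i * k j) / (k i - k j))"
      using val by (intro sum.cong refl) blast
    also have "\<dots> = real m * S" using B(2) by (simp add: S_def sum_distrib_left)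
    finally show "E z \<bullet> \<zeta> = real m * S" .
  qed
  \<comment> \<open>\<open>E z \<bullet> \<zeta>\<close> has a single value on the fibre through z0,
    so its derivatives along the fibre vanish, here to first order and in \<open>E2\<close> to
    second order.\<close>
  have E1: "dd E z e \<bullet> \<zeta> = 0" if "z \<in> V" "P (z - z0) = 0" "P e = 0" for z e
  proof -
    have bl: "bounded_linear (\<lambda>w. w \<bullet> \<zeta>)" by (rule bounded_linear_inner_left)
    have "dd (\<lambda>z. E z \<bullet> \<zeta>) z e = 0"
    proof (rule dd_zero_if_constant_on_line[OF V(1) that(1)])
      show "(\<lambda>z. E z \<bullet> \<zeta>) differentiable (at z)"
        by (rule smooth_on_differentiable[OF smooth_on_bounded_linear[OF bl V(1) smE] that(1)])
      show "E (z + s *\<^sub>R e) \<bullet> \<zeta> = E z \<bullet> \<zeta>" if "z + s *\<^sub>R e \<in> V" for s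
      proof -
        have "P (z + s *\<^sub>R e - z0) = 0"
          using \<open>P (z - z0) = 0\<close> \<open>P e = 0\<close> by (simp add: linear_diff[OF P] linear_add[OF P] linear_cmul[OF P])
        then show ?thesis using E\<zeta> that \<open>z \<in> V\<close> \<open>P (z - z0) = 0\<close> by metis
      qed
    qed
    then show ?thesis
      using dd_bounded_linear[OF bl smooth_on_differentiable[OF smE that(1)], of e] by simp
  qed
  have E2: "dd (\<lambda>z. dd E z e) z0 e \<bullet> \<zeta> = 0" if "P e = 0" for e
  proof -
    have bl: "bounded_linear (\<lambda>w. w \<bullet> \<zeta>)" by (rule bounded_linear_inner_left)
    have smE': "smooth_on V (\<lambda>z. dd E z e)" by (rule smooth_on_dd[OF smE])
    have "dd (\<lambda>z. dd E z e \<bullet> \<zeta>) z0 e = 0"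
    proof (rule dd_zero_if_constant_on_line[OF V(1) V(3)])
      show "(\<lambda>z. dd E z e \<bullet> \<zeta>) differentiable (at z0)"
        by (rule smooth_on_differentiable[OF smooth_on_bounded_linear[OF bl V(1) smE'] V(3)])
      show "dd E (z0 + s *\<^sub>R e) e \<bullet> \<zeta> = dd E z0 e \<bullet> \<zeta>" if "z0 + s *\<^sub>R e \<in> V" for s
        using E1[OF that _ \<open>P e = 0\<close>] E1[OF V(3) _ \<open>P e = 0\<close>] \<open>P e = 0\<close>
        by (simp add: linear_cmul[OF P] linear_0[OF P])
    qed
    then show ?thesis
      using dd_bounded_linear[OF bl smooth_on_differentiable[OF smE' V(3)], of e] by simp
  qed
  have P00: "P (z0 - z0) = 0" by (simp add: linear_0[OF P])
  \<comment> \<open>Vectors of the collapsed eigenspace are exactly those tangent to the fibre, so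
    in the coordinates \<psi> they come from the kernel of P.\<close>
  have lift: "\<exists>e. P e = 0 \<and> dd \<psi> z0 e = u" if "u \<in> PD \<kappa> y0" for u
  proof -
    obtain e where e: "dd \<psi> z0 e = u" using bij[OF V(3)] bij_is_surj by (metis surjD)
    have "P e = \<Lambda> (dd f y0 u)" using L\<rho>[OF V(3), of e] d\<rho>[OF V(3)] e V(5) by simp
    moreover have "dd f y0 u = 0" using ker[OF y0] that by simp
    ultimately have "P e = 0" using linear_0[OF L] by simp
    then show ?thesis using e by blast
  qed
  have dF\<zeta>: "dd F y0 u \<bullet> \<zeta> = 0" if u: "u \<in> PD \<kappa> y0" for u
  proof -
    obtain e where e: "P e = 0" "dd \<psi> z0 e = u" using lift[OF u] by blast
    have "dd E z0 e = - (1 + \<kappa> * \<kappa>) *\<^sub>R dd F y0 u"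
      using dE[OF V(3)] e(2) V(5) d\<eta>_PD[OF y0 u] by simp
    then show ?thesis using E1[OF V(3) P00 e(1)] \<kappa>1 by simp
  qed
  have "dim (PD \<kappa> y0) > 0" using dim_PD[OF y0 i] m_pos by (simp add: \<kappa>_def)
  then have "\<not> PD \<kappa> y0 \<subseteq> {0}" using dim_eq_0 by (metis less_irrefl)
  then obtain u where u: "u \<in> PD \<kappa> y0" "u \<noteq> 0" by blast
  obtain e where e: "P e = 0" "dd \<psi> z0 e = u" using lift[OF u(1)] by blast
  \<comment> \<open>The acceleration of E along the fibre and, below, its squared speed q. As E
    stays on a sphere, X has the inner product -q with E.\<close>
  define X where "X = dd (\<lambda>z. dd E z e) z0 e"
  define q where "q = dd E z0 e \<bullet> dd E z0 e"
  have smE': "smooth_on V (\<lambda>z. dd E z e)" by (rule smooth_on_dd[OF smE])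
  have "dd E z0 e = - (1 + \<kappa> * \<kappa>) *\<^sub>R dd F y0 u"
    using dE[OF V(3)] e(2) V(5) d\<eta>_PD[OF y0 u(1)] by simp
  then have "dd E z0 e \<noteq> 0" using \<kappa>1 dF_eq_0_iff[OF y0] u(2) by simp
  then have q: "q > 0" by (simp add: q_def)
  have EE: "E z \<bullet> E z = 1 + \<kappa> * \<kappa>" if "z \<in> V" for z
    using f\<eta>(3)[OF \<psi>\<Omega>[OF that]] by (simp add: E_def)
  have EdE: "dd E z e \<bullet> E z = 0" if "z \<in> V" for z
    using dd_inner_const[OF V(1) that smE smE EE, of e] by (simp add: inner_commute)
  have XE: "X \<bullet> E z0 = - q"
    using dd_inner_const[OF V(1) V(3) smE' smE EdE, of e] by (simp add: X_def q_def)
  have E\<rho>: "E z \<bullet> \<rho> z = 0" if "z \<in> V" for z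
    using f\<eta>(1)[OF \<psi>\<Omega>[OF that]] by (simp add: E_def \<rho>_def)
  have dE\<rho>: "dd E z e \<bullet> \<rho> z = 0" if "z \<in> V" for z
    using dd_inner_const[OF V(1) that smE sm\<rho> E\<rho>, of e] d\<rho>0[OF that e(1)] by simp
  have X\<rho>: "X \<bullet> \<rho> z0 = 0"
    using dd_inner_const[OF V(1) V(3) smE' sm\<rho> dE\<rho>, of e] d\<rho>0[OF V(3) e(1)] by (simp add: X_def)
  have dd\<rho>e: "dd (\<lambda>z. dd \<rho> z b) z e = 0" if "z \<in> V" for z b
  proof -
    have "dd (\<lambda>z. dd \<rho> z b) z e = dd (\<lambda>z. dd \<rho> z e) z b" by (rule dd_symmetric[OF V(1) sm\<rho> that])
    also have "\<dots> = 0" by (rule dd_const_on[OF V(1) that]) (rule d\<rho>0[OF _ e(1)])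
    finally show ?thesis .
  qed
  have dEd\<rho>: "dd E z e \<bullet> dd \<rho> z b = 0" if "z \<in> V" for z b
    using Ed\<rho>'[OF that, of e b] dd\<rho>e[OF that] by simp
  have Xd\<rho>: "X \<bullet> dd \<rho> z0 b = 0" for b
    using dd_inner_const[OF V(1) V(3) smE' smooth_on_dd[OF sm\<rho>] dEd\<rho>, of e b] dd\<rho>e[OF V(3)]
    by (simp add: X_def)
  \<comment> \<open>X with its component along E removed. It is orthogonal to \<eta>, to f and to T,
    hence lies in the image of the collapsed eigenspace, on which \<zeta> vanishes by
    \<open>dF\<zeta>\<close>. So X . \<zeta> = 0 forces q (E . \<zeta>) = 0.\<close>
  define W where "W = (1 + \<kappa> * \<kappa>) *\<^sub>R X + q *\<^sub>R E z0"
  have WE: "W \<bullet> \<eta> y0 = 0"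
    using XE EE[OF V(3)] V(5) by (simp add: W_def inner_add_left E_def)
  have Wf: "W \<bullet> f y0 = 0"
    using X\<rho> E\<rho>[OF V(3)] V(5) by (simp add: W_def inner_add_left \<rho>_def)
  have WT: "W \<bullet> t = 0" if "t \<in> T" for t
    using that Xd\<rho> Ed\<rho>[OF V(3)] by (auto simp: T_def W_def inner_add_left)
  have "(1 + \<kappa> * \<kappa>) *\<^sub>R F y0 = \<kappa> *\<^sub>R f y0 - \<eta> y0" "(1 + \<kappa> * \<kappa>) *\<^sub>R N y0 = f y0 + \<kappa> *\<^sub>R \<eta> y0"
    by (simp_all add: f_def \<eta>_def algebra_simps)
  then have "(1 + \<kappa> * \<kappa>) * (W \<bullet> F y0) = 0" "(1 + \<kappa> * \<kappa>) * (W \<bullet> N y0) = 0"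
    by (simp_all add: inner_scaleR_right[symmetric] inner_add_right inner_diff_right Wf WE del: inner_scaleR_right)
      (simp_all add: Wf WE)
  then have "W \<bullet> F y0 = 0" "W \<bullet> N y0 = 0" using \<kappa>1 by auto
  then have Wr: "W \<in> range (dd F y0)" by (rule range_dF[OF y0])
  obtain B where B: "\<And>i. i \<in> {1..g} \<Longrightarrow> B i \<subseteq> dd F y0 ` PD (k i) y0"
    "onb (\<Union>i\<in>{1..g}. B i) (range (dd F y0))"
    using frame[OF y0] by metis
  have "(W \<bullet> b) * (b \<bullet> \<zeta>) = 0" if b: "b \<in> (\<Union>i\<in>{1..g}. B i)" for b
  proof -
    obtain j where j: "j \<in> {1..g}" "b \<in> B j" using b by blast
    then obtain w where w: "w \<in> PD (k j) y0" "b = dd F y0 w" using B(1) by blast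
    show ?thesis
    proof (cases "j = i")
      case True
      then show ?thesis using dF\<zeta> w by (simp add: \<kappa>_def)
    next
      case False
      then have "\<kappa> \<noteq> k j" using inj_k i j by (auto simp: \<kappa>_def dest: inj_onD)
      then have "b = dd f y0 ((1 / (\<kappa> - k j)) *\<^sub>R w)"
        using df_PD[OF y0 w(1)] w(2) by (simp add: linear_cmul[OF smooth_on_linear_dd[OF smf y0]])
      then have "b \<in> T" using T_eq[OF V(3) P00] V(5) by blast
      then show ?thesis using WT by simp
    qed
  qed
  then have "(\<Sum>b\<in>(\<Union>i\<in>{1..g}. B i). (W \<bullet> b) * (b \<bullet> \<zeta>)) = 0" by (intro sum.neutral) blast
  moreover have "W \<bullet> \<zeta> = (\<Sum>b\<in>(\<Union>i\<in>{1..g}. B i). (W \<bullet> b) * (b \<bullet> \<zeta>))"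
    by (subst onb_expand[OF B(2) Wr]) (simp add: inner_sum_left)
  ultimately have "W \<bullet> \<zeta> = 0" by (rule trans[rotated])
  then have "q * (E z0 \<bullet> \<zeta>) = 0" using E2[OF e(1)] by (simp add: W_def inner_add_left X_def)
  then have "real m * S = 0" using E\<zeta>[OF V(3) P00] q by simp
  then show ?thesis using m_pos by (simp add: S_def)
qed

section \<open>The Gauss equation\<close>

context hsurf
begin

text \<open>The moving frame F, N, dF as an isomorphism from a fixed vector space onto the ambient
  space. Its inverse is smooth by \<open>smooth_on_linear_solve\<close>, which makes tangential
  components smooth without inverting a Gram matrix.\<close>

definition frame_map :: "'e \<Rightarrow> real \<times> real \<times> 'e \<Rightarrow> 'b" where
  "frame_map y p = fst p *\<^sub>R F y + fst (snd p) *\<^sub>R N y + dd F y (snd (snd p))"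

definition frame_inv :: "'e \<Rightarrow> 'b \<Rightarrow> real \<times> real \<times> 'e" where
  "frame_inv y w = (w \<bullet> F y, w \<bullet> N y,
     Hilbert_Choice.inv (dd F y) (w - (w \<bullet> F y) *\<^sub>R F y - (w \<bullet> N y) *\<^sub>R N y))"

lemma linear_frame_map: "y \<in> \<Omega> \<Longrightarrow> linear (frame_map y)"
  by (intro linearI) (simp_all add: frame_map_def linear_add[OF linF] linear_cmul[OF linF] algebra_simps)

lemma tangential_in_range:
  assumes "y \<in> \<Omega>"
  shows "w - (w \<bullet> F y) *\<^sub>R F y - (w \<bullet> N y) *\<^sub>R N y \<in> range (dd F y)"
  by (rule range_dF[OF assms])
    (simp_all add: inner_diff_left FF NN NF assms inner_commute[of "F y" "N y"])

lemma frame_map_inv: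
  assumes "y \<in> \<Omega>"
  shows "frame_map y (frame_inv y w) = w"
  using f_inv_into_f[OF tangential_in_range[OF assms]] by (simp add: frame_map_def frame_inv_def)

lemma frame_inv_map:
  assumes "y \<in> \<Omega>"
  shows "frame_inv y (frame_map y p) = p"
proof -
  have "frame_map y p \<bullet> F y = fst p" "frame_map y p \<bullet> N y = fst (snd p)"
    using FF[OF assms] NN[OF assms] NF[OF assms] FdF[OF assms] NdF[OF assms]
    by (simp_all add: frame_map_def inner_add_left inner_add_right inner_commute)
  then show ?thesis
    using inv_f_f[OF injF[OF assms]] by (simp add: frame_inv_def frame_map_def prod_eq_iff)
qed

lemma smooth_frame_map: "smooth_on \<Omega> (\<lambda>y. frame_map y p)"
  unfolding frame_map_def
  by (intro smooth_on_add smooth_on_cmul smooth_on_dd open_dom smF smN)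

lemma linear_frame_inv:
  assumes "y \<in> \<Omega>"
  shows "linear (frame_inv y)"
proof (rule linearI)
  show "frame_inv y (v + w) = frame_inv y v + frame_inv y w" for v w
    using frame_inv_map[OF assms, of "frame_inv y v + frame_inv y w"] frame_map_inv[OF assms]
    by (simp add: linear_add[OF linear_frame_map[OF assms]])
  show "frame_inv y (c *\<^sub>R v) = c *\<^sub>R frame_inv y v" for c v
    using frame_inv_map[OF assms, of "c *\<^sub>R frame_inv y v"] frame_map_inv[OF assms]
    by (simp add: linear_cmul[OF linear_frame_map[OF assms]])
qed

lemma smooth_frame_inv:
  assumes "smooth_on \<Omega> X"
  shows "smooth_on \<Omega> (\<lambda>y. frame_inv y (X y))"
proof -
  have *: "smooth_on \<Omega> (\<lambda>y. frame_inv y w)" for w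
    by (rule smooth_on_linear_solve[OF open_dom linear_frame_map frame_inv_map frame_map_inv smooth_frame_map])
  show ?thesis by (rule smooth_linear_app[OF open_dom linear_frame_inv * assms])
qed

section \<open>The Levi-Civita connection and the curvature tensor of the induced metric\<close>

abbreviation hess :: "'e \<Rightarrow> 'e \<Rightarrow> 'e \<Rightarrow> 'b" where
  "hess y u v \<equiv> dd (\<lambda>z. dd F z v) y u"

abbreviation G :: "'e \<Rightarrow> 'e \<Rightarrow> 'e \<Rightarrow> real" where
  "G y u v \<equiv> dd F y u \<bullet> dd F y v"

definition II :: "'e \<Rightarrow> 'e \<Rightarrow> 'e \<Rightarrow> real" where
  "II y u v = - (dd N y u \<bullet> dd F y v)"

definition Gam :: "'e \<Rightarrow> 'e \<Rightarrow> 'e \<Rightarrow> 'e" where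
  "Gam y u v = snd (snd (frame_inv y (hess y u v)))"

lemma hess_sym: "y \<in> \<Omega> \<Longrightarrow> hess y u v = hess y v u"
  using dd_symmetric[OF open_dom smF] by blast

lemma hess_N:
  assumes "y \<in> \<Omega>"
  shows "hess y u v \<bullet> N y = II y u v"
  using dd_inner_const[OF open_dom assms smN smooth_on_dd[OF smF] NdF, of u v]
  by (simp add: II_def inner_commute)

lemma hess_F:
  assumes "y \<in> \<Omega>"
  shows "hess y u v \<bullet> F y = - G y u v"
  using dd_inner_const[OF open_dom assms smF smooth_on_dd[OF smF] FdF, of u v]
  by (simp add: inner_commute)

text \<open>Gauss formula; the component along F comes from the curvature of the unit sphere in the
  ambient space.\<close>

lemma hess_decomp:
  assumes "y \<in> \<Omega>"
  shows "hess y u v = dd F y (Gam y u v) + II y u v *\<^sub>R N y - G y u v *\<^sub>R F y"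
  using frame_map_inv[OF assms, of "hess y u v"]
  by (simp add: frame_map_def Gam_def frame_inv_def hess_N[OF assms] hess_F[OF assms] algebra_simps)

lemma hess_tangential: "y \<in> \<Omega> \<Longrightarrow> hess y u v \<bullet> dd F y w = G y (Gam y u v) w"
  by (subst hess_decomp) (simp_all add: inner_add_left inner_diff_left NdF FdF)

lemma smooth_Gam: "smooth_on \<Omega> (\<lambda>y. Gam y u v)"
  unfolding Gam_def
  by (intro smooth_on_bounded_linear[OF bounded_linear_snd] open_dom smooth_frame_inv smooth_on_dd smF)

lemma eq_if_G_eq:
  assumes "y \<in> \<Omega>" "\<And>w. G y u w = G y v w"
  shows "u = v"
proof -
  have "dd F y (u - v) \<bullet> dd F y (u - v) = 0"
    using assms(2)[of "u - v"] by (simp add: linear_diff[OF linF[OF assms(1)]] inner_diff_left)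
  then show ?thesis using dF_eq_0_iff[OF assms(1)] by simp
qed

lemma sharp_eqI:
  assumes "y \<in> \<Omega>" "\<And>w. G y z w = \<alpha> w"
  shows "sharp (G y) \<alpha> = z"
  unfolding sharp_def using assms eq_if_G_eq by (intro the_equality) (blast, metis)

text \<open>Each derivative of G in the Koszul formula gives two second derivatives of F. By
  symmetry they cancel except for twice the term with \<open>hess y u v\<close>.\<close>

lemma christoffel_eq:
  assumes y: "y \<in> \<Omega>"
  shows "christoffel G y u v = Gam y u v"
  unfolding christoffel_def deriv_along_def
proof (rule sharp_eqI[OF y])
  fix w
  have dG: "dd (\<lambda>z. G z v w) y u = hess y u v \<bullet> dd F y w + dd F y v \<bullet> hess y u w" for u v w
    by (rule dd_inner[OF smooth_on_differentiable[OF smooth_on_dd[OF smF] y]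
          smooth_on_differentiable[OF smooth_on_dd[OF smF] y]])
  have "dd (\<lambda>z. G z v w) y u + dd (\<lambda>z. G z u w) y v - dd (\<lambda>z. G z u v) y w = 2 * (hess y u v \<bullet> dd F y w)"
    unfolding dG using hess_sym[OF y] by (simp add: inner_commute)
  then show "G y (Gam y u v) w
      = (dd (\<lambda>z. G z v w) y u + dd (\<lambda>z. G z u w) y v - dd (\<lambda>z. G z u v) y w) / 2"
    using hess_tangential[OF y] by simp
qed

lemma smooth_II: "smooth_on \<Omega> (\<lambda>y. II y u v)"
  unfolding II_def by (intro smooth_on_minus smooth_on_inner smooth_on_dd open_dom smN smF)

lemma smooth_G: "smooth_on \<Omega> (\<lambda>y. G y u v)"
  by (intro smooth_on_inner smooth_on_dd open_dom smF)

text \<open>The tangential part of the differentiated Gauss formula. Derivatives of the coefficients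
  II and G multiply N and F and drop out.\<close>

lemma third_derivative:
  assumes y: "y \<in> \<Omega>"
  shows "dd (\<lambda>z. hess z v w) y u \<bullet> dd F y x =
    G y (dd (\<lambda>z. Gam z v w) y u + Gam y u (Gam y v w)) x
      - II y v w * II y u x - G y v w * G y u x"
proof -
  have sm: "smooth_on \<Omega> (\<lambda>z. dd F z (Gam z v w))"
    by (rule smooth_linear_app[OF open_dom linF smooth_on_dd[OF smF] smooth_Gam])
  have sm': "smooth_on \<Omega> (\<lambda>z. II z v w *\<^sub>R N z)" "smooth_on \<Omega> (\<lambda>z. G z v w *\<^sub>R F z)"
    by (intro smooth_on_scaleR open_dom smooth_II smooth_G smN smF)+
  note df = smooth_on_differentiable[OF _ y]
  have "dd (\<lambda>z. hess z v w) y u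
      = dd (\<lambda>z. dd F z (Gam z v w) + II z v w *\<^sub>R N z - G z v w *\<^sub>R F z) y u"
    by (rule fun_cong[OF dd_cong[OF open_dom y hess_decomp]])
  also have "\<dots> = dd (\<lambda>z. dd F z (Gam z v w)) y u + dd (\<lambda>z. II z v w *\<^sub>R N z) y u
      - dd (\<lambda>z. G z v w *\<^sub>R F z) y u"
    by (simp add: dd_diff[OF df[OF smooth_on_add[OF open_dom sm sm'(1)]] df[OF sm'(2)]]
        dd_add[OF df[OF sm] df[OF sm'(1)]])
  also have "dd (\<lambda>z. II z v w *\<^sub>R N z) y u = II y v w *\<^sub>R dd N y u + dd (\<lambda>z. II z v w) y u *\<^sub>R N y"
    using dd_eq[OF has_derivative_scaleR[OF smooth_on_has_derivative[OF smooth_II y]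
          smooth_on_has_derivative[OF smN y]]] by simp
  also have "dd (\<lambda>z. G z v w *\<^sub>R F z) y u = G y v w *\<^sub>R dd F y u + dd (\<lambda>z. G z v w) y u *\<^sub>R F y"
    using dd_eq[OF has_derivative_scaleR[OF smooth_on_has_derivative[OF smooth_G y]
          smooth_on_has_derivative[OF smF y]]] by simp
  also have "dd (\<lambda>z. dd F z (Gam z v w)) y u
      = hess y u (Gam y v w) + dd F y (dd (\<lambda>z. Gam z v w) y u)"
    by (rule dd_linear_app[OF open_dom y linF smooth_on_dd[OF smF] smooth_Gam])
  finally show ?thesis
    using hess_tangential[OF y, of "Gam y v w" u x]
    by (simp add: inner_add_left inner_diff_left NdF[OF y] FdF[OF y] linear_add[OF linF[OF y]] II_def)
qed

text \<open>Third derivatives of F commute, so two instances of \<open>third_derivative\<close> have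
  equal left sides; their difference isolates the curvature tensor.\<close>

lemma gauss_equation:
  assumes y: "y \<in> \<Omega>"
  shows "G y (riemann G y u v w) x =
    II y v w * II y u x - II y u w * II y v x + G y v w * G y u x - G y u w * G y v x"
proof -
  have cong: "dd (\<lambda>z. christoffel G z v w) y u = dd (\<lambda>z. Gam z v w) y u" for u v w
    by (rule fun_cong[OF dd_cong[OF open_dom y christoffel_eq]])
  have "riemann G y u v w = (dd (\<lambda>z. Gam z v w) y u + Gam y u (Gam y v w))
      - (dd (\<lambda>z. Gam z u w) y v + Gam y v (Gam y u w))"
    unfolding riemann_def deriv_along_def cong christoffel_eq[OF y] by simp
  then have "G y (riemann G y u v w) x = G y (dd (\<lambda>z. Gam z v w) y u + Gam y u (Gam y v w)) x
      - G y (dd (\<lambda>z. Gam z u w) y v + Gam y v (Gam y u w)) x"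
    by (simp add: linear_diff[OF linF[OF y]] inner_diff_left)
  moreover have "dd (\<lambda>z. hess z v w) y u = dd (\<lambda>z. hess z u w) y v"
    by (rule dd_symmetric[OF open_dom smooth_on_dd[OF smF] y])
  ultimately show ?thesis
    using third_derivative[OF y, of w v u x] third_derivative[OF y, of w u v x] by simp
qed

text \<open>The standard basis in the definition of the Ricci tensor is not orthonormal for G.
  Expanding it in the frame pulled back from an orthonormal basis of the tangent space gives the
  same trace in adapted form.\<close>

lemma trace_frame:
  assumes y: "y \<in> \<Omega>" and U: "onb U (range (dd F y))" and L: "linear L"
  shows "(\<Sum>b\<in>Basis. L b \<bullet> b) = (\<Sum>c\<in>U. dd F y (L (Hilbert_Choice.inv (dd F y) c)) \<bullet> c)"
proof -
  define e where "e = Hilbert_Choice.inv (dd F y)"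
  have ran: "c \<in> range (dd F y)" if "c \<in> U" for c
    using U span_base[OF that] by (simp add: onb_def)
  have e: "dd F y (e c) = c" if "c \<in> U" for c
    unfolding e_def using f_inv_into_f[OF ran[OF that]] .
  have exp: "v = (\<Sum>c\<in>U. (dd F y v \<bullet> c) *\<^sub>R e c)" for v
  proof -
    have "dd F y v = (\<Sum>c\<in>U. (dd F y v \<bullet> c) *\<^sub>R c)" by (rule onb_expand[OF U]) simp
    also have "\<dots> = dd F y (\<Sum>c\<in>U. (dd F y v \<bullet> c) *\<^sub>R e c)"
      by (simp add: linear_sum[OF linF[OF y]] linear_cmul[OF linF[OF y]] e)
    finally show ?thesis using injF[OF y] by (simp add: inj_eq)
  qed
  have "(\<Sum>b\<in>Basis. L b \<bullet> b) = (\<Sum>b\<in>Basis. \<Sum>c\<in>U. (dd F y (L b) \<bullet> c) * (e c \<bullet> b))"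
    by (rule sum.cong[OF refl], subst exp) (simp add: inner_sum_left)
  also have "\<dots> = (\<Sum>c\<in>U. \<Sum>b\<in>Basis. (dd F y (L b) \<bullet> c) * (e c \<bullet> b))" by (rule sum.swap)
  also have "\<dots> = (\<Sum>c\<in>U. dd F y (L (e c)) \<bullet> c)"
  proof (rule sum.cong[OF refl])
    fix c
    have "linear (\<lambda>b. dd F y (L b) \<bullet> c)"
      by (intro linearI) (simp_all add: linear_add[OF L] linear_cmul[OF L] linear_add[OF linF[OF y]]
          linear_cmul[OF linF[OF y]] inner_add_left)
    from linear_Basis_expand[OF this, of "e c"]
    show "(\<Sum>b\<in>Basis. (dd F y (L b) \<bullet> c) * (e c \<bullet> b)) = dd F y (L (e c)) \<bullet> c"
      by (simp add: mult.commute)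
  qed
  finally show ?thesis by (simp add: e_def)
qed

text \<open>Linearity of \<open>riemann\<close> is hidden by \<open>sharp\<close> and by derivatives
  of Christoffel terms. Nondegeneracy of G lets it be read off the right side of the Gauss
  equation.\<close>

lemma linear_if_linear_G:
  assumes y: "y \<in> \<Omega>" and "\<And>w. linear (\<lambda>u. G y (L u) w)"
  shows "linear L"
proof (rule linearI)
  show "L (u + v) = L u + L v" for u v
    by (rule eq_if_G_eq[OF y])
      (use linear_add[OF assms(2)] in \<open>simp add: linear_add[OF linF[OF y]] inner_add_left\<close>)
  show "L (c *\<^sub>R u) = c *\<^sub>R L u" for c u
    by (rule eq_if_G_eq[OF y])
      (use linear_cmul[OF assms(2)] in \<open>simp add: linear_cmul[OF linF[OF y]]\<close>)
qed

lemma linear_II_left: "y \<in> \<Omega> \<Longrightarrow> linear (\<lambda>u. II y u v)"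
  and linear_II_right: "y \<in> \<Omega> \<Longrightarrow> linear (II y u)"
  and linear_G_left: "y \<in> \<Omega> \<Longrightarrow> linear (\<lambda>u. G y u v)"
  and linear_G_right: "y \<in> \<Omega> \<Longrightarrow> linear (\<lambda>v. G y u v)"
  by (intro linearI; simp add: II_def linear_add[OF linF] linear_cmul[OF linF] linear_add[OF linN]
      linear_cmul[OF linN] inner_add_left inner_add_right)+

lemma scalar_curvature_frame:
  assumes y: "y \<in> \<Omega>" and U: "onb U (range (dd F y))"
    and eig: "\<And>c. c \<in> U \<Longrightarrow> dd N y (Hilbert_Choice.inv (dd F y) c) = - kc c *\<^sub>R c"
  shows "metric_scalar_curvature G y
    = (\<Sum>c\<in>U. kc c)\<^sup>2 - (\<Sum>c\<in>U. (kc c)\<^sup>2) + real (card U) * (real (card U) - 1)"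
proof -
  define e where "e = Hilbert_Choice.inv (dd F y)"
  have ran: "c \<in> range (dd F y)" if "c \<in> U" for c
    using U span_base[OF that] by (simp add: onb_def)
  have e: "dd F y (e c) = c" if "c \<in> U" for c
    unfolding e_def using f_inv_into_f[OF ran[OF that]] .
  have fin: "finite U" using U by (simp add: onb_def)
  have ip: "c \<bullet> d = (if c = d then 1 else 0)" if "c \<in> U" "d \<in> U" for c d
    using U that by (auto simp: onb_def)
  have ric: "ricci G y v w = (\<Sum>c\<in>U. G y (riemann G y (e c) v w) (e c))" for v w
  proof -
    have "linear (\<lambda>u. riemann G y u v w)"
      by (rule linear_if_linear_G[OF y]) (unfold gauss_equation[OF y],
          intro linear_compose_add linear_compose_sub;
          simp add: linearI linear_add[OF linear_II_left[OF y]] linear_cmul[OF linear_II_left[OF y]]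
            linear_add[OF linear_G_left[OF y]] linear_cmul[OF linear_G_left[OF y]] algebra_simps)
    from trace_frame[OF y U this] show ?thesis
      unfolding ricci_def e_def[symmetric] by (simp add: e cong: sum.cong)
  qed
  have ric_lin1: "linear (\<lambda>v. ricci G y v w)" and ric_lin2: "linear (ricci G y v)" for v w
    unfolding ric gauss_equation[OF y]
    by (intro linearI; simp add: linear_add[OF linear_II_left[OF y]] linear_cmul[OF linear_II_left[OF y]]
        linear_add[OF linear_G_left[OF y]] linear_cmul[OF linear_G_left[OF y]]
        linear_add[OF linear_II_right[OF y]] linear_cmul[OF linear_II_right[OF y]]
        linear_add[OF linear_G_right[OF y]] linear_cmul[OF linear_G_right[OF y]]
        algebra_simps sum.distrib sum_distrib_left sum_subtractf)+
  define L where "L v = (\<Sum>c\<in>U. ricci G y v (e c) *\<^sub>R e c)" for v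
  have exp: "w = (\<Sum>c\<in>U. (c \<bullet> dd F y w) *\<^sub>R e c)" for w
  proof -
    have "dd F y w = (\<Sum>c\<in>U. (dd F y w \<bullet> c) *\<^sub>R c)" by (rule onb_expand[OF U]) simp
    also have "\<dots> = dd F y (\<Sum>c\<in>U. (c \<bullet> dd F y w) *\<^sub>R e c)"
      by (simp add: linear_sum[OF linF[OF y]] linear_cmul[OF linF[OF y]] e inner_commute)
    finally show ?thesis using injF[OF y] by (simp add: inj_eq)
  qed
  have GL: "G y (L v) w = ricci G y v w" for v w
  proof -
    have "G y (L v) w = (\<Sum>c\<in>U. ricci G y v (e c) * (c \<bullet> dd F y w))"
      by (simp add: L_def linear_sum[OF linF[OF y]] linear_cmul[OF linF[OF y]] inner_sum_left e)
    also have "\<dots> = ricci G y v (\<Sum>c\<in>U. (c \<bullet> dd F y w) *\<^sub>R e c)"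
      by (simp add: linear_sum[OF ric_lin2] linear_cmul[OF ric_lin2] mult.commute)
    finally show ?thesis using exp[of w] by simp
  qed
  have sharp: "sharp (G y) (ricci G y v) = L v" for v by (rule sharp_eqI[OF y GL])
  have linL: "linear L" by (rule linear_if_linear_G[OF y]) (simp add: GL ric_lin1)
  have "metric_scalar_curvature G y = (\<Sum>c\<in>U. dd F y (L (e c)) \<bullet> c)"
    unfolding metric_scalar_curvature_def sharp e_def by (rule trace_frame[OF y U linL])
  also have "\<dots> = (\<Sum>c\<in>U. ricci G y (e c) (e c))"
    by (rule sum.cong[OF refl]) (use GL e in metis)
  \<comment> \<open>For c different from d the summand is the sectional curvature 1 + kc c kc d; the
    conditional terms make the diagonal vanish.\<close>
  also have "\<dots> = (\<Sum>c\<in>U. \<Sum>d\<in>U. kc c * kc d - (if c = d then (kc c)\<^sup>2 else 0) + 1 - (if c = d then 1 else 0))"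
    unfolding ric gauss_equation[OF y]
  proof (intro sum.cong refl)
    fix c d assume cd: "c \<in> U" "d \<in> U"
    have II: "II y (e a) (e b) = kc a * (a \<bullet> b)" if "a \<in> U" "b \<in> U" for a b
      using eig[OF that(1)] that by (simp add: II_def e e_def[symmetric])
    show "II y (e c) (e c) * II y (e d) (e d) - II y (e d) (e c) * II y (e c) (e d)
        + G y (e c) (e c) * G y (e d) (e d) - G y (e d) (e c) * G y (e c) (e d)
      = kc c * kc d - (if c = d then (kc c)\<^sup>2 else 0) + 1 - (if c = d then 1 else 0)"
      using cd by (simp add: II e ip power2_eq_square)
  qed
  also have "\<dots> = (\<Sum>c\<in>U. kc c)\<^sup>2 - (\<Sum>c\<in>U. (kc c)\<^sup>2) + real (card U) * (real (card U) - 1)"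
    using fin by (simp add: sum.distrib sum_subtractf power2_eq_square sum_product algebra_simps)
  finally show ?thesis .
qed

end

lemma (in isosurf) scalar_curvature_eq:
  assumes y: "y \<in> \<Omega>"
  shows "metric_scalar_curvature (\<lambda>z u v. dd F z u \<bullet> dd F z v) y =
    (real m * (\<Sum>i\<in>{1..g}. k i))\<^sup>2 - real m * (\<Sum>i\<in>{1..g}. (k i)\<^sup>2) + real DIM('a) * (real DIM('a) - 1)"
proof -
  obtain B where B: "\<And>i. i \<in> {1..g} \<Longrightarrow> onb (B i) (dd F y ` PD (k i) y)"
    "\<And>i. i \<in> {1..g} \<Longrightarrow> card (B i) = m" "\<And>i. i \<in> {1..g} \<Longrightarrow> B i \<subseteq> dd F y ` PD (k i) y"
    "\<And>i j. i \<in> {1..g} \<Longrightarrow> j \<in> {1..g} \<Longrightarrow> i \<noteq> j \<Longrightarrow> B i \<inter> B j = {}"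
    "onb (\<Union>i\<in>{1..g}. B i) (range (dd F y))"
    using frame[OF y] by metis
  define kc where "kc c = - (dd N y (Hilbert_Choice.inv (dd F y) c) \<bullet> c)" for c
  have dN: "dd N y (Hilbert_Choice.inv (dd F y) c) = - k i *\<^sub>R c" and kc: "kc c = k i"
    if i: "i \<in> {1..g}" "c \<in> B i" for i c
  proof -
    obtain w where w: "w \<in> PD (k i) y" "c = dd F y w" using B(3) i by blast
    then show *: "dd N y (Hilbert_Choice.inv (dd F y) c) = - k i *\<^sub>R c"
      using inv_f_f[OF injF[OF y]] by (simp add: PD_def)
    have "c \<bullet> c = 1" using B(1)[OF i(1)] i(2) by (simp add: onb_def)
    then show "kc c = k i" using * by (simp add: kc_def)
  qed
  have finB: "finite (B j)" if "j \<in> {1..g}" for j using B(1)[OF that] by (simp add: onb_def)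
  have sums: "(\<Sum>c\<in>(\<Union>i\<in>{1..g}. B i). \<phi> (kc c)) = real m * (\<Sum>i\<in>{1..g}. \<phi> (k i))" for \<phi> :: "real \<Rightarrow> real"
  proof -
    have "(\<Sum>c\<in>(\<Union>i\<in>{1..g}. B i). \<phi> (kc c)) = (\<Sum>i\<in>{1..g}. \<Sum>c\<in>B i. \<phi> (kc c))"
      by (rule sum.UNION_disjoint) (use finB B(4) in auto)
    also have "\<dots> = (\<Sum>i\<in>{1..g}. \<Sum>c\<in>B i. \<phi> (k i))"
      using kc by (intro sum.cong refl) simp
    also have "\<dots> = real m * (\<Sum>i\<in>{1..g}. \<phi> (k i))"
      using B(2) by (simp add: sum_distrib_left)
    finally show ?thesis .
  qed
  have "dd N y (Hilbert_Choice.inv (dd F y) c) = - kc c *\<^sub>R c" if c: "c \<in> (\<Union>i\<in>{1..g}. B i)" for c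
  proof -
    obtain i where i: "i \<in> {1..g}" "c \<in> B i" using c by blast
    show ?thesis using dN[OF i] kc[OF i] by simp
  qed
  from scalar_curvature_frame[OF y B(5) this]
  have "metric_scalar_curvature (\<lambda>z u v. dd F z u \<bullet> dd F z v) y =
      (real m * (\<Sum>i\<in>{1..g}. k i))\<^sup>2 - real m * (\<Sum>i\<in>{1..g}. (k i)\<^sup>2)
      + real (card (\<Union>i\<in>{1..g}. B i)) * (real (card (\<Union>i\<in>{1..g}. B i)) - 1)"
    using sums[of "\<lambda>x. x"] sums[of "\<lambda>x. x\<^sup>2"] by simp
  then show ?thesis using onb_card[OF B(5)] dim_range_dF[OF y] by simp
qed

text \<open>\<open>scalar_curvature\<close> sends the base point through the chart and back, which
  is the identity on the chart image only. Openness makes this harmless for the nested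
  derivatives.\<close>

lemma metric_scalar_curvature_cong:
  assumes "open S" "y \<in> S" "\<And>z. z \<in> S \<Longrightarrow> G z = G' z"
  shows "metric_scalar_curvature G y = metric_scalar_curvature G' y"
proof -
  have chr: "christoffel G z u v = christoffel G' z u v" if "z \<in> S" for z u v
  proof -
    have "dd (\<lambda>z. G z a b) z = dd (\<lambda>z. G' z a b) z" for a b
      by (rule dd_cong[OF assms(1) that]) (simp add: assms(3))
    then show ?thesis by (simp add: christoffel_def deriv_along_def assms(3)[OF that])
  qed
  have "riemann G y u v w = riemann G' y u v w" for u v w
  proof -
    have "dd (\<lambda>z. christoffel G z a b) y = dd (\<lambda>z. christoffel G' z a b) y" for a b
      by (rule dd_cong[OF assms(1,2)]) (simp add: chr)
    then show ?thesis by (simp add: riemann_def deriv_along_def chr[OF assms(2)])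
  qed
  then have "ricci G y = ricci G' y" by (intro ext) (simp add: ricci_def)
  then show ?thesis by (simp add: metric_scalar_curvature_def assms(3)[OF assms(2)])
qed

section \<open>Consequences of Cartan's identity\<close>

locale cartan_numbers =
  fixes k :: "nat \<Rightarrow> real" and g :: nat
  assumes inj: "inj_on k {1..g}" and g0: "g > 0"
    and cartan: "\<And>i. i \<in> {1..g} \<Longrightarrow> (\<Sum>j\<in>{1..g} - {i}. (1 + k i * k j) / (k i - k j)) = 0"
begin

abbreviation "c i \<mu> \<equiv> cos \<mu> - k i * sin \<mu>"
abbreviation "c' i \<mu> \<equiv> - sin \<mu> - k i * cos \<mu>"

definition "h \<mu> = (\<Prod>i\<in>{1..g}. c i \<mu>)"
definition "h1 \<mu> = (\<Sum>i\<in>{1..g}. c' i \<mu> * (\<Prod>j\<in>{1..g} - {i}. c j \<mu>))"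

text \<open>By c_i c_j + c_i' c_j' = 1 + k_i k_j and c_i c_j' - c_j c_i' = k_i - k_j, each summand
  is a weight times a difference of terms with one index each, minus h. Cartan's identity and the
  antisymmetry of the weights annul both weighted sums, and g (g - 1) copies of -h remain.\<close>

lemma pair_sum:
  "(\<Sum>i\<in>{1..g}. \<Sum>j\<in>{1..g} - {i}. c' i \<mu> * c' j \<mu> * (\<Prod>l\<in>{1..g} - {i} - {j}. c l \<mu>))
    = - real g * (real g - 1) * h \<mu>"
proof -
  define I where "I = {1..g}"
  have fin: "finite I" and card: "card I = g" by (simp_all add: I_def)
  define Q where "Q i j = (\<Prod>l\<in>I - {i} - {j}. c l \<mu>)" for i j
  define R where "R i = (\<Prod>l\<in>I - {i}. c l \<mu>)" for i
  define w where "w i j = (1 + k i * k j) / (k i - k j)" for i j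
  have cs: "cos \<mu> * cos \<mu> + sin \<mu> * sin \<mu> = 1" using sin_cos_squared_add2[of \<mu>] by (simp add: power2_eq_square)
  have RQ: "R i = c j \<mu> * Q i j" if "i \<in> I" "j \<in> I - {i}" for i j
    unfolding R_def Q_def using that fin by (subst prod.remove[of _ j]) auto
  have RQ': "R j = c i \<mu> * Q i j" if "i \<in> I" "j \<in> I - {i}" for i j
  proof -
    have "I - {i} - {j} = I - {j} - {i}" by auto
    then have "Q i j = Q j i" by (simp add: Q_def)
    then show ?thesis using RQ[of j i] that by auto
  qed
  have hR: "h \<mu> = c i \<mu> * R i" if "i \<in> I" for i
    unfolding R_def h_def I_def[symmetric] using that fin by (subst prod.remove[of _ i]) auto
  have ne: "k i \<noteq> k j" if "i \<in> I" "j \<in> I - {i}" for i j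
    using inj that by (auto simp: I_def dest: inj_onD)
  have term_eq: "c' i \<mu> * c' j \<mu> * Q i j = w i j * (c' j \<mu> * R j) - w i j * (c' i \<mu> * R i) - h \<mu>"
    if ij: "i \<in> I" "j \<in> I - {i}" for i j
  proof -
    have 1: "c i \<mu> * c j \<mu> + c' i \<mu> * c' j \<mu> = 1 + k i * k j" using cs by algebra
    have 2: "c i \<mu> * c' j \<mu> - c j \<mu> * c' i \<mu> = k i - k j" using cs by algebra
    have hQ: "h \<mu> = c i \<mu> * (c j \<mu> * Q i j)" using hR[OF ij(1)] RQ[OF ij] by simp
    have "c' j \<mu> * R j - c' i \<mu> * R i = (c i \<mu> * c' j \<mu> - c j \<mu> * c' i \<mu>) * Q i j"
      unfolding RQ[OF ij] RQ'[OF ij] by (simp add: algebra_simps)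
    also have "\<dots> = (k i - k j) * Q i j" unfolding 2 ..
    finally have "w i j * (c' j \<mu> * R j - c' i \<mu> * R i) = (1 + k i * k j) * Q i j"
      using ne[OF ij] by (simp add: w_def)
    also have "\<dots> = (c i \<mu> * c j \<mu> + c' i \<mu> * c' j \<mu>) * Q i j" unfolding 1 ..
    also have "\<dots> = h \<mu> + c' i \<mu> * c' j \<mu> * Q i j" unfolding hQ by (simp add: algebra_simps)
    finally show ?thesis by (simp add: right_diff_distrib)
  qed
  have wi: "(\<Sum>j\<in>I - {i}. w i j) = 0" if "i \<in> I" for i
    using cartan[of i] that by (simp add: w_def I_def)
  have wj: "(\<Sum>i\<in>I - {j}. w i j) = 0" if "j \<in> I" for j
  proof -
    have "(\<Sum>i\<in>I - {j}. w i j) = (\<Sum>i\<in>I - {j}. - w j i)"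
    proof (rule sum.cong[OF refl])
      fix i
      have "k i - k j = - (k j - k i)" by simp
      then show "w i j = - w j i" unfolding w_def by (metis minus_divide_right mult.commute)
    qed
    then show ?thesis using wi[OF that] by (simp add: sum_negf)
  qed
  have "(\<Sum>i\<in>I. \<Sum>j\<in>I - {i}. c' i \<mu> * c' j \<mu> * Q i j)
      = (\<Sum>i\<in>I. \<Sum>j\<in>I - {i}. w i j * (c' j \<mu> * R j) - w i j * (c' i \<mu> * R i) - h \<mu>)"
    using term_eq by (intro sum.cong refl) blast
  also have "\<dots> = (\<Sum>i\<in>I. \<Sum>j\<in>I - {i}. w i j * (c' j \<mu> * R j))
      - (\<Sum>i\<in>I. \<Sum>j\<in>I - {i}. w i j * (c' i \<mu> * R i)) - (\<Sum>i\<in>I. \<Sum>j\<in>I - {i}. h \<mu>)"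
    by (simp only: sum_subtractf)
  also have "(\<Sum>i\<in>I. \<Sum>j\<in>I - {i}. w i j * (c' i \<mu> * R i)) = 0"
    using wi by (simp add: sum_distrib_right[symmetric])
  also have "(\<Sum>i\<in>I. \<Sum>j\<in>I - {i}. w i j * (c' j \<mu> * R j))
      = (\<Sum>j\<in>I. \<Sum>i\<in>I - {j}. w i j * (c' j \<mu> * R j))"
  proof -
    have "(\<Sum>i\<in>I. \<Sum>j\<in>I - {i}. f i j) = (\<Sum>j\<in>I. \<Sum>i\<in>I - {j}. f i j)" for f :: "nat \<Rightarrow> nat \<Rightarrow> real"
    proof -
      have "(\<Sum>i\<in>I. \<Sum>j\<in>I - {i}. f i j) = (\<Sum>i\<in>I. \<Sum>j\<in>{j \<in> I. i \<noteq> j}. f i j)"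
        by (intro sum.cong refl) auto
      also have "\<dots> = (\<Sum>j\<in>I. \<Sum>i\<in>{i \<in> I. i \<noteq> j}. f i j)"
        by (rule sum.swap_restrict[OF fin fin])
      also have "\<dots> = (\<Sum>j\<in>I. \<Sum>i\<in>I - {j}. f i j)" by (intro sum.cong refl) auto
      finally show ?thesis .
    qed
    then show ?thesis .
  qed
  also have "\<dots> = 0" using wj by (simp add: sum_distrib_right[symmetric])
  also have "(\<Sum>i\<in>I. \<Sum>j\<in>I - {i}. h \<mu>) = real g * (real g - 1) * h \<mu>"
    using g0 fin card by (simp add: of_nat_diff)
  finally show ?thesis by (simp add: I_def Q_def)
qed

lemma DERIV_c: "(c i has_real_derivative c' i \<mu>) (at \<mu>)"
  by (auto intro!: derivative_eq_intros)

lemma DERIV_c': "(c' i has_real_derivative - c i \<mu>) (at \<mu>)"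
  by (auto intro!: derivative_eq_intros)

lemma DERIV_prod_c:
  shows "((\<lambda>\<mu>. \<Prod>j\<in>J. c j \<mu>) has_real_derivative (\<Sum>i\<in>J. c' i \<mu> * (\<Prod>j\<in>J - {i}. c j \<mu>))) (at \<mu>)"
  by (rule has_field_derivative_prod) (rule DERIV_c)

lemma DERIV_h: "(h has_real_derivative h1 \<mu>) (at \<mu>)"
  unfolding h_def[abs_def] h1_def by (rule DERIV_prod_c)

text \<open>Differentiating a factor twice gives g times -h, and the pairs of distinct factors give
  -g (g - 1) h.\<close>

lemma DERIV_h1: "(h1 has_real_derivative - (real g)\<^sup>2 * h \<mu>) (at \<mu>)"
proof -
  have "(h1 has_real_derivative (\<Sum>i\<in>{1..g}. c' i \<mu> * (\<Sum>j\<in>{1..g} - {i}. c' j \<mu> * (\<Prod>l\<in>{1..g} - {i} - {j}. c l \<mu>))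
      + (- c i \<mu>) * (\<Prod>j\<in>{1..g} - {i}. c j \<mu>))) (at \<mu>)"
    unfolding h1_def[abs_def]
    by (intro DERIV_sum DERIV_mult' DERIV_c' DERIV_prod_c)
  moreover have "(\<Sum>i\<in>{1..g}. c' i \<mu> * (\<Sum>j\<in>{1..g} - {i}. c' j \<mu> * (\<Prod>l\<in>{1..g} - {i} - {j}. c l \<mu>))
      + (- c i \<mu>) * (\<Prod>j\<in>{1..g} - {i}. c j \<mu>)) = - (real g)\<^sup>2 * h \<mu>"
  proof -
    have "(\<Sum>i\<in>{1..g}. (- c i \<mu>) * (\<Prod>j\<in>{1..g} - {i}. c j \<mu>)) = (\<Sum>i\<in>{1..g}. - h \<mu>)"
    proof (rule sum.cong[OF refl])
      fix i assume "i \<in> {1..g}"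
      then have "h \<mu> = c i \<mu> * (\<Prod>j\<in>{1..g} - {i}. c j \<mu>)"
        unfolding h_def by (subst prod.remove[of _ i]) auto
      then show "(- c i \<mu>) * (\<Prod>j\<in>{1..g} - {i}. c j \<mu>) = - h \<mu>" by (simp only: mult_minus_left)
    qed
    moreover have "(\<Sum>i\<in>{1..g}. c' i \<mu> * (\<Sum>j\<in>{1..g} - {i}. c' j \<mu> * (\<Prod>l\<in>{1..g} - {i} - {j}. c l \<mu>)))
        = - real g * (real g - 1) * h \<mu>"
      using pair_sum[of \<mu>] by (simp add: sum_distrib_left mult.assoc)
    ultimately show ?thesis
      unfolding sum.distrib by (simp add: algebra_simps power2_eq_square)
  qed
  ultimately show ?thesis by simp
qed

definition "a = (\<Sum>i\<in>{1..g}. k i) / real g"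

text \<open>Uniqueness for the harmonic oscillator by its energy: u1^2 + g^2 u^2 is constant and
  zero at 0.\<close>

lemma h_eq: "h \<mu> = cos (real g * \<mu>) - a * sin (real g * \<mu>)"
  and h1_eq: "h1 \<mu> = - real g * sin (real g * \<mu>) - a * real g * cos (real g * \<mu>)"
proof -
  define u where "u \<mu> = h \<mu> - (cos (real g * \<mu>) - a * sin (real g * \<mu>))" for \<mu>
  define u1 where "u1 \<mu> = h1 \<mu> - (- real g * sin (real g * \<mu>) - a * real g * cos (real g * \<mu>))" for \<mu>
  have du: "(u has_real_derivative u1 \<mu>) (at \<mu>)" for \<mu>
    unfolding u_def[abs_def] u1_def by (auto intro!: derivative_eq_intros DERIV_h)
  have du1: "(u1 has_real_derivative - (real g)\<^sup>2 * u \<mu>) (at \<mu>)" for \<mu>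
    unfolding u_def u1_def[abs_def]
    by (auto intro!: derivative_eq_intros DERIV_h1 simp: algebra_simps power2_eq_square)
  have "((\<lambda>\<mu>. (u1 \<mu>)\<^sup>2 + (real g)\<^sup>2 * (u \<mu>)\<^sup>2) has_real_derivative 0) (at \<mu>)" for \<mu>
    by (auto intro!: derivative_eq_intros du du1 simp: algebra_simps)
  then have const: "(u1 \<mu>)\<^sup>2 + (real g)\<^sup>2 * (u \<mu>)\<^sup>2 = (u1 0)\<^sup>2 + (real g)\<^sup>2 * (u 0)\<^sup>2" for \<mu>
    using DERIV_isconst_all[of "\<lambda>\<mu>. (u1 \<mu>)\<^sup>2 + (real g)\<^sup>2 * (u \<mu>)\<^sup>2" \<mu> 0] by blast
  have "u 0 = 0" by (simp add: u_def h_def)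
  moreover have "u1 0 = 0" using g0 by (simp add: u1_def h1_def a_def sum_negf)
  ultimately have "(u1 \<mu>)\<^sup>2 + (real g)\<^sup>2 * (u \<mu>)\<^sup>2 = 0" using const by simp
  moreover have "(real g)\<^sup>2 * (u \<mu>)\<^sup>2 \<ge> 0" "(u1 \<mu>)\<^sup>2 \<ge> 0" by simp_all
  ultimately have "(u1 \<mu>)\<^sup>2 = 0" "(real g)\<^sup>2 * (u \<mu>)\<^sup>2 = 0" by linarith+
  then have "u1 \<mu> = 0" "u \<mu> = 0" using g0 by simp_all
  then show "h \<mu> = cos (real g * \<mu>) - a * sin (real g * \<mu>)"
    "h1 \<mu> = - real g * sin (real g * \<mu>) - a * real g * cos (real g * \<mu>)"
    by (simp_all add: u_def u1_def)
qed

section \<open>Power sums of the principal curvatures of parallel hypersurfaces\<close>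

abbreviation "kpar \<mu> i \<equiv> (k i * cos \<mu> + sin \<mu>) / (cos \<mu> - k i * sin \<mu>)"

lemma h_nonzero_iff: "h \<mu> \<noteq> 0 \<longleftrightarrow> (\<forall>i\<in>{1..g}. c i \<mu> \<noteq> 0)"
  by (simp add: h_def)

text \<open>Each curvature is -c'/c, so their sum is minus the logarithmic derivative of the product
  h.\<close>

lemma sum_kpar:
  assumes "h \<mu> \<noteq> 0"
  shows "(\<Sum>i\<in>{1..g}. kpar \<mu> i) = - h1 \<mu> / h \<mu>"
proof -
  have "kpar \<mu> i = - (c' i \<mu> * (\<Prod>j\<in>{1..g} - {i}. c j \<mu>)) / h \<mu>" if i: "i \<in> {1..g}" for i
  proof -
    have *: "h \<mu> = c i \<mu> * (\<Prod>j\<in>{1..g} - {i}. c j \<mu>)"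
      unfolding h_def using i by (subst prod.remove[of _ i]) auto
    then have "c i \<mu> \<noteq> 0" "(\<Prod>j\<in>{1..g} - {i}. c j \<mu>) \<noteq> 0" using assms by auto
    moreover have "k i * cos \<mu> + sin \<mu> = - c' i \<mu>" by simp
    ultimately have "kpar \<mu> i = - c' i \<mu> / c i \<mu>" by (simp only:)
    also have "\<dots> = (- c' i \<mu> * (\<Prod>j\<in>{1..g} - {i}. c j \<mu>)) / h \<mu>"
      unfolding * using assms * by (intro nonzero_mult_divide_mult_cancel_right[symmetric]) auto
    finally show ?thesis by (simp only: mult_minus_left)
  qed
  then show ?thesis by (simp add: h1_def sum_divide_distrib[symmetric] sum_negf)
qed

text \<open>The square of the sum exceeds the sum of squares by the products over distinct pairs;
  multiplied by h these are the terms of \<open>pair_sum\<close>.\<close>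

lemma sum_kpar_sq:
  assumes "h \<mu> \<noteq> 0"
  shows "(\<Sum>i\<in>{1..g}. (kpar \<mu> i)\<^sup>2) = (\<Sum>i\<in>{1..g}. kpar \<mu> i)\<^sup>2 + real g * (real g - 1)"
proof -
  define K where "K = kpar \<mu>"
  have KQ: "K i * K j * h \<mu> = c' i \<mu> * c' j \<mu> * (\<Prod>l\<in>{1..g} - {i} - {j}. c l \<mu>)"
    if i: "i \<in> {1..g}" "j \<in> {1..g} - {i}" for i j
  proof -
    have "h \<mu> = c i \<mu> * (\<Prod>j\<in>{1..g} - {i}. c j \<mu>)"
      unfolding h_def using i by (subst prod.remove[of _ i]) auto
    also have "(\<Prod>j\<in>{1..g} - {i}. c j \<mu>) = c j \<mu> * (\<Prod>l\<in>{1..g} - {i} - {j}. c l \<mu>)"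
      using i by (subst prod.remove[of _ j]) auto
    finally have *: "h \<mu> = c i \<mu> * (c j \<mu> * (\<Prod>l\<in>{1..g} - {i} - {j}. c l \<mu>))" .
    have "c i \<mu> \<noteq> 0" "c j \<mu> \<noteq> 0" using assms i h_nonzero_iff by auto
    then have "K i * c i \<mu> = - c' i \<mu>" "K j * c j \<mu> = - c' j \<mu>" by (simp_all add: K_def)
    then show ?thesis unfolding * by algebra
  qed
  have "(\<Sum>i\<in>{1..g}. K i)\<^sup>2 = (\<Sum>i\<in>{1..g}. \<Sum>j\<in>{1..g}. K i * K j)"
    by (simp add: power2_eq_square sum_product)
  also have "\<dots> = (\<Sum>i\<in>{1..g}. (K i)\<^sup>2 + (\<Sum>j\<in>{1..g} - {i}. K i * K j))"
    by (intro sum.cong refl) (subst sum.remove, auto simp: power2_eq_square)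
  finally have "(\<Sum>i\<in>{1..g}. K i)\<^sup>2 * h \<mu> = (\<Sum>i\<in>{1..g}. (K i)\<^sup>2) * h \<mu>
      + (\<Sum>i\<in>{1..g}. \<Sum>j\<in>{1..g} - {i}. K i * K j * h \<mu>)"
    by (simp add: sum.distrib distrib_right sum_distrib_right)
  also have "(\<Sum>i\<in>{1..g}. \<Sum>j\<in>{1..g} - {i}. K i * K j * h \<mu>)
      = (\<Sum>i\<in>{1..g}. \<Sum>j\<in>{1..g} - {i}. c' i \<mu> * c' j \<mu> * (\<Prod>l\<in>{1..g} - {i} - {j}. c l \<mu>))"
    using KQ by (intro sum.cong refl) blast
  also have "\<dots> = - real g * (real g - 1) * h \<mu>" by (rule pair_sum)
  finally have "((\<Sum>i\<in>{1..g}. K i)\<^sup>2 + real g * (real g - 1) - (\<Sum>i\<in>{1..g}. (K i)\<^sup>2)) * h \<mu> = 0"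
    by (simp add: algebra_simps)
  then show ?thesis using assms by (simp add: K_def)
qed

end

section \<open>The flow equation\<close>

text \<open>The image of an interval is connected, so \<theta> cannot leave the range between the
  excluded values 0 and pi/2. There ln (sin \<theta>) - t / m is defined and has derivative
  zero.\<close>

lemma angle_ode_solution:
  fixes \<theta> :: "real \<Rightarrow> real" and m \<phi>0 :: real
  assumes m0: "m \<noteq> 0" and J: "is_interval J" "0 \<in> J" and \<phi>0: "\<theta> 0 = \<phi>0" "0 < \<phi>0" "\<phi>0 < pi / 2"
    and ne: "\<And>t. t \<in> J \<Longrightarrow> sin (\<theta> t) \<noteq> 0 \<and> cos (\<theta> t) \<noteq> 0"
    and ode: "\<And>t. t \<in> J \<Longrightarrow> (\<theta> has_real_derivative tan (\<theta> t) / m) (at t)"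
    and t: "t \<in> J"
  shows "0 < \<theta> t \<and> \<theta> t < pi / 2 \<and> sin (\<theta> t) = sin \<phi>0 * exp (t / m)"
proof -
  have cont: "continuous_on J \<theta>"
    by (rule continuous_at_imp_continuous_on) (use ode DERIV_isCont in blast)
  have conn: "connected (\<theta> ` J)"
    by (rule connected_continuous_image[OF cont]) (use J(1) is_interval_connected in blast)
  have bounds: "0 < \<theta> s \<and> \<theta> s < pi / 2" if s: "s \<in> J" for s
  proof (rule ccontr)
    assume "\<not> (0 < \<theta> s \<and> \<theta> s < pi / 2)"
    then consider "\<theta> s \<le> 0" | "pi / 2 \<le> \<theta> s" by linarith
    then show False
    proof cases
      case 1
      then have "0 \<in> \<theta> ` J"
        using connectedD_interval[OF conn, of "\<theta> s" "\<theta> 0" 0] s J(2) \<phi>0 by auto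
      then show False using ne by (metis imageE sin_zero)
    next
      case 2
      then have "pi / 2 \<in> \<theta> ` J"
        using connectedD_interval[OF conn, of "\<theta> 0" "\<theta> s" "pi / 2"] s J(2) \<phi>0 by auto
      then show False using ne by (metis imageE cos_pi_half)
    qed
  qed
  have "((\<lambda>s. ln (sin (\<theta> s)) - s / m) has_derivative (\<lambda>h. 0)) (at s within J)" if s: "s \<in> J" for s
  proof -
    have "sin (\<theta> s) > 0" using bounds[OF s] by (intro sin_gt_zero) auto
    then have "((\<lambda>s. ln (sin (\<theta> s)) - s / m) has_real_derivative
        (cos (\<theta> s) * (tan (\<theta> s) / m)) / sin (\<theta> s) - 1 / m) (at s)"
      using m0 by (auto intro!: derivative_eq_intros ode[OF s])
    moreover have "(cos (\<theta> s) * (tan (\<theta> s) / m)) / sin (\<theta> s) - 1 / m = 0"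
      using ne[OF s] m0 by (simp add: tan_def)
    ultimately have "((\<lambda>s. ln (sin (\<theta> s)) - s / m) has_real_derivative 0) (at s)" by simp
    then have "((\<lambda>s. ln (sin (\<theta> s)) - s / m) has_derivative (\<lambda>h. 0)) (at s)"
      unfolding has_field_derivative_def by (rule has_derivative_eq_rhs) auto
    then show ?thesis by (rule has_derivative_at_withinI)
  qed
  then obtain C where C: "\<And>s. s \<in> J \<Longrightarrow> ln (sin (\<theta> s)) - s / m = C"
    using has_derivative_zero_constant[of J "\<lambda>s. ln (sin (\<theta> s)) - s / m"] J(1) is_interval_convex by blast
  have pos: "sin (\<theta> s) > 0" if "s \<in> J" for s using bounds[OF that] by (intro sin_gt_zero) auto
  have "ln (sin (\<theta> t)) = ln (sin \<phi>0) + t / m"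
    using C[OF t] C[OF J(2)] \<phi>0(1) by simp
  also have "\<dots> = ln (sin \<phi>0 * exp (t / m))"
    using pos[OF J(2)] \<phi>0(1) by (simp add: ln_mult)
  finally have "sin (\<theta> t) = sin \<phi>0 * exp (t / m)"
    using pos[OF t] pos[OF J(2)] \<phi>0(1) by simp
  then show ?thesis using bounds[OF t] by simp
qed

section \<open>The explicit solution in terms of the angle\<close>

locale flow_angle =
  fixes a :: real and m g :: nat
  assumes a_pos: "a > 0" and m_pos: "m > 0" and g_pos: "g > 0"
begin

text \<open>R and \<phi>0 are the polar coordinates of the point (a, 1). The time \<open>ts\<close>
  is where exp (t / m) reaches R, so the argument of arcsin in \<theta> is below 1 exactly before
  \<open>ts\<close>.\<close>

definition "R = sqrt (a\<^sup>2 + 1)"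
definition "\<phi>0 = arcsin (1 / R)"
definition "ts = real m / 2 * ln (a\<^sup>2 + 1)"
definition "\<theta> t = arcsin (exp (t / real m) / R)"
definition "\<mu> t = (\<phi>0 - \<theta> t) / real g"

lemma R_pos: "R > 1" and R2: "R * R = a\<^sup>2 + 1"
proof -
  show "R > 1" unfolding R_def using a_pos by (intro real_less_rsqrt) simp
  show "R * R = a\<^sup>2 + 1" unfolding R_def by (simp add: add_nonneg_nonneg)
qed

lemma ts_pos: "ts > 0"
proof -
  have "ln (a\<^sup>2 + 1) > 0" using a_pos by (intro ln_gt_zero) simp
  then show ?thesis using m_pos by (simp add: ts_def)
qed

lemma exp_ts: "exp (ts / real m) = R"
proof -
  have "exp (ts / real m) = exp (ln (sqrt (a\<^sup>2 + 1)))"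
    using m_pos by (simp add: ts_def ln_sqrt add_pos_nonneg add_nonneg_pos)
  then show ?thesis by (simp add: R_def add_nonneg_pos)
qed

lemma exp_less_R_iff: "exp (t / real m) < R \<longleftrightarrow> t < ts"
  unfolding exp_ts[symmetric] using m_pos by (simp add: divide_less_cancel)

lemma sin_\<phi>0: "sin \<phi>0 = 1 / R" and cos_\<phi>0: "cos \<phi>0 = a / R" and \<phi>0: "0 < \<phi>0" "\<phi>0 < pi / 2"
proof -
  have b: "0 < 1 / R" "1 / R < 1" using R_pos by auto
  show "sin \<phi>0 = 1 / R" unfolding \<phi>0_def using b by (intro sin_arcsin) linarith+
  have "1 - (1 / R)\<^sup>2 = (a / R)\<^sup>2"
  proof -
    have "R * R \<noteq> 0" using R_pos by simp
    then have "1 - (1 / R)\<^sup>2 = (R * R - 1) / (R * R)"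
      by (simp add: power2_eq_square diff_divide_distrib)
    also have "R * R - 1 = a * a" using R2 by (simp add: power2_eq_square)
    finally show ?thesis by (simp add: power2_eq_square)
  qed
  moreover have "cos \<phi>0 = sqrt (1 - (1 / R)\<^sup>2)"
    unfolding \<phi>0_def by (rule cos_arcsin) (use b in linarith)+
  ultimately have "cos \<phi>0 = sqrt ((a / R)\<^sup>2)" by simp
  also have "\<dots> = a / R" using R_pos a_pos by simp
  finally show "cos \<phi>0 = a / R" .
  have "arcsin 0 < arcsin (1 / R)" by (intro arcsin_less_arcsin) (use b in linarith)+
  then show "0 < \<phi>0" by (simp add: \<phi>0_def)
  have "arcsin (1 / R) < arcsin 1" by (intro arcsin_less_arcsin) (use b in linarith)+
  then show "\<phi>0 < pi / 2" by (simp add: \<phi>0_def)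
qed

lemma \<theta>0: "\<theta> 0 = \<phi>0" by (simp add: \<theta>_def \<phi>0_def)

lemma \<mu>0: "\<mu> 0 = 0" by (simp add: \<mu>_def \<theta>0)

lemma g_\<mu>: "\<phi>0 - real g * \<mu> t = \<theta> t" "real g * \<mu> t = \<phi>0 - \<theta> t"
  using g_pos by (simp_all add: \<mu>_def)

lemma \<theta>_facts:
  assumes "t < ts"
  shows "sin (\<theta> t) = exp (t / real m) / R" "cos (\<theta> t) = sqrt (a\<^sup>2 + 1 - exp (2 * t / real m)) / R"
    "0 < \<theta> t" "\<theta> t < pi / 2"
proof -
  define x where "x = exp (t / real m) / R"
  have x: "0 < x" "x < 1" using R_pos exp_less_R_iff[of t] assms by (simp_all add: x_def)
  show "sin (\<theta> t) = exp (t / real m) / R" using x by (simp add: \<theta>_def x_def[symmetric])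
  have "1 - x\<^sup>2 = (a\<^sup>2 + 1 - exp (2 * t / real m)) / R\<^sup>2"
  proof -
    have "(exp (t / real m))\<^sup>2 = exp (2 * t / real m)"
      by (simp add: power2_eq_square exp_add[symmetric])
    moreover have "R\<^sup>2 = a\<^sup>2 + 1" using R2 by (simp add: power2_eq_square)
    moreover have "R\<^sup>2 \<noteq> 0" using R_pos by simp
    ultimately show ?thesis by (simp add: x_def power_divide diff_divide_distrib)
  qed
  then show "cos (\<theta> t) = sqrt (a\<^sup>2 + 1 - exp (2 * t / real m)) / R"
    using x R_pos by (simp add: \<theta>_def x_def[symmetric] cos_arcsin real_sqrt_divide)
  have "arcsin 0 < arcsin x" by (intro arcsin_less_arcsin) (use x in linarith)+
  then show "0 < \<theta> t" by (simp add: \<theta>_def x_def)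
  have "arcsin x < arcsin 1" by (intro arcsin_less_arcsin) (use x in linarith)+
  then show "\<theta> t < pi / 2" by (simp add: \<theta>_def x_def)
qed

lemma cos_sin_g_\<mu>:
  assumes "t < ts"
  shows "cos (real g * \<mu> t) = (exp (t / real m) + a * sqrt (a\<^sup>2 + 1 - exp (2 * t / real m))) / (a\<^sup>2 + 1)"
    "sin (real g * \<mu> t) = (- a * exp (t / real m) + sqrt (a\<^sup>2 + 1 - exp (2 * t / real m))) / (a\<^sup>2 + 1)"
  unfolding g_\<mu>(2) cos_diff sin_diff sin_\<phi>0 cos_\<phi>0 \<theta>_facts[OF assms] R2[symmetric]
  by (simp_all add: add_divide_distrib diff_divide_distrib)

lemma DERIV_\<theta>:
  assumes "t < ts"
  shows "(\<theta> has_real_derivative tan (\<theta> t) / real m) (at t)"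
proof -
  define x where "x = exp (t / real m) / R"
  have x: "0 < x" "x < 1" using R_pos exp_less_R_iff[of t] assms by (simp_all add: x_def)
  have e: "((\<lambda>t. exp (t / real m) / R) has_real_derivative exp (t / real m) / R / real m) (at t)"
    using m_pos R_pos by (auto intro!: derivative_eq_intros)
  have "(\<theta> has_real_derivative inverse (sqrt (1 - (exp (t / real m) / R)\<^sup>2)) * (exp (t / real m) / R / real m)) (at t)"
    unfolding \<theta>_def[abs_def]
    by (rule DERIV_chain2[OF DERIV_arcsin e]) (use x in \<open>unfold x_def, linarith+\<close>)
  then have "(\<theta> has_real_derivative inverse (sqrt (1 - x\<^sup>2)) * (x / real m)) (at t)"
    by (simp only: x_def)
  moreover have "tan (\<theta> t) = x / sqrt (1 - x\<^sup>2)"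
    using x by (simp add: tan_def \<theta>_def x_def[symmetric] cos_arcsin)
  ultimately show ?thesis by (simp add: divide_inverse mult_ac)
qed

lemma DERIV_\<mu>:
  assumes "t < ts"
  shows "(\<mu> has_real_derivative - tan (\<theta> t) / (real g * real m)) (at t)"
  unfolding \<mu>_def[abs_def] using g_pos
  by (auto intro!: derivative_eq_intros DERIV_\<theta>[OF assms])

text \<open>Two bootstraps: tan solves y' = 1 + y^2 with polynomial right side, and \<theta> solves
  y' = tan y / m.\<close>

lemma smooth_\<mu>: "smooth_on {..<ts} \<mu>"
proof -
  let ?T = "{- (pi / 2)<..<pi / 2}"
  have sq: "smooth_on UNIV (\<lambda>x::real. 1 + x * x)"
    by (intro smooth_on_add smooth_on_const smooth_on_bilinear[OF bounded_bilinear_mult] smooth_on_id open_UNIV)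
  have "smooth_on ?T (tan :: real \<Rightarrow> real)"
  proof (rule smooth_on_ode[OF _ open_UNIV _ sq])
    fix t :: real assume "t \<in> ?T"
    then have "cos t \<noteq> 0" using cos_gt_zero_pi[of t] by auto
    then have "inverse ((cos t)\<^sup>2) = 1 + tan t * tan t"
      using tan_sec[of t] by (simp add: power2_eq_square)
    then show "(tan has_real_derivative 1 + tan t * tan t) (at t)"
      using DERIV_tan[OF \<open>cos t \<noteq> 0\<close>] by simp
  qed auto
  then have "smooth_on ?T (\<lambda>x. (1 / real m) *\<^sub>R tan x)" by (intro smooth_on_cmul) auto
  then have "smooth_on {..<ts} \<theta>"
  proof (rule smooth_on_ode[rotated 3])
    show "\<theta> ` {..<ts} \<subseteq> ?T" using \<theta>_facts(3,4) pi_gt_zero by force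
    show "(\<theta> has_real_derivative (1 / real m) *\<^sub>R tan (\<theta> t)) (at t)" if "t \<in> {..<ts}" for t
      using DERIV_\<theta>[of t] that by simp
  qed auto
  then have "smooth_on {..<ts} (\<lambda>t. (1 / real g) *\<^sub>R (\<phi>0 - \<theta> t))"
    by (intro smooth_on_cmul smooth_on_diff smooth_on_const) auto
  then show ?thesis by (simp add: \<mu>_def[abs_def] divide_inverse mult.commute)
qed

lemma \<mu>_at_bot: "(\<mu> \<longlongrightarrow> \<phi>0 / real g) at_bot"
proof -
  have "filterlim (\<lambda>t. t / real m) at_bot at_bot"
    using m_pos filterlim_tendsto_pos_mult_at_bot[of "\<lambda>_. 1 / real m" "1 / real m" at_bot "\<lambda>t. t"]
    by (simp add: filterlim_ident)
  then have "((\<lambda>t. exp (t / real m)) \<longlongrightarrow> 0) at_bot"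
    by (rule filterlim_compose[OF exp_at_bot])
  then have "((\<lambda>t. exp (t / real m) / R) \<longlongrightarrow> 0 / R) at_bot" by (intro tendsto_intros) (use R_pos in auto)
  then have "(\<theta> \<longlongrightarrow> arcsin 0) at_bot"
    unfolding \<theta>_def[abs_def] by (intro isCont_tendsto_compose[OF isCont_arcsin]) auto
  then have "((\<lambda>t. (\<phi>0 - \<theta> t) / real g) \<longlongrightarrow> (\<phi>0 - arcsin 0) / real g) at_bot"
    by (intro tendsto_intros) (use g_pos in auto)
  then show ?thesis by (simp add: \<mu>_def[abs_def])
qed

text \<open>The differential equation is singular at \<theta> = pi/2, but the arcsin formula for
  \<theta> remains continuous up to \<open>ts\<close>.\<close>

lemma \<mu>_at_ts: "(\<mu> \<longlongrightarrow> (\<phi>0 - pi / 2) / real g) (at_left ts)"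
proof -
  have "exp (t / real m) / R \<le> 1" if "t \<le> ts" for t
    using that R_pos m_pos exp_ts by (simp add: divide_le_eq) (metis divide_right_mono exp_le_cancel_iff of_nat_0_le_iff)
  moreover have "0 \<le> exp (t / real m) / R" for t using R_pos by simp
  ultimately have "continuous_on {..ts} \<theta>"
    unfolding \<theta>_def[abs_def] using R_pos m_pos
    by (intro continuous_on_arcsin continuous_intros) (auto intro: order_trans[of _ 0])
  then have "(\<theta> \<longlongrightarrow> \<theta> ts) (at ts within {..ts})" by (simp add: continuous_on_def)
  then have "(\<theta> \<longlongrightarrow> \<theta> ts) (at_left ts)"
    by (rule tendsto_within_subset) auto
  then have "((\<lambda>t. (\<phi>0 - \<theta> t) / real g) \<longlongrightarrow> (\<phi>0 - \<theta> ts) / real g) (at_left ts)"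
    by (intro tendsto_intros) (use g_pos in auto)
  moreover have "\<theta> ts = pi / 2" using R_pos by (simp add: \<theta>_def exp_ts)
  ultimately show ?thesis by (simp add: \<mu>_def[abs_def])
qed

text \<open>The angle stays below pi/2, so its sine stays below 1, and this is what bounds the
  interval by \<open>ts\<close>; arcsin then recovers the angle from its sine.\<close>

lemma unique_\<mu>:
  assumes J: "is_interval J" "0 \<in> J" and \<nu>0: "\<nu> 0 = 0"
    and ne: "\<And>t. t \<in> J \<Longrightarrow> sin (\<phi>0 - real g * \<nu> t) \<noteq> 0 \<and> cos (\<phi>0 - real g * \<nu> t) \<noteq> 0"
    and ode: "\<And>t. t \<in> J \<Longrightarrow> (\<nu> has_real_derivative - tan (\<phi>0 - real g * \<nu> t) / (real g * real m)) (at t)"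
    and t: "t \<in> J"
  shows "t < ts \<and> \<nu> t = \<mu> t"
proof -
  have ode': "((\<lambda>t. \<phi>0 - real g * \<nu> t) has_real_derivative tan (\<phi>0 - real g * \<nu> t) / real m) (at t)"
    if "t \<in> J" for t
    using g_pos by (auto intro!: derivative_eq_intros ode[OF that])
  have sol: "0 < \<phi>0 - real g * \<nu> t" "\<phi>0 - real g * \<nu> t < pi / 2"
    "sin (\<phi>0 - real g * \<nu> t) = sin \<phi>0 * exp (t / real m)"
    using angle_ode_solution[OF _ J _ \<phi>0 ne ode' t] \<nu>0 m_pos by auto
  have "sin (\<phi>0 - real g * \<nu> t) < sin (pi / 2)"
    using sol(1,2) by (intro sin_monotone_2pi) auto
  then have "exp (t / real m) < R" using sol(3) sin_\<phi>0 R_pos by (simp add: divide_less_eq)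
  then have tts: "t < ts" using exp_less_R_iff by simp
  have "\<phi>0 - real g * \<nu> t = arcsin (sin (\<phi>0 - real g * \<nu> t))"
    using sol(1,2) by (simp add: arcsin_sin)
  also have "\<dots> = \<theta> t" using sol(3) sin_\<phi>0 by (simp add: \<theta>_def)
  finally have "real g * \<nu> t = \<phi>0 - \<theta> t" by simp
  then show ?thesis using tts g_pos by (simp add: \<mu>_def field_simps)
qed

end

section \<open>Minimal hypersurfaces with two principal curvatures\<close>

context hsurf
begin

lemma frame_span: "y \<in> \<Omega> \<Longrightarrow> \<exists>\<alpha> \<beta> v. w = \<alpha> *\<^sub>R F y + \<beta> *\<^sub>R N y + dd F y v"
  using frame_map_inv[of y w] unfolding frame_map_def by metis

text \<open>
  The reflection exchanging \<open>F\<close> and \<open>N\<close>: its constancy means that \<open>F + N\<close> and \<open>F - N\<close> move in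
  fixed orthogonal subspaces.
\<close>

definition swap_map :: "'e \<Rightarrow> 'b \<Rightarrow> 'b" where
  "swap_map y w = fst (frame_inv y w) *\<^sub>R N y + fst (snd (frame_inv y w)) *\<^sub>R F y
     + dd N y (snd (snd (frame_inv y w)))"

lemma swap_map_frame:
  assumes "y \<in> \<Omega>"
  shows "swap_map y (\<alpha> *\<^sub>R F y + \<beta> *\<^sub>R N y + dd F y v) = \<alpha> *\<^sub>R N y + \<beta> *\<^sub>R F y + dd N y v"
  using frame_inv_map[OF assms, of "(\<alpha>, \<beta>, v)"] by (simp add: swap_map_def frame_map_def)

lemma linear_swap_map: "y \<in> \<Omega> \<Longrightarrow> linear (swap_map y)"
  by (intro linearI)
    (simp_all add: swap_map_def linear_add[OF linear_frame_inv] linear_cmul[OF linear_frame_inv]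
      linear_add[OF linN] linear_cmul[OF linN] algebra_simps)

lemma smooth_swap_map: "smooth_on \<Omega> (\<lambda>y. swap_map y w)"
proof -
  have K: "smooth_on \<Omega> (\<lambda>y. frame_inv y w)"
    by (rule smooth_frame_inv[OF smooth_on_const[OF open_dom]])
  note K1 = smooth_on_bounded_linear[OF bounded_linear_fst open_dom K]
    and K2 = smooth_on_bounded_linear[OF bounded_linear_snd open_dom K]
  note K21 = smooth_on_bounded_linear[OF bounded_linear_fst open_dom K2]
    and K22 = smooth_on_bounded_linear[OF bounded_linear_snd open_dom K2]
  show ?thesis unfolding swap_map_def
    by (rule smooth_on_add[OF open_dom smooth_on_add[OF open_dom
          smooth_on_scaleR[OF open_dom K1 smN] smooth_on_scaleR[OF open_dom K21 smF]]
          smooth_linear_app[OF open_dom linN smooth_on_dd[OF smN] K22]])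
qed

lemma swap_map_sym:
  assumes "y \<in> \<Omega>"
  shows "swap_map y w \<bullet> x = w \<bullet> swap_map y x"
proof -
  obtain \<alpha> \<beta> v \<alpha>' \<beta>' v' where
    w: "w = \<alpha> *\<^sub>R F y + \<beta> *\<^sub>R N y + dd F y v" and x: "x = \<alpha>' *\<^sub>R F y + \<beta>' *\<^sub>R N y + dd F y v'"
    using frame_span[OF assms] by metis
  show ?thesis
    unfolding w x swap_map_frame[OF assms]
    using dN_dF_sym[OF assms, of v v']
    by (simp add: inner_add_left inner_add_right FF[OF assms] NN[OF assms] NF[OF assms]
        inner_commute[of "F y" "N y"] FdF[OF assms] NdF[OF assms] FdN[OF assms] NdN[OF assms]
        inner_commute[of "dd F y _" "F y"] inner_commute[of "dd F y _" "N y"]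
        inner_commute[of "dd N y _" "F y"] inner_commute[of "dd N y _" "N y"]
        inner_commute[of "dd F y v" "dd N y v'"])
qed

text \<open>The values on F and N over an open set determine, by differentiation, those on dF, and
  the three together span. This permits gluing of locally constant reflections.\<close>

lemma swap_map_unique:
  assumes "open U" "U \<subseteq> \<Omega>" "U \<noteq> {}" "linear B" "linear B'"
    and "\<And>y. y \<in> U \<Longrightarrow> B (F y) = N y \<and> B (N y) = F y"
    and "\<And>y. y \<in> U \<Longrightarrow> B' (F y) = N y \<and> B' (N y) = F y"
  shows "B = B'"
proof
  fix w
  obtain y where y: "y \<in> U" "y \<in> \<Omega>" using assms(2,3) by auto
  have dB: "L (dd F y v) = dd N y v"
    if "linear L" and L: "\<And>y. y \<in> U \<Longrightarrow> L (F y) = N y \<and> L (N y) = F y" for L v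
  proof -
    have "dd (\<lambda>z. L (F z)) y v = L (dd F y v)"
      using that(1) dd_bounded_linear[OF _ smooth_on_differentiable[OF smF y(2)]] linear_conv_bounded_linear
      by blast
    moreover have "dd (\<lambda>z. L (F z)) y = dd N y"
      by (rule dd_cong[OF assms(1) y(1)]) (use L in blast)
    ultimately show ?thesis by simp
  qed
  obtain \<alpha> \<beta> v where w: "w = \<alpha> *\<^sub>R F y + \<beta> *\<^sub>R N y + dd F y v" using frame_span[OF y(2)] by metis
  have "B (dd F y v) = B' (dd F y v)"
    using dB[OF assms(4,6), of v] dB[OF assms(5,7), of v] by simp
  then show "B w = B' w"
    unfolding w linear_add[OF assms(4)] linear_add[OF assms(5)] linear_cmul[OF assms(4)] linear_cmul[OF assms(5)]
      using assms(6,7)[OF y(1)] by simp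
qed

end

section \<open>Principal curvatures 1 and -1: constancy of the reflection\<close>

locale clifford_local = hsurf +
  assumes span_pm: "y \<in> \<Omega> \<Longrightarrow> span (PD 1 y \<union> PD (-1) y) = UNIV"
begin

lemma zero_on_pm:
  assumes "y \<in> \<Omega>" "linear L" "\<And>v. v \<in> PD 1 y \<Longrightarrow> L v = 0" "\<And>v. v \<in> PD (-1) y \<Longrightarrow> L v = 0"
  shows "L v = 0"
  by (rule linear_eq_0_on_span[OF assms(2), of "PD 1 y \<union> PD (-1) y"])
    (use span_pm[OF assms(1)] assms(3,4) in auto)

text \<open>The two focal maps up to the factor sqrt 2: dp vanishes on the directions of curvature
  1, dq on those of curvature -1.\<close>

definition "p y = F y + N y"
definition "q y = F y - N y"

lemma smp: "smooth_on \<Omega> p" and smq: "smooth_on \<Omega> q"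
  unfolding p_def[abs_def] q_def[abs_def]
  by (intro smooth_on_add smooth_on_diff open_dom smF smN)+

lemma dp: "y \<in> \<Omega> \<Longrightarrow> dd p y v = dd F y v + dd N y v"
  and dq: "y \<in> \<Omega> \<Longrightarrow> dd q y v = dd F y v - dd N y v"
  unfolding p_def[abs_def] q_def[abs_def]
  by (simp_all add: dd_add dd_diff smooth_on_differentiable[OF smF] smooth_on_differentiable[OF smN])

lemma dp_PD: "y \<in> \<Omega> \<Longrightarrow> v \<in> PD 1 y \<Longrightarrow> dd p y v = 0"
  and dq_PD: "y \<in> \<Omega> \<Longrightarrow> v \<in> PD (-1) y \<Longrightarrow> dd q y v = 0"
  by (simp_all add: dp dq PD_def)

lemma linp: "y \<in> \<Omega> \<Longrightarrow> linear (dd p y)" using smooth_on_linear_dd[OF smp] .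
lemma linq: "y \<in> \<Omega> \<Longrightarrow> linear (dd q y)" using smooth_on_linear_dd[OF smq] .

text \<open>Each factor sees only the eigenspace that the other one kills, and the two eigenspaces
  are orthogonal.\<close>

lemma dp_dq:
  assumes y: "y \<in> \<Omega>"
  shows "dd p y w \<bullet> dd q y z = 0"
proof (rule zero_on_pm[OF y, of "\<lambda>w. dd p y w \<bullet> dd q y z"])
  show "linear (\<lambda>w. dd p y w \<bullet> dd q y z)"
    by (intro linearI) (simp_all add: linear_add[OF linp[OF y]] linear_cmul[OF linp[OF y]] inner_add_left)
  show "dd p y w \<bullet> dd q y z = 0" if "w \<in> PD 1 y" for w using dp_PD[OF y that] by simp
  show "dd p y w \<bullet> dd q y z = 0" if w: "w \<in> PD (-1) y" for w
  proof (rule zero_on_pm[OF y, of "\<lambda>z. dd p y w \<bullet> dd q y z"])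
    show "linear (\<lambda>z. dd p y w \<bullet> dd q y z)"
      by (intro linearI) (simp_all add: linear_add[OF linq[OF y]] linear_cmul[OF linq[OF y]] inner_add_right)
    show "dd p y w \<bullet> dd q y z = 0" if z: "z \<in> PD 1 y" for z
      using PD_orthogonal[OF y w z] w z by (simp add: dp dq y PD_def inner_add_left inner_add_right)
    show "dd p y w \<bullet> dd q y z = 0" if "z \<in> PD (-1) y" for z using dq_PD[OF y that] by simp
  qed
qed

abbreviation "P2 y v w \<equiv> dd (\<lambda>z. dd p z w) y v"
abbreviation "Q2 y v w \<equiv> dd (\<lambda>z. dd q z w) y v"

lemma PQ_diff: "y \<in> \<Omega> \<Longrightarrow> P2 y v w \<bullet> dd q y z + dd p y w \<bullet> Q2 y v z = 0"
  by (rule dd_inner_const[OF open_dom _ smooth_on_dd[OF smp] smooth_on_dd[OF smq] dp_dq])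

text \<open>Differentiating dp . dq = 0 moves a derivative from one factor to the other. Together
  with the symmetry of second derivatives this puts v into the slot where dp, respectively dq,
  annihilates it at y, so no eigenvector has to be extended to a field.\<close>

lemma P2_dq:
  assumes y: "y \<in> \<Omega>"
  shows "P2 y v w \<bullet> dd q y z = 0"
proof (rule zero_on_pm[OF y, of "\<lambda>v. P2 y v w \<bullet> dd q y z"])
  have lin: "linear (dd (\<lambda>z. dd p z w) y)" by (rule smooth_on_linear_dd[OF smooth_on_dd[OF smp] y])
  show "linear (\<lambda>v. P2 y v w \<bullet> dd q y z)"
    by (intro linearI) (simp_all add: linear_add[OF lin] linear_cmul[OF lin] inner_add_left)
  show "P2 y v w \<bullet> dd q y z = 0" if "v \<in> PD 1 y" for v
    using PQ_diff[OF y, of v w z] dd_symmetric[OF open_dom smp y, of v w] PQ_diff[OF y, of w v z]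
      PQ_diff[OF y, where v = w and w = v and z = z] dp_PD[OF y that] by simp
  show "P2 y v w \<bullet> dd q y z = 0" if "v \<in> PD (-1) y" for v
    using PQ_diff[OF y, where v = v and w = w and z = z] dd_symmetric[OF open_dom smq y, of v z]
      PQ_diff[OF y, where v = z and w = w and z = v] dq_PD[OF y that] by simp
qed

lemma Q2_dp: "y \<in> \<Omega> \<Longrightarrow> Q2 y v z \<bullet> dd p y w = 0"
  using PQ_diff[where v = v and w = w and z = z] P2_dq by (simp add: inner_commute)

lemma dp_q: "y \<in> \<Omega> \<Longrightarrow> dd p y w \<bullet> q y = 0" and dq_p: "y \<in> \<Omega> \<Longrightarrow> dd q y w \<bullet> p y = 0"
  by (simp_all add: dp dq p_def q_def inner_add_left inner_add_right inner_diff_left inner_diff_right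
      inner_commute[of "dd F y _" "F y"] inner_commute[of "dd F y _" "N y"]
      inner_commute[of "dd N y _" "F y"] inner_commute[of "dd N y _" "N y"] FdF NdF FdN NdN)

lemma P2_q: "y \<in> \<Omega> \<Longrightarrow> P2 y v w \<bullet> q y = 0"
  using dd_inner_const[OF open_dom _ smooth_on_dd[OF smp] smq dp_q, of y w v] dp_dq by simp

lemma Q2_p: "y \<in> \<Omega> \<Longrightarrow> Q2 y v w \<bullet> p y = 0"
  using dd_inner_const[OF open_dom _ smooth_on_dd[OF smq] smp dq_p, of y w v] dp_dq
  by (simp add: inner_commute)

text \<open>Curvatures 1 and -1 make the shape operator an involution.\<close>

lemma swap_dN:
  assumes y: "y \<in> \<Omega>"
  shows "swap_map y (dd N y v) = dd F y v"
proof -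
  have dF: "swap_map y (dd F y v) = dd N y v" for v
    using swap_map_frame[OF y, of 0 0 v] by simp
  have "swap_map y (dd N y v) - dd F y v = 0"
  proof (rule zero_on_pm[OF y, of "\<lambda>v. swap_map y (dd N y v) - dd F y v"])
    show "linear (\<lambda>v. swap_map y (dd N y v) - dd F y v)"
      by (intro linearI) (simp_all add: linear_add[OF linF[OF y]] linear_cmul[OF linF[OF y]]
          linear_add[OF linN[OF y]] linear_cmul[OF linN[OF y]] linear_add[OF linear_swap_map[OF y]]
          linear_cmul[OF linear_swap_map[OF y]] algebra_simps)
    show "swap_map y (dd N y v) - dd F y v = 0" if "v \<in> PD 1 y" for v
      using that dF[of v] by (simp add: PD_def linear_neg[OF linear_swap_map[OF y]])
    show "swap_map y (dd N y v) - dd F y v = 0" if "v \<in> PD (-1) y" for v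
      using that dF[of v] by (simp add: PD_def)
  qed
  then show ?thesis by simp
qed

lemma swap_pq:
  assumes y: "y \<in> \<Omega>"
  shows "swap_map y (p y) = p y" "swap_map y (q y) = - q y"
    "swap_map y (dd p y v) = dd p y v" "swap_map y (dd q y v) = - dd q y v"
proof -
  have s: "swap_map y (F y) = N y" "swap_map y (N y) = F y" "swap_map y (dd F y v) = dd N y v"
    using swap_map_frame[OF y, of 1 0 0] swap_map_frame[OF y, of 0 1 0] swap_map_frame[OF y, of 0 0 v]
      linear_0[OF linF[OF y]] linear_0[OF linN[OF y]] by simp_all
  show "swap_map y (p y) = p y" "swap_map y (q y) = - q y"
    "swap_map y (dd p y v) = dd p y v" "swap_map y (dd q y v) = - dd q y v"
    unfolding dp[OF y] dq[OF y] p_def q_def linear_add[OF linear_swap_map[OF y]]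
      linear_diff[OF linear_swap_map[OF y]] s swap_dN[OF y] by simp_all
qed

lemma eq_0_if_orthogonal_pq:
  assumes y: "y \<in> \<Omega>" and "x \<bullet> p y = 0" "x \<bullet> q y = 0" "\<And>u. x \<bullet> dd p y u = 0" "\<And>u. x \<bullet> dd q y u = 0"
  shows "x = 0"
proof (rule eq_0_if_orthogonal[OF y])
  show "x \<bullet> F y = 0" "x \<bullet> N y = 0"
    using assms(2,3) by (simp_all add: p_def q_def inner_add_right inner_diff_right)
  show "x \<bullet> dd F y v = 0" for v
    using assms(4,5)[of v] by (simp add: dp[OF y] dq[OF y] inner_add_right inner_diff_right)
qed

text \<open>p and dp are fixed by the symmetric map \<open>swap_map\<close>, q and dq are reversed.
  As P2 is orthogonal to the reversed vectors, its image has the same inner products with all four,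
  and these vectors span.\<close>

lemma swap_P2: assumes y: "y \<in> \<Omega>" shows "swap_map y (P2 y v w) = P2 y v w"
proof -
  have "swap_map y (P2 y v w) - P2 y v w = 0"
    by (rule eq_0_if_orthogonal_pq[OF y])
      (simp_all add: inner_diff_left swap_map_sym[OF y] swap_pq[OF y] P2_dq[OF y] P2_q[OF y])
  then show ?thesis by simp
qed

lemma swap_Q2: assumes y: "y \<in> \<Omega>" shows "swap_map y (Q2 y v w) = - Q2 y v w"
proof -
  have "swap_map y (Q2 y v w) + Q2 y v w = 0"
    by (rule eq_0_if_orthogonal_pq[OF y])
      (simp_all add: inner_add_left swap_map_sym[OF y] swap_pq[OF y] Q2_dp[OF y] Q2_p[OF y])
  then show ?thesis by (simp add: eq_neg_iff_add_eq_0)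
qed

lemma swap_hess:
  assumes y: "y \<in> \<Omega>"
  shows "swap_map y (hess y v w) = dd (\<lambda>z. dd N z w) y v"
proof -
  have dF: "smooth_on \<Omega> (\<lambda>z. dd F z w)" and dN: "smooth_on \<Omega> (\<lambda>z. dd N z w)"
    using smooth_on_dd smF smN by blast+
  have "P2 y v w = dd (\<lambda>z. dd F z w + dd N z w) y v"
    using fun_cong[OF dd_cong[OF open_dom y dp]] .
  then have P2: "P2 y v w = hess y v w + dd (\<lambda>z. dd N z w) y v"
    using dd_add[OF smooth_on_differentiable[OF dF y] smooth_on_differentiable[OF dN y]] by simp
  have "Q2 y v w = dd (\<lambda>z. dd F z w - dd N z w) y v"
    using fun_cong[OF dd_cong[OF open_dom y dq]] .
  then have Q2: "Q2 y v w = hess y v w - dd (\<lambda>z. dd N z w) y v"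
    using dd_diff[OF smooth_on_differentiable[OF dF y] smooth_on_differentiable[OF dN y]] by simp
  have "2 *\<^sub>R swap_map y (hess y v w) = swap_map y (P2 y v w + Q2 y v w)"
    unfolding P2 Q2 by (simp add: linear_cmul[OF linear_swap_map[OF y], symmetric] scaleR_2)
  also have "\<dots> = P2 y v w - Q2 y v w"
    by (simp add: linear_add[OF linear_swap_map[OF y]] swap_P2[OF y] swap_Q2[OF y])
  also have "\<dots> = 2 *\<^sub>R dd (\<lambda>z. dd N z w) y v" unfolding P2 Q2 by (simp add: scaleR_2)
  finally show ?thesis by simp
qed

text \<open>Differentiates the rule \<open>swap_map_frame\<close> for a frame combination with
  frozen coefficients. By \<open>swap_dN\<close> and \<open>swap_hess\<close> the motion of the
  frame accounts for the whole derivative, leaving none for the map.\<close>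

lemma dd_swap_map:
  assumes y: "y \<in> \<Omega>"
  shows "dd (\<lambda>z. swap_map z w) y v = 0"
proof -
  obtain \<alpha> \<beta> u where w: "w = \<alpha> *\<^sub>R F y + \<beta> *\<^sub>R N y + dd F y u" using frame_span[OF y] by metis
  define X where "X z = \<alpha> *\<^sub>R F z + \<beta> *\<^sub>R N z + dd F z u" for z
  define Y where "Y z = \<alpha> *\<^sub>R N z + \<beta> *\<^sub>R F z + dd N z u" for z
  have smX: "smooth_on \<Omega> X"
    unfolding X_def[abs_def] by (intro smooth_on_add smooth_on_cmul smooth_on_dd open_dom smF smN)
  have dX: "dd X y v = \<alpha> *\<^sub>R dd F y v + \<beta> *\<^sub>R dd N y v + hess y v u"
    and dY: "dd Y y v = \<alpha> *\<^sub>R dd N y v + \<beta> *\<^sub>R dd F y v + dd (\<lambda>z. dd N z u) y v"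
    unfolding X_def[abs_def] Y_def[abs_def]
    by (subst dd_add; (subst dd_lincomb)?;
        intro smooth_on_differentiable[OF _ y] smooth_on_add smooth_on_cmul smooth_on_dd open_dom smF smN refl)+
  have "dd (\<lambda>z. swap_map z (X z)) y v = dd Y y v"
    by (rule fun_cong[OF dd_cong[OF open_dom y]]) (simp add: X_def Y_def swap_map_frame)
  moreover have "dd (\<lambda>z. swap_map z (X z)) y v = dd (\<lambda>z. swap_map z w) y v + swap_map y (dd X y v)"
    using dd_linear_app[OF open_dom y linear_swap_map smooth_swap_map smX] w by (simp add: X_def)
  moreover have "swap_map y (dd X y v) = dd Y y v"
    using swap_map_frame[OF y, of 0 0 v]
    by (simp add: dX dY linear_add[OF linear_swap_map[OF y]] linear_cmul[OF linear_swap_map[OF y]]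
        swap_dN[OF y] swap_hess[OF y])
  ultimately show ?thesis by simp
qed

lemma swap_map_constant:
  assumes "y0 \<in> \<Omega>"
  obtains U B where "open U" "y0 \<in> U" "U \<subseteq> \<Omega>" "linear B" "\<And>w x. B w \<bullet> x = w \<bullet> B x"
    "\<And>y. y \<in> U \<Longrightarrow> B (F y) = N y \<and> B (N y) = F y"
proof -
  obtain e where e: "e > 0" "ball y0 e \<subseteq> \<Omega>" using assms open_dom open_contains_ball by blast
  have const: "swap_map y0 w = swap_map y w" if "y \<in> ball y0 e" for y w
    by (rule convex_dd_zero_eq[OF convex_ball[of y0 e] smooth_on_subset[OF smooth_swap_map e(2)]])
      (use that e dd_swap_map in auto)
  have "swap_map y0 (F y) = N y \<and> swap_map y0 (N y) = F y" if y: "y \<in> ball y0 e" for y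
  proof -
    have "y \<in> \<Omega>" using y e by auto
    then show ?thesis
      using const[OF y] swap_map_frame[of y 1 0 0] swap_map_frame[of y 0 1 0]
        linear_0[OF linF] linear_0[OF linN] by simp
  qed
  then show thesis
    using that[of "ball y0 e" "swap_map y0"] e linear_swap_map[OF assms] swap_map_sym[OF assms] by auto
qed

end

section \<open>Hypersurfaces in charts\<close>

lemma chart_facts:
  assumes "is_chart X c"
  shows "openin X (fst c)" "open (snd c ` fst c)" "inj_on (snd c) (fst c)"
    "\<And>x. x \<in> fst c \<Longrightarrow> inv_into (fst c) (snd c) (snd c x) = x"
    "\<And>V. open V \<Longrightarrow> openin X {x \<in> fst c. snd c x \<in> V}"
proof -
  show o: "openin X (fst c)" and "open (snd c ` fst c)" using assms by (simp_all add: is_chart_def)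
  have hom: "homeomorphic_map (subtopology X (fst c)) (top_of_set (snd c ` fst c)) (snd c)"
    using assms by (simp add: is_chart_def)
  have top: "topspace (subtopology X (fst c)) = fst c"
    using openin_subset[OF o] by (auto simp: topspace_subtopology)
  show inj: "inj_on (snd c) (fst c)" using homeomorphic_imp_injective_map[OF hom] top by simp
  show "inv_into (fst c) (snd c) (snd c x) = x" if "x \<in> fst c" for x using inv_into_f_f[OF inj that] .
  show "openin X {x \<in> fst c. snd c x \<in> V}" if "open V" for V
  proof -
    have "openin (top_of_set (snd c ` fst c)) (snd c ` fst c \<inter> V)"
      using that by (simp add: openin_open_Int)
    then have "openin (subtopology X (fst c))
        {x \<in> topspace (subtopology X (fst c)). snd c x \<in> snd c ` fst c \<inter> V}"
      using homeomorphic_imp_continuous_map[OF hom] openin_continuous_map_preimage by blast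
    moreover have "{x \<in> topspace (subtopology X (fst c)). snd c x \<in> snd c ` fst c \<inter> V}
        = {x \<in> fst c. snd c x \<in> V}"
      unfolding top by auto
    ultimately show ?thesis using openin_trans_full[OF _ o] by simp
  qed
qed

lemma in_chart_at: "is_chart X c \<Longrightarrow> x \<in> fst c \<Longrightarrow> in_chart c F (snd c x) = F x"
  by (simp add: in_chart_def chart_facts(4))

lemma in_chart_lincomb:
  "in_chart c (\<lambda>x. a *\<^sub>R F x + b *\<^sub>R N x) = (\<lambda>y. a *\<^sub>R in_chart c F y + b *\<^sub>R in_chart c N y)"
  by (simp add: in_chart_def fun_eq_iff)

lemma in_chart_image: "is_chart X c \<Longrightarrow> U \<subseteq> snd c ` fst c \<Longrightarrow>
    F ` {x \<in> fst c. snd c x \<in> U} = in_chart c F ` U"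
proof -
  assume c: "is_chart X c" and U: "U \<subseteq> snd c ` fst c"
  have "U = snd c ` {x \<in> fst c. snd c x \<in> U}" using U by auto
  then have "in_chart c F ` U = (\<lambda>x. in_chart c F (snd c x)) ` {x \<in> fst c. snd c x \<in> U}"
    by (metis image_image)
  also have "\<dots> = F ` {x \<in> fst c. snd c x \<in> U}"
    by (rule image_cong[OF refl]) (simp add: in_chart_at[OF c])
  finally show ?thesis ..
qed

lemma hsurf_chart:
  fixes F N :: "'m \<Rightarrow> 'b::euclidean_space" and A :: "('m, 'e::euclidean_space) chart set"
  assumes "oriented_hypersurface A F N" "c \<in> A" "is_chart X c"
  shows "hsurf (snd c ` fst c) (in_chart c F) (in_chart c N)"
proof
  show "open (snd c ` fst c)" by (rule chart_facts(2)[OF assms(3)])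
  show "DIM('b) = DIM('e) + 2" "smooth_on (snd c ` fst c) (in_chart c F)"
    "smooth_on (snd c ` fst c) (in_chart c N)"
    using assms(1,2) by (simp_all add: oriented_hypersurface_def smooth_map_def)
  fix y assume "y \<in> snd c ` fst c"
  then obtain x where x: "x \<in> fst c" "y = snd c x" by auto
  have "norm (F x) = 1 \<and> inj (differential c F x) \<and>
        norm (N x) = 1 \<and> N x \<bullet> F x = 0 \<and> (\<forall>v. N x \<bullet> differential c F x v = 0)"
    using assms(1,2) x(1) by (simp add: oriented_hypersurface_def)
  then show "in_chart c F y \<bullet> in_chart c F y = 1" "in_chart c N y \<bullet> in_chart c N y = 1"
    "in_chart c N y \<bullet> in_chart c F y = 0" "inj (dd (in_chart c F) y)"
    "\<And>v. in_chart c N y \<bullet> dd (in_chart c F) y v = 0"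
    unfolding x(2) in_chart_at[OF assms(3) x(1)] differential_def by (simp_all add: norm_eq_1)
qed

lemma oriented_hypersurfaceI:
  fixes F N :: "'m \<Rightarrow> 'b::euclidean_space" and A :: "('m, 'e::euclidean_space) chart set"
  assumes "DIM('b) = DIM('e) + 2"
    and "\<And>c. c \<in> A \<Longrightarrow> is_chart X c \<and> hsurf (snd c ` fst c) (in_chart c F) (in_chart c N)"
  shows "oriented_hypersurface A F N"
  unfolding oriented_hypersurface_def smooth_map_def
proof (intro conjI ballI allI)
  fix c assume c: "c \<in> A"
  then interpret hsurf "snd c ` fst c" "in_chart c F" "in_chart c N" using assms(2) by blast
  show "smooth_on (snd c ` fst c) (in_chart c F)" "smooth_on (snd c ` fst c) (in_chart c N)"
    by (fact smF smN)+
  fix x assume x: "x \<in> fst c"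
  then have y: "snd c x \<in> snd c ` fst c" by simp
  have at: "in_chart c G (snd c x) = G x" for G :: "'m \<Rightarrow> 'b"
    by (rule in_chart_at[of X]) (use assms(2)[OF c] x in blast)+
  show "norm (F x) = 1" "norm (N x) = 1" "N x \<bullet> F x = 0" "inj (differential c F x)"
    "N x \<bullet> differential c F x v = 0" for v
    using FF[OF y] NN[OF y] NF[OF y] NdF[OF y] injF[OF y]
    unfolding at differential_def by (simp_all add: norm_eq_1)
qed (fact assms(1))

lemma hsurf_cong:
  assumes "hsurf \<Omega> F N" "\<And>y. y \<in> \<Omega> \<Longrightarrow> F y = F' y"
  shows "hsurf \<Omega> F' N"
proof -
  interpret hsurf \<Omega> F N by fact
  have d: "dd F' y = dd F y" if "y \<in> \<Omega>" for y
    by (rule dd_cong[OF open_dom that]) (simp add: assms(2))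
  show ?thesis
  proof
    show "smooth_on \<Omega> F'" using smooth_on_cong[OF open_dom, of F F'] assms(2) smF by blast
  qed (use open_dom dim_eq smN FF NN NF NdF injF d assms(2) in auto)
qed

text \<open>Two unit normals differ by the factor M . N, which is continuous with values 1 and -1,
  hence locally constant; so the derivatives differ by the same sign.\<close>

lemma (in hsurf) other_normal:
  assumes M: "hsurf \<Omega> F M" and y: "y \<in> \<Omega>"
  shows "\<exists>s\<in>{1, -1}. M y = s *\<^sub>R N y \<and> dd M y = (\<lambda>v. s *\<^sub>R dd N y v)"
proof -
  interpret M: hsurf \<Omega> F M by fact
  define s where "s z = M z \<bullet> N z" for z
  have Ms: "M z = s z *\<^sub>R N z" if z: "z \<in> \<Omega>" for z
  proof -
    have "M z - s z *\<^sub>R N z = 0"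
      by (rule eq_0_if_orthogonal[OF z])
        (simp_all add: inner_diff_left M.NF NF NN M.NdF NdF s_def z)
    then show ?thesis by simp
  qed
  have s1: "s z = 1 \<or> s z = -1" if z: "z \<in> \<Omega>" for z
  proof -
    have "s z * s z = 1" using M.NN[OF z] NN[OF z] by (simp add: Ms[OF z])
    then show ?thesis by (simp add: square_eq_1_iff)
  qed
  have "continuous_on \<Omega> s" unfolding s_def[abs_def]
    using smooth_on_continuous M.smN smN by (intro continuous_on_inner)
  then have op: "open (s -` {s y - 1<..<s y + 1} \<inter> \<Omega>)"
    using continuous_on_open_vimage[OF open_dom] open_greaterThanLessThan by blast
  have ys: "y \<in> s -` {s y - 1<..<s y + 1} \<inter> \<Omega>" using y by simp
  have Mz: "M z = s y *\<^sub>R N z" if "z \<in> s -` {s y - 1<..<s y + 1} \<inter> \<Omega>" for z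
    using that Ms[of z] s1[of z] s1[OF y] by auto
  have "dd M y = dd (\<lambda>z. s y *\<^sub>R N z) y" by (rule dd_cong[OF op ys Mz])
  then have "dd M y v = s y *\<^sub>R dd N y v" for v
    using dd_cmul[OF smooth_on_differentiable[OF smN y]] by simp
  then show ?thesis using Ms[OF y] s1[OF y] by (intro bexI[of _ "s y"]) auto
qed

lemma mean_curvature_cong:
  assumes "differential c F x = differential c F' x" "differential c N x = differential c N' x"
  shows "mean_curvature c F N x = mean_curvature c F' N' x"
  by (simp add: mean_curvature_def principal_curvatures_def curvature_mult_def curvature_space_def
      first_form_def second_form_def assms)

lemma mean_curvature_flip:
  assumes "differential c M x = (\<lambda>v. - differential c N x v)"
  shows "mean_curvature c F M x = - mean_curvature c F N x"
proof -
  have cs: "curvature_space c F M x \<kappa> = curvature_space c F N x (- \<kappa>)" for \<kappa>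
    by (simp add: curvature_space_def second_form_def first_form_def assms minus_equation_iff eq_commute)
  have "principal_curvatures c F M x = uminus ` principal_curvatures c F N x"
    by (force simp: principal_curvatures_def cs image_iff)
  then show ?thesis
    by (simp add: mean_curvature_def sum.reindex curvature_mult_def cs sum_negf)
qed

locale isosurf_chart =
  fixes X :: "'m topology" and c :: "('m, 'e::euclidean_space) chart"
    and F N :: "'m \<Rightarrow> 'b::euclidean_space" and k :: "nat \<Rightarrow> real" and g m :: nat
  assumes chart: "is_chart X c" and iso: "isosurf (snd c ` fst c) (in_chart c F) (in_chart c N) k g m"
begin

sublocale L: isosurf "snd c ` fst c" "in_chart c F" "in_chart c N" k g m by (rule iso)

lemma curvature_space_eq:
  assumes "x \<in> fst c"
  shows "curvature_space c F N x \<kappa> = L.PD \<kappa> (snd c x)"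
  using L.PD_eq_form[of "snd c x" \<kappa>] assms
  by (simp add: curvature_space_def second_form_def first_form_def differential_def)

lemma principal_curvatures_eq: "x \<in> fst c \<Longrightarrow> principal_curvatures c F N x = k ` {1..g}"
  using L.principal_set[of "snd c x"] by (simp add: principal_curvatures_def curvature_space_eq)

lemma curvature_mult_eq: "x \<in> fst c \<Longrightarrow> i \<in> {1..g} \<Longrightarrow> curvature_mult c F N x (k i) = m"
  using L.dim_PD[of "snd c x" i] by (simp add: curvature_mult_def curvature_space_eq)

lemma sum_principal_curvatures:
  assumes "x \<in> fst c"
  shows "(\<Sum>\<kappa>\<in>principal_curvatures c F N x. real (curvature_mult c F N x \<kappa>) * \<phi> \<kappa>)
    = real m * (\<Sum>i\<in>{1..g}. \<phi> (k i))"
  unfolding principal_curvatures_eq[OF assms] sum.reindex[OF L.inj_k] sum_distrib_left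
  by (rule sum.cong) (simp_all only: o_def curvature_mult_eq[OF assms])

lemma mean_curvature_eq: "x \<in> fst c \<Longrightarrow> mean_curvature c F N x = real m * (\<Sum>i\<in>{1..g}. k i)"
  unfolding mean_curvature_def by (rule sum_principal_curvatures)

lemma sq_norm_eq: "x \<in> fst c \<Longrightarrow> sq_norm_second_form c F N x = real m * (\<Sum>i\<in>{1..g}. (k i)\<^sup>2)"
  unfolding sq_norm_second_form_def by (rule sum_principal_curvatures)

lemma scalar_curvature_chart:
  assumes "x \<in> fst c"
  shows "scalar_curvature c F x = (real m * (\<Sum>i\<in>{1..g}. k i))\<^sup>2 - real m * (\<Sum>i\<in>{1..g}. (k i)\<^sup>2)
    + real DIM('e) * (real DIM('e) - 1)"
proof -
  have y: "snd c x \<in> snd c ` fst c" using assms by simp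
  have "scalar_curvature c F x
      = metric_scalar_curvature (\<lambda>z u v. dd (in_chart c F) z u \<bullet> dd (in_chart c F) z v) (snd c x)"
    unfolding scalar_curvature_def
  proof (rule metric_scalar_curvature_cong[OF L.open_dom y])
    fix z assume "z \<in> snd c ` fst c"
    then show "first_form c F (inv_into (fst c) (snd c) z)
        = (\<lambda>u v. dd (in_chart c F) z u \<bullet> dd (in_chart c F) z v)"
      by (simp add: first_form_def differential_def f_inv_into_f fun_eq_iff)
  qed
  then show ?thesis using L.scalar_curvature_eq[OF y] by simp
qed

end

section \<open>Locally constant data on a connected space\<close>

text \<open>A clopen argument: since any nonempty open set determines b, overlapping neighbourhoods
  share it. Serves for the ambient reflection and for the point to which the focal image collapses
  when g = 1.\<close>

lemma locally_constant_choice: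
  assumes conn: "connected_space X" and ne: "topspace X \<noteq> {}"
    and loc: "\<And>x. x \<in> topspace X \<Longrightarrow> \<exists>U b. openin X U \<and> x \<in> U \<and> (\<forall>z\<in>U. Q z b)"
    and uniq: "\<And>U b b'. openin X U \<Longrightarrow> U \<noteq> {} \<Longrightarrow> (\<And>z. z \<in> U \<Longrightarrow> Q z b) \<Longrightarrow>
      (\<And>z. z \<in> U \<Longrightarrow> Q z b') \<Longrightarrow> b = b'"
  obtains b where "\<And>x. x \<in> topspace X \<Longrightarrow> Q x b"
proof -
  obtain x0 where "x0 \<in> topspace X" using ne by blast
  then obtain U0 b0 where U0: "openin X U0" "x0 \<in> U0" "\<forall>z\<in>U0. Q z b0" using loc by meson
  define S where "S = {x. \<exists>U. openin X U \<and> x \<in> U \<and> (\<forall>z\<in>U. Q z b0)}"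
  have SX: "S \<subseteq> topspace X" using openin_subset by (fastforce simp: S_def)
  have "openin X S" by (subst openin_subopen) (auto simp: S_def)
  moreover have "openin X (topspace X - S)"
  proof (subst openin_subopen, intro ballI)
    fix x assume x: "x \<in> topspace X - S"
    then obtain U b where U: "openin X U" "x \<in> U" "\<forall>z\<in>U. Q z b" using loc by (metis DiffD1)
    have "U \<inter> S = {}"
    proof (rule ccontr)
      assume "U \<inter> S \<noteq> {}"
      then obtain z V where V: "z \<in> U" "openin X V" "z \<in> V" "\<forall>z\<in>V. Q z b0" by (auto simp: S_def)
      have "b = b0"
        by (rule uniq[of "U \<inter> V"]) (use U V in auto)
      then have "x \<in> S" using U by (auto simp: S_def)
      then show False using x by blast
    qed
    then show "\<exists>T. openin X T \<and> x \<in> T \<and> T \<subseteq> topspace X - S"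
      using U openin_subset[OF U(1)] by blast
  qed
  then have "closedin X S" using SX by (simp add: closedin_def)
  ultimately have "S = {} \<or> S = topspace X" using conn connected_space_clopen_in by blast
  moreover have "x0 \<in> S" using U0 by (auto simp: S_def)
  ultimately have "S = topspace X" by blast
  then show thesis using that[of b0] by (auto simp: S_def)
qed

section \<open>Clifford hypersurfaces\<close>

lemma linear_eigenspace_subspace:
  fixes B :: "'b::euclidean_space \<Rightarrow> 'b"
  assumes "linear B"
  shows "subspace {w. B w = c *\<^sub>R w}"
  by (auto simp: subspace_def linear_0[OF assms] linear_add[OF assms] linear_cmul[OF assms] scaleR_add_right)

text \<open>The local reflections glue to one symmetric map B. Its eigenspaces carry F + N and F -
  N, whose halves have norm 1 / sqrt 2 and add up to F; openness of the image follows from an open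
  mapping argument.\<close>

lemma clifford_global:
  fixes X :: "'m topology" and A :: "('m, 'e::euclidean_space) chart set"
    and F N :: "'m \<Rightarrow> 'b::euclidean_space"
  assumes conn: "connected_space X" and ne: "topspace X \<noteq> {}"
    and charts: "\<And>c. c \<in> A \<Longrightarrow> is_chart X c" and cover: "(\<Union>c\<in>A. fst c) = topspace X"
    and dimb: "DIM('b) = 2 * m + 2"
    and loc: "\<And>c. c \<in> A \<Longrightarrow> clifford_local (snd c ` fst c) (in_chart c F) (in_chart c N)"
    and dims: "\<And>c y. c \<in> A \<Longrightarrow> y \<in> snd c ` fst c \<Longrightarrow>
      dim (hsurf.PD (in_chart c F) (in_chart c N) 1 y) = m \<and>
      dim (hsurf.PD (in_chart c F) (in_chart c N) (-1) y) = m"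
  shows "clifford_hypersurface m (F ` topspace X)"
proof -
  \<comment> \<open>Conditions at a single point, as \<open>locally_constant_choice\<close> demands.
    Symmetry is carried along for the orthogonality of the eigenspaces.\<close>
  define Q where "Q x B \<longleftrightarrow> linear B \<and> (\<forall>w x. B w \<bullet> x = w \<bullet> B x) \<and> B (F x) = N x \<and> B (N x) = F x"
    for x and B :: "'b \<Rightarrow> 'b"
  have "\<exists>U B. openin X U \<and> x \<in> U \<and> (\<forall>z\<in>U. Q z B)" if x: "x \<in> topspace X" for x
  proof -
    obtain c where c: "c \<in> A" "x \<in> fst c" using x cover by blast
    interpret clifford_local "snd c ` fst c" "in_chart c F" "in_chart c N" by (rule loc[OF c(1)])
    obtain U B where UB: "open U" "snd c x \<in> U" "U \<subseteq> snd c ` fst c" "linear B" "\<And>w x. B w \<bullet> x = w \<bullet> B x"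
      "\<And>y. y \<in> U \<Longrightarrow> B (in_chart c F y) = in_chart c N y \<and> B (in_chart c N y) = in_chart c F y"
      using swap_map_constant[of "snd c x"] c(2) by auto
    have "Q z B" if "z \<in> fst c" "snd c z \<in> U" for z
      using UB(4,5) UB(6)[OF that(2)] by (simp add: Q_def in_chart_at[OF charts[OF c(1)] that(1)])
    then show ?thesis
      using chart_facts(5)[OF charts[OF c(1)] UB(1)] c(2) UB(2)
      by (intro exI[of _ "{z \<in> fst c. snd c z \<in> U}"] exI[of _ B]) auto
  qed
  moreover have "B = B'"
    if U: "openin X U" "U \<noteq> {}" and B: "\<And>z. z \<in> U \<Longrightarrow> Q z B" and B': "\<And>z. z \<in> U \<Longrightarrow> Q z B'" for U B B'
  proof -
    obtain x where x: "x \<in> U" using U by blast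
    then obtain c where c: "c \<in> A" "x \<in> fst c" using openin_subset[OF U(1)] cover by blast
    interpret clifford_local "snd c ` fst c" "in_chart c F" "in_chart c N" by (rule loc[OF c(1)])
    have hom: "homeomorphic_map (subtopology X (fst c)) (top_of_set (snd c ` fst c)) (snd c)"
      using charts[OF c(1)] by (simp add: is_chart_def)
    have "openin (subtopology X (fst c)) (U \<inter> fst c)" using U(1) by (auto simp: openin_subtopology)
    then have "openin (top_of_set (snd c ` fst c)) (snd c ` (U \<inter> fst c))"
      using homeomorphic_imp_open_map[OF hom] by (simp add: open_map_def)
    then have "open (snd c ` (U \<inter> fst c))" using open_dom openin_open_eq by blast
    then show ?thesis
    proof (rule swap_map_unique)
      show "linear B" "linear B'" using B[OF x] B'[OF x] by (simp_all add: Q_def)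
      fix y assume "y \<in> snd c ` (U \<inter> fst c)"
      then obtain z where z: "z \<in> U" "z \<in> fst c" "y = snd c z" by auto
      show "B (in_chart c F y) = in_chart c N y \<and> B (in_chart c N y) = in_chart c F y"
        "B' (in_chart c F y) = in_chart c N y \<and> B' (in_chart c N y) = in_chart c F y"
        using B[OF z(1)] B'[OF z(1)] by (simp_all add: Q_def z(3) in_chart_at[OF charts[OF c(1)] z(2)])
    qed (use x c in auto)
  qed
  ultimately obtain B where Q: "\<And>x. x \<in> topspace X \<Longrightarrow> Q x B"
    using locally_constant_choice[OF conn ne, of Q] by metis
  obtain x1 where x1: "x1 \<in> topspace X" using ne by blast
  have B: "linear B" "\<And>w x. B w \<bullet> x = w \<bullet> B x" using Q[OF x1] by (simp_all add: Q_def)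
  have BF: "B (F x) = N x" "B (N x) = F x" if "x \<in> topspace X" for x using Q[OF that] by (simp_all add: Q_def)
  define V where "V = {w. B w = 1 *\<^sub>R w}"
  define W where "W = {w. B w = (-1) *\<^sub>R w}"
  have V: "subspace V" and W: "subspace W"
    unfolding V_def W_def by (rule linear_eigenspace_subspace[OF B(1)])+
  have orth: "v \<bullet> w = 0" if "v \<in> V" "w \<in> W" for v w
    using B(2)[of v w] that by (simp add: V_def W_def)
  have pV: "F x + N x \<in> V" and qW: "F x - N x \<in> W" if "x \<in> topspace X" for x
    using BF[OF that] by (simp_all add: V_def W_def linear_add[OF B(1)] linear_diff[OF B(1)])
  obtain c1 where c1: "c1 \<in> A" "x1 \<in> fst c1" using x1 cover by blast
  have dimV: "dim V \<ge> m + 1" and dimW: "dim W \<ge> m + 1"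
  proof -
    interpret clifford_local "snd c1 ` fst c1" "in_chart c1 F" "in_chart c1 N" by (rule loc[OF c1(1)])
    define y where "y = snd c1 x1"
    have y: "y \<in> snd c1 ` fst c1" using c1 by (simp add: y_def)
    have at: "in_chart c1 F y = F x1" "in_chart c1 N y = N x1"
      unfolding y_def by (rule in_chart_at[OF charts[OF c1(1)] c1(2)])+
    have BdF: "B (dd (in_chart c1 F) y v) = dd (in_chart c1 N) y v" for v
    proof -
      have "dd (\<lambda>z. B (in_chart c1 F z)) y v = B (dd (in_chart c1 F) y v)"
        using dd_bounded_linear[OF _ smooth_on_differentiable[OF smF y]] B(1) linear_conv_bounded_linear by blast
      moreover have "dd (\<lambda>z. B (in_chart c1 F z)) y = dd (in_chart c1 N) y"
      proof (rule dd_cong[OF open_dom y])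
        fix z assume "z \<in> snd c1 ` fst c1"
        then obtain x where x: "x \<in> fst c1" "z = snd c1 x" by auto
        then have "x \<in> topspace X" using cover c1(1) by blast
        then show "B (in_chart c1 F z) = in_chart c1 N z"
          using BF(1) by (simp add: x(2) in_chart_at[OF charts[OF c1(1)] x(1)])
      qed
      ultimately show ?thesis by simp
    qed
    have dimPD: "dim (dd (in_chart c1 F) y ` PD s y) = m" if "s = 1 \<or> s = -1" for s
      using dim_image_eq[OF linF[OF y], of "PD s y"] injF[OF y] dims[OF c1(1) y] that
      by (metis inj_on_subset top_greatest)
    \<comment> \<open>One dimension comes from F + N or F - N, and m more from an eigenspace of the
      shape operator orthogonal to it. Since B dF = dN, curvature -1 contributes to V and curvature
      1 to W. The ambient dimension 2 m + 2 then leaves equality.\<close>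
    have lower: "dim S \<ge> m + 1"
      if S: "subspace S" "w \<in> S" "w \<noteq> 0" "dd (in_chart c1 F) y ` PD s y \<subseteq> S" "s = 1 \<or> s = -1"
        and w: "w = F x1 + N x1 \<or> w = F x1 - N x1" for S w s
    proof -
      have "dim ({w} \<union> dd (in_chart c1 F) y ` PD s y) = dim {w} + dim (dd (in_chart c1 F) y ` PD s y)"
      proof (rule dim_orthogonal_sum)
        fix a b assume "a \<in> {w}" "b \<in> dd (in_chart c1 F) y ` PD s y"
        then show "a \<bullet> b = 0"
          using w FdF[OF y] NdF[OF y] at by (auto simp: inner_add_left inner_diff_left)
      qed
      moreover have "dim {w} = 1" using S(3) by (simp add: dim_eq_card_independent)
      moreover have "dim ({w} \<union> dd (in_chart c1 F) y ` PD s y) \<le> dim S"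
        by (rule dim_subset) (use S in auto)
      ultimately show ?thesis using dimPD[OF S(5)] by simp
    qed
    have NF0: "F x1 \<bullet> F x1 = 1" "N x1 \<bullet> N x1 = 1" "N x1 \<bullet> F x1 = 0" "F x1 \<bullet> N x1 = 0"
      using FF[OF y] NN[OF y] NF[OF y] at by (simp_all add: inner_commute)
    have "(F x1 + N x1) \<bullet> F x1 = 1" "(F x1 - N x1) \<bullet> F x1 = 1"
      using NF0 by (simp_all add: inner_add_left inner_diff_left)
    then have nz: "F x1 + N x1 \<noteq> 0" "F x1 - N x1 \<noteq> 0" by auto
    have "dd (in_chart c1 F) y ` PD (-1) y \<subseteq> V" using BdF by (auto simp: V_def PD_def)
    then show "dim V \<ge> m + 1" using lower[OF V pV[OF x1] nz(1)] by blast
    have "dd (in_chart c1 F) y ` PD 1 y \<subseteq> W" using BdF by (auto simp: W_def PD_def)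
    then show "dim W \<ge> m + 1" using lower[OF W qW[OF x1] nz(2)] by blast
  qed
  have "dim (V \<union> W) = dim V + dim W" by (rule dim_orthogonal_sum) (rule orth)
  moreover have "dim (V \<union> W) \<le> DIM('b)" by (rule dim_subset_UNIV)
  ultimately have dimVW: "dim V = m + 1" "dim W = m + 1" using dimV dimW dimb by auto
  define Pr where "Pr = {v + w | v w. v \<in> V \<and> w \<in> W \<and> norm v = 1 / sqrt 2 \<and> norm w = 1 / sqrt 2}"
  have norms: "(F x + N x) \<bullet> (F x + N x) = 2" "(F x - N x) \<bullet> (F x - N x) = 2" if x: "x \<in> topspace X" for x
  proof -
    obtain c where c: "c \<in> A" "x \<in> fst c" using x cover by blast
    interpret clifford_local "snd c ` fst c" "in_chart c F" "in_chart c N" by (rule loc[OF c(1)])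
    have y: "snd c x \<in> snd c ` fst c" using c by simp
    show "(F x + N x) \<bullet> (F x + N x) = 2" "(F x - N x) \<bullet> (F x - N x) = 2"
      using FF[OF y] NN[OF y] NF[OF y] unfolding in_chart_at[OF charts[OF c(1)] c(2)]
      by (simp_all add: inner_add_left inner_add_right inner_diff_left inner_diff_right inner_commute)
  qed
  have half: "norm ((1/2) *\<^sub>R w) = 1 / sqrt 2" if "w \<bullet> w = 2" for w :: 'b
  proof -
    have "sqrt 2 * norm ((1/2) *\<^sub>R w) = (sqrt 2 * sqrt 2) / 2" using that by (simp add: norm_eq_sqrt_inner[of w])
    then show ?thesis by (simp add: field_simps)
  qed
  have sub: "F ` topspace X \<subseteq> Pr"
  proof
    fix w assume "w \<in> F ` topspace X"
    then obtain x where x: "x \<in> topspace X" "w = F x" by auto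
    have "w = (1/2) *\<^sub>R (F x + N x) + (1/2) *\<^sub>R (F x - N x)"
      unfolding x(2) by (simp add: scaleR_add_right scaleR_diff_right scaleR_2[symmetric] scaleR_left_distrib[symmetric])
    moreover have "(1/2) *\<^sub>R (F x + N x) \<in> V" "(1/2) *\<^sub>R (F x - N x) \<in> W"
      using subspace_mul V W pV[OF x(1)] qW[OF x(1)] by blast+
    ultimately show "w \<in> Pr" unfolding Pr_def using half norms[OF x(1)] by blast
  qed
  have "openin (top_of_set Pr) (F ` topspace X)"
  proof (subst openin_subopen, intro ballI)
    fix o0 assume "o0 \<in> F ` topspace X"
    then obtain x where x: "x \<in> topspace X" "o0 = F x" by auto
    obtain c where c: "c \<in> A" "x \<in> fst c" using x cover by blast
    interpret clifford_local "snd c ` fst c" "in_chart c F" "in_chart c N" by (rule loc[OF c(1)])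
    define y where "y = snd c x"
    have y: "y \<in> snd c ` fst c" using c by (simp add: y_def)
    \<comment> \<open>Scaling the two halves independently adds the two missing dimensions, so near
      (1/2, 1/2, y) this is a map between spaces of equal dimension with invertible derivative, and
      its image is a neighbourhood of F x.\<close>
    define \<Theta> where "\<Theta> = (\<lambda>(r::real, s::real, z). r *\<^sub>R p z + s *\<^sub>R q z)"
    define T where "T = {0::real<..} \<times> {0::real<..} \<times> (snd c ` fst c)"
    have T: "open T" unfolding T_def by (intro open_Times open_greaterThan open_dom)
    have cont: "continuous_on T \<Theta>"
    proof -
      have ss: "continuous_on T (\<lambda>t. snd (snd t))" by (intro continuous_intros)
      have "continuous_on T (\<lambda>t. p (snd (snd t)))" "continuous_on T (\<lambda>t. q (snd (snd t)))"
        by (rule continuous_on_compose2[OF smooth_on_continuous[OF smp] ss], unfold T_def, force)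
          (rule continuous_on_compose2[OF smooth_on_continuous[OF smq] ss[unfolded T_def]], force)
      then show ?thesis unfolding \<Theta>_def case_prod_beta by (intro continuous_intros)
    qed
    have tT: "(1/2, 1/2, y) \<in> T" using y by (simp add: T_def)
    have pder: "(p has_derivative dd p y) (at y)" and qder: "(q has_derivative dd q y) (at y)"
      using smooth_on_has_derivative[OF smp y] smooth_on_has_derivative[OF smq y] .
    define \<Theta>' where "\<Theta>' = (\<lambda>(r::real, s::real, v). frame_map y (r + s, r - s, v))"
    have der: "(\<Theta> has_derivative \<Theta>') (at (1/2, 1/2, y))"
    proof -
      have "((\<lambda>t. p (snd (snd t))) has_derivative (\<lambda>h. dd p y (snd (snd h)))) (at (1/2::real, 1/2::real, y))"
        by (rule has_derivative_compose[where g = p and f = "\<lambda>t. snd (snd t)"])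
          (auto intro!: derivative_eq_intros pder)
      moreover have "((\<lambda>t. q (snd (snd t))) has_derivative (\<lambda>h. dd q y (snd (snd h)))) (at (1/2::real, 1/2::real, y))"
        by (rule has_derivative_compose[where g = q and f = "\<lambda>t. snd (snd t)"])
          (auto intro!: derivative_eq_intros qder)
      ultimately have "((\<lambda>t. fst t *\<^sub>R p (snd (snd t)) + fst (snd t) *\<^sub>R q (snd (snd t))) has_derivative
        (\<lambda>h. (1/2) *\<^sub>R dd p y (snd (snd h)) + fst h *\<^sub>R p y
           + ((1/2) *\<^sub>R dd q y (snd (snd h)) + fst (snd h) *\<^sub>R q y))) (at (1/2, 1/2, y))"
        by (auto intro!: derivative_eq_intros)
      moreover have "(1/2) *\<^sub>R dd p y v + r *\<^sub>R p y + ((1/2) *\<^sub>R dd q y v + s *\<^sub>R q y)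
          = frame_map y (r + s, r - s, v)" for r s v
      proof -
        have "(1/2) *\<^sub>R dd p y v + (1/2) *\<^sub>R dd q y v = (1/2 + 1/2) *\<^sub>R dd (in_chart c F) y v"
          unfolding dp[OF y] dq[OF y] scaleR_left_distrib by (simp add: scaleR_add_right scaleR_diff_right)
        then show ?thesis by (simp add: frame_map_def p_def q_def algebra_simps)
      qed
      ultimately show ?thesis by (simp add: \<Theta>_def \<Theta>'_def case_prod_beta')
    qed
    \<comment> \<open>The inverse of \<open>\<Theta>'\<close>: coordinates in the frame, then the
      inverse of (r, s) \<mapsto> (r + s, r - s).\<close>
    define G' where "G' w = (let z = frame_inv y w in
      ((fst z + fst (snd z)) / 2, (fst z - fst (snd z)) / 2, snd (snd z)))" for w
    have "linear G'"
      unfolding G'_def Let_def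
      by (intro linearI) (simp_all add: linear_add[OF linear_frame_inv[OF y]] linear_cmul[OF linear_frame_inv[OF y]]
          field_simps)
    then have blG: "bounded_linear G'" using linear_conv_bounded_linear by blast
    have "\<Theta>' (G' w) = w" for w
    proof -
      have "\<Theta>' (G' w) = frame_map y (frame_inv y w)"
        by (simp add: \<Theta>'_def G'_def Let_def add_divide_distrib[symmetric] diff_divide_distrib[symmetric] frame_map_def)
      then show ?thesis using frame_map_inv[OF y] by simp
    qed
    then have id: "\<Theta>' \<circ> G' = id" by auto
    have int: "\<Theta> (1/2, 1/2, y) \<in> interior (\<Theta> ` T)"
      by (rule sussmann_open_mapping[OF T cont tT der blG id subset_refl])
        (use tT T in \<open>simp add: interior_open\<close>)
    have "\<Theta> (1/2, 1/2, y) = (1/2 + 1/2) *\<^sub>R in_chart c F y"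
      unfolding \<Theta>_def p_def q_def scaleR_left_distrib by (simp add: scaleR_add_right scaleR_diff_right)
    then have o0: "o0 \<in> interior (\<Theta> ` T)"
      using int x(2) by (simp add: y_def in_chart_at[OF charts[OF c(1)] c(2)])
    have "interior (\<Theta> ` T) \<inter> Pr \<subseteq> F ` topspace X"
    proof
      fix w assume w: "w \<in> interior (\<Theta> ` T) \<inter> Pr"
      then have "w \<in> \<Theta> ` T" using interior_subset by blast
      then obtain r s z where rs: "r > 0" "s > 0" "z \<in> snd c ` fst c" "w = r *\<^sub>R p z + s *\<^sub>R q z"
        by (auto simp: T_def \<Theta>_def)
      obtain x' where x': "x' \<in> fst c" "z = snd c x'" using rs(3) by auto
      have x'X: "x' \<in> topspace X" using x'(1) c(1) cover by blast
      have pz: "p z = F x' + N x'" and qz: "q z = F x' - N x'"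
        unfolding p_def q_def x'(2) in_chart_at[OF charts[OF c(1)] x'(1)] by simp_all
      obtain v u where vu: "w = v + u" "v \<in> V" "u \<in> W" "norm v = 1 / sqrt 2" "norm u = 1 / sqrt 2"
        using w by (auto simp: Pr_def)
      have e1: "r *\<^sub>R p z \<in> V" "s *\<^sub>R q z \<in> W"
        unfolding pz qz using subspace_mul V W pV[OF x'X] qW[OF x'X] by blast+
      define d where "d = v - r *\<^sub>R p z"
      have d: "d \<in> V" "d = s *\<^sub>R q z - u"
        unfolding d_def using subspace_diff[OF V vu(2) e1(1)] vu(1) rs(4) by (simp_all add: algebra_simps)
      have "d \<in> W" unfolding d(2) by (rule subspace_diff[OF W e1(2) vu(3)])
      \<comment> \<open>Orthogonality of V and W makes the splitting of w unique; the prescribed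
        norms then force r = s = 1/2, so w is a value of F.\<close>
      then have "d = 0" using orth[OF d(1)] by (metis inner_eq_zero_iff)
      then have eqs: "v = r *\<^sub>R p z" "u = s *\<^sub>R q z" using d d_def by auto
      have half': "t = 1/2" if "t > 0" "norm (t *\<^sub>R b) = 1 / sqrt 2" "b \<bullet> b = 2" for t and b :: 'b
      proof -
        have "t * sqrt 2 = 1 / sqrt 2" using that by (simp add: norm_eq_sqrt_inner[of b])
        then have "t * (sqrt 2 * sqrt 2) = 1" by (simp add: field_simps)
        then show ?thesis by simp
      qed
      have rs2: "r = 1/2" "s = 1/2"
        using half'[OF rs(1)] half'[OF rs(2)] vu(4,5) eqs norms[OF x'X] pz qz by auto
      have "w = (1/2 + 1/2) *\<^sub>R F x'"
        unfolding rs(4) pz qz rs2 scaleR_left_distrib by (simp add: scaleR_add_right scaleR_diff_right)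
      then show "w \<in> F ` topspace X" using x'X by simp
    qed
    then show "\<exists>T. openin (top_of_set Pr) T \<and> o0 \<in> T \<and> T \<subseteq> F ` topspace X"
      using o0 sub x by (intro exI[of _ "interior (\<Theta> ` T) \<inter> Pr"]) (auto simp: openin_open)
  qed
  then show ?thesis
    unfolding clifford_hypersurface_def Pr_def using dimb V W dimVW orth by blast
qed

section \<open>The flow by parallel hypersurfaces\<close>

locale isoparametric_flow =
  fixes X :: "'m topology" and A :: "('m, 'e::euclidean_space) chart set"
    and F N :: "'m \<Rightarrow> 'b::euclidean_space" and k :: "nat \<Rightarrow> real" and g m :: nat
  assumes charts: "\<And>c. c \<in> A \<Longrightarrow> is_chart X c" and cover: "(\<Union>c\<in>A. fst c) = topspace X"
    and conn: "connected_space X" and ne: "topspace X \<noteq> {}"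
    and iso: "\<And>c. c \<in> A \<Longrightarrow> isosurf (snd c ` fst c) (in_chart c F) (in_chart c N) k g m"
    and pos: "(\<Sum>i\<in>{1..g}. k i) > 0"
begin

lemma chart_at: "x \<in> topspace X \<Longrightarrow> \<exists>c\<in>A. x \<in> fst c"
  using cover by blast

lemma dimb: "DIM('b) = DIM('e) + 2" and dime: "DIM('e) = g * m" and g_pos: "g > 0" and m_pos: "m > 0"
  and inj_k: "inj_on k {1..g}"
  and cartan: "i \<in> {1..g} \<Longrightarrow> (\<Sum>j\<in>{1..g} - {i}. (1 + k i * k j) / (k i - k j)) = 0"
proof -
  obtain c x where c: "c \<in> A" "x \<in> fst c" using ne chart_at by blast
  interpret isosurf "snd c ` fst c" "in_chart c F" "in_chart c N" k g m by (rule iso[OF c(1)])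
  show "DIM('b) = DIM('e) + 2" "DIM('e) = g * m" "g > 0" "m > 0" "inj_on k {1..g}"
    by (fact dim_eq dim_gm g_pos m_pos inj_k)+
  show "(\<Sum>j\<in>{1..g} - {i}. (1 + k i * k j) / (k i - k j)) = 0" if "i \<in> {1..g}"
    by (rule cartan_identity[of "snd c x"]) (use c that in auto)
qed

sublocale C: cartan_numbers k g
  by unfold_locales (fact inj_k g_pos cartan)+

lemma a_pos: "C.a > 0"
  using pos g_pos by (simp add: C.a_def)

sublocale fa: flow_angle C.a m g
  by unfold_locales (fact a_pos m_pos g_pos)+

definition "Fp u x = cos u *\<^sub>R F x + sin u *\<^sub>R N x"
definition "Np u x = - sin u *\<^sub>R F x + cos u *\<^sub>R N x"

lemma in_chart_Fp: "in_chart c (Fp u) = (\<lambda>y. cos u *\<^sub>R in_chart c F y + sin u *\<^sub>R in_chart c N y)"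
  and in_chart_Np: "in_chart c (Np u) = (\<lambda>y. - sin u *\<^sub>R in_chart c F y + cos u *\<^sub>R in_chart c N y)"
  unfolding Fp_def[abs_def] Np_def[abs_def] by (rule in_chart_lincomb)+

text \<open>Amplitude-phase form of \<open>C.h_eq\<close>, with (a, 1) = R (cos \<phi>0, sin
  \<phi>0).\<close>

lemma h_angle: "C.h u = fa.R * sin (fa.\<phi>0 - real g * u)"
  and h1_angle: "C.h1 u = - real g * fa.R * cos (fa.\<phi>0 - real g * u)"
proof -
  have "fa.R * (1 / fa.R) = 1" "fa.R * (C.a / fa.R) = C.a" using fa.R_pos by simp_all
  then show "C.h u = fa.R * sin (fa.\<phi>0 - real g * u)"
    "C.h1 u = - real g * fa.R * cos (fa.\<phi>0 - real g * u)"
    unfolding C.h_eq C.h1_eq sin_diff cos_diff fa.sin_\<phi>0 fa.cos_\<phi>0 by algebra+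
qed

lemma h_nonzero: "C.h u \<noteq> 0 \<longleftrightarrow> sin (fa.\<phi>0 - real g * u) \<noteq> 0"
  using fa.R_pos by (simp add: h_angle)

text \<open>Correct also at a zero of the cosine: there the convention x / 0 = 0 makes the tangent
  and then the quotient 0, which is the value of -h1 / h.\<close>

lemma sum_kpar_angle:
  assumes "sin (fa.\<phi>0 - real g * u) \<noteq> 0"
  shows "(\<Sum>i\<in>{1..g}. C.kpar u i) = real g / tan (fa.\<phi>0 - real g * u)"
  using C.sum_kpar[of u] h_nonzero[of u] assms fa.R_pos by (simp add: h_angle h1_angle tan_def)

lemma parallel_chart:
  assumes "c \<in> A" "sin (fa.\<phi>0 - real g * u) \<noteq> 0"
  shows "isosurf_chart X c (Fp u) (Np u) (C.kpar u) g m"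
proof (rule isosurf_chart.intro)
  interpret isosurf "snd c ` fst c" "in_chart c F" "in_chart c N" k g m by (rule iso[OF assms(1)])
  show "is_chart X c" by (rule charts[OF assms(1)])
  show "isosurf (snd c ` fst c) (in_chart c (Fp u)) (in_chart c (Np u)) (C.kpar u) g m"
    unfolding in_chart_Fp in_chart_Np
    by (rule parallel_isosurf) (use assms(2) h_nonzero C.h_nonzero_iff in blast)
qed

lemma parallel_oriented:
  assumes "sin (fa.\<phi>0 - real g * u) \<noteq> 0"
  shows "oriented_hypersurface A (Fp u) (Np u)"
  by (rule oriented_hypersurfaceI[OF dimb, of A X])
    (use parallel_chart[OF _ assms] in \<open>auto simp: isosurf_chart_def isosurf_def\<close>)

lemma parallel_mean_curvature:
  assumes "c \<in> A" "x \<in> fst c" "sin (fa.\<phi>0 - real g * u) \<noteq> 0"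
  shows "mean_curvature c (Fp u) (Np u) x = real g * real m / tan (fa.\<phi>0 - real g * u)"
  using isosurf_chart.mean_curvature_eq[OF parallel_chart[OF assms(1,3)] assms(2)]
    sum_kpar_angle[OF assms(3)] by (simp add: mult.commute)

lemma has_vector_derivative_Fp:
  assumes "(\<nu> has_real_derivative d) (at t)"
  shows "((\<lambda>s. Fp (\<nu> s) x) has_vector_derivative d *\<^sub>R Np (\<nu> t) x) (at t)"
proof -
  have "((\<lambda>s. cos (\<nu> s)) has_real_derivative - sin (\<nu> t) * d) (at t)"
    "((\<lambda>s. sin (\<nu> s)) has_real_derivative cos (\<nu> t) * d) (at t)"
    using assms by (auto intro!: derivative_eq_intros)
  from has_vector_derivative_add[OF has_vector_derivative_scaleR[OF this(1) has_vector_derivative_const]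
      has_vector_derivative_scaleR[OF this(2) has_vector_derivative_const]]
  have "((\<lambda>s. cos (\<nu> s) *\<^sub>R F x + sin (\<nu> s) *\<^sub>R N x) has_vector_derivative
      (- sin (\<nu> t) * d) *\<^sub>R F x + (cos (\<nu> t) * d) *\<^sub>R N x) (at t)"
    by simp
  then show ?thesis by (simp add: Fp_def Np_def algebra_simps)
qed

lemma flow_solution:
  "parallel_imcf_solution A F N {..<fa.ts} fa.\<mu> (\<lambda>t. Fp (fa.\<mu> t)) (\<lambda>t. Np (fa.\<mu> t))"
  unfolding parallel_imcf_solution_def imcf_solution_def
proof (intro conjI ballI)
  show "open {..<fa.ts}" "is_interval {..<fa.ts}" "0 \<in> {..<fa.ts}" "smooth_on {..<fa.ts} fa.\<mu>" "fa.\<mu> 0 = 0"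
    using fa.ts_pos fa.smooth_\<mu> fa.\<mu>0 by (auto simp: is_interval_1)
  show "Fp (fa.\<mu> 0) x = F x" for x by (simp add: Fp_def fa.\<mu>0)
  show "Fp (fa.\<mu> t) x = cos (fa.\<mu> t) *\<^sub>R F x + sin (fa.\<mu> t) *\<^sub>R N x" for t x by (simp add: Fp_def)
  fix t assume "t \<in> {..<fa.ts}"
  then have t: "t < fa.ts" by simp
  have th: "fa.\<phi>0 - real g * fa.\<mu> t = fa.\<theta> t" by (rule fa.g_\<mu>)
  have s: "sin (fa.\<phi>0 - real g * fa.\<mu> t) \<noteq> 0"
    unfolding th using fa.\<theta>_facts(3,4)[OF t] sin_gt_zero[of "fa.\<theta> t"] by auto
  have tanp: "tan (fa.\<theta> t) > 0" using fa.\<theta>_facts(3,4)[OF t] by (intro tan_gt_zero)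
  show "oriented_hypersurface A (Fp (fa.\<mu> t)) (Np (fa.\<mu> t))" by (rule parallel_oriented[OF s])
  fix c x assume c: "c \<in> A" "x \<in> fst c"
  have H: "mean_curvature c (Fp (fa.\<mu> t)) (Np (fa.\<mu> t)) x = real g * real m / tan (fa.\<theta> t)"
    using parallel_mean_curvature[OF c s] by (simp only: th)
  then show "mean_curvature c (Fp (fa.\<mu> t)) (Np (fa.\<mu> t)) x > 0" using tanp g_pos m_pos by simp
  show "((\<lambda>s. Fp (fa.\<mu> s) x) has_vector_derivative
      - (1 / mean_curvature c (Fp (fa.\<mu> t)) (Np (fa.\<mu> t)) x) *\<^sub>R Np (fa.\<mu> t) x) (at t)"
    using has_vector_derivative_Fp[OF fa.DERIV_\<mu>[OF t], of x] by (simp add: H)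
qed

text \<open>A zero of the sine annuls a factor of h, and then a whole eigenspace of dimension m > 0
  lies in the kernel of the differential.\<close>

lemma regular_if_immersed:
  assumes c: "c \<in> A" "x \<in> fst c" and hs: "hsurf (snd c ` fst c) (in_chart c (Fp u)) M"
  shows "sin (fa.\<phi>0 - real g * u) \<noteq> 0"
proof -
  interpret isosurf "snd c ` fst c" "in_chart c F" "in_chart c N" k g m by (rule iso[OF c(1)])
  interpret M: hsurf "snd c ` fst c" "in_chart c (Fp u)" M by (rule hs)
  define y where "y = snd c x"
  have y: "y \<in> snd c ` fst c" using c by (simp add: y_def)
  have "cos u - k i * sin u \<noteq> 0" if i: "i \<in> {1..g}" for i
  proof
    assume 0: "cos u - k i * sin u = 0"
    then have "sin u \<noteq> 0" using sin_cos_squared_add[of u] by auto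
    then have "{v. dd (in_chart c (Fp u)) y v = 0} = PD (k i) y"
      unfolding in_chart_Fp by (rule focal_kernel[OF y]) (use 0 in simp)
    then have "PD (k i) y \<subseteq> {0}" using M.dF_eq_0_iff[OF y] by auto
    then show False using dim_PD[OF y i] m_pos dim_eq_0 by (metis less_irrefl)
  qed
  then show ?thesis using h_nonzero C.h_nonzero_iff by blast
qed

text \<open>A competing solution brings its own normals, equal to \<open>Np\<close> only up to a
  sign. The sign cancels in the velocity, because the mean curvature changes with the normal; so
  \<nu> obeys the same equation as \<mu>.\<close>

lemma flow_unique:
  assumes sol: "parallel_imcf_solution A F N J \<nu> Gt Mt" and t: "t \<in> J"
  shows "t < fa.ts \<and> \<nu> t = fa.\<mu> t"
proof -
  have J: "open J" "is_interval J" "0 \<in> J" and sm: "smooth_on J \<nu>" and \<nu>0: "\<nu> 0 = 0"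
    and G: "\<And>t c x. t \<in> J \<Longrightarrow> c \<in> A \<Longrightarrow> x \<in> fst c \<Longrightarrow> Gt t x = Fp (\<nu> t) x"
    and ori: "\<And>t. t \<in> J \<Longrightarrow> oriented_hypersurface A (Gt t) (Mt t)"
    and H: "\<And>t c x. t \<in> J \<Longrightarrow> c \<in> A \<Longrightarrow> x \<in> fst c \<Longrightarrow> mean_curvature c (Gt t) (Mt t) x > 0"
    and der: "\<And>t c x. t \<in> J \<Longrightarrow> c \<in> A \<Longrightarrow> x \<in> fst c \<Longrightarrow> ((\<lambda>s. Gt s x) has_vector_derivative
              (- (1 / mean_curvature c (Gt t) (Mt t) x)) *\<^sub>R Mt t x) (at t)"
    using sol by (auto simp: parallel_imcf_solution_def imcf_solution_def Fp_def)
  obtain c x where c: "c \<in> A" "x \<in> fst c" using ne chart_at by blast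
  have main: "(sin (fa.\<phi>0 - real g * \<nu> t) \<noteq> 0 \<and> cos (fa.\<phi>0 - real g * \<nu> t) \<noteq> 0) \<and>
    (\<nu> has_real_derivative - tan (fa.\<phi>0 - real g * \<nu> t) / (real g * real m)) (at t)" if t: "t \<in> J" for t
  proof -
    define \<Omega> where "\<Omega> = snd c ` fst c"
    define y where "y = snd c x"
    have y: "y \<in> \<Omega>" using c by (simp add: y_def \<Omega>_def)
    have Geq: "in_chart c (Gt t) z = in_chart c (Fp (\<nu> t)) z" if "z \<in> \<Omega>" for z
      using that G[OF t c(1)] by (auto simp: \<Omega>_def in_chart_at[OF charts[OF c(1)]])
    have hG: "hsurf \<Omega> (in_chart c (Gt t)) (in_chart c (Mt t))"
      unfolding \<Omega>_def by (rule hsurf_chart[OF ori[OF t] c(1) charts[OF c(1)]])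
    then have hM: "hsurf \<Omega> (in_chart c (Fp (\<nu> t))) (in_chart c (Mt t))"
      by (rule hsurf_cong) (rule Geq)
    have s: "sin (fa.\<phi>0 - real g * \<nu> t) \<noteq> 0"
      by (rule regular_if_immersed[OF c]) (use hM in \<open>simp add: \<Omega>_def\<close>)
    interpret P: isosurf_chart X c "Fp (\<nu> t)" "Np (\<nu> t)" "C.kpar (\<nu> t)" g m
      by (rule parallel_chart[OF c(1) s])
    obtain e where e: "e = 1 \<or> e = -1" "in_chart c (Mt t) y = e *\<^sub>R in_chart c (Np (\<nu> t)) y"
      "dd (in_chart c (Mt t)) y = (\<lambda>v. e *\<^sub>R dd (in_chart c (Np (\<nu> t))) y v)"
      using P.L.other_normal[OF hM[unfolded \<Omega>_def]] y unfolding \<Omega>_def by blast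
    have Mx: "Mt t x = e *\<^sub>R Np (\<nu> t) x"
      using e(2) unfolding y_def in_chart_at[OF charts[OF c(1)] c(2)] .
    have dG: "differential c (Gt t) x = differential c (Fp (\<nu> t)) x"
      unfolding differential_def using dd_cong[OF _ y Geq] chart_facts(2)[OF charts[OF c(1)]]
      by (simp add: y_def \<Omega>_def)
    have HM: "mean_curvature c (Gt t) (Mt t) x = e * mean_curvature c (Fp (\<nu> t)) (Np (\<nu> t)) x"
      using e(1)
    proof
      assume e1: "e = 1"
      then have "differential c (Mt t) x = differential c (Np (\<nu> t)) x"
        using e(3) by (simp add: differential_def y_def)
      then show ?thesis using mean_curvature_cong[OF dG] e1 by simp
    next
      assume e1: "e = -1"
      then have "differential c (Mt t) x = (\<lambda>v. - differential c (Np (\<nu> t)) x v)"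
        using e(3) by (simp add: differential_def y_def)
      then have "mean_curvature c (Gt t) (Mt t) x = - mean_curvature c (Gt t) (Np (\<nu> t)) x"
        by (rule mean_curvature_flip)
      then show ?thesis using mean_curvature_cong[OF dG, of "Np (\<nu> t)" "Np (\<nu> t)"] e1 by simp
    qed
    define Hv where "Hv = mean_curvature c (Fp (\<nu> t)) (Np (\<nu> t)) x"
    have Hv: "Hv = real g * real m / tan (fa.\<phi>0 - real g * \<nu> t)"
      unfolding Hv_def by (rule parallel_mean_curvature[OF c s])
    have Hv0: "e * Hv > 0" using H[OF t c] HM by (simp add: Hv_def)
    \<comment> \<open>Division by zero yields 0, so a zero of the sine or cosine would make tan and
      then Hv zero. Positive mean curvature thus excludes the minimal position.\<close>
    then have "tan (fa.\<phi>0 - real g * \<nu> t) \<noteq> 0" using Hv by auto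
    then have cosne: "cos (fa.\<phi>0 - real g * \<nu> t) \<noteq> 0" by (auto simp: tan_def)
    obtain d where d: "(\<nu> has_real_derivative d) (at t)"
      using smooth_on_differentiable[OF sm t] real_differentiable_def by blast
    have "((\<lambda>s. Gt s x) has_vector_derivative d *\<^sub>R Np (\<nu> t) x) (at t)"
      by (rule has_vector_derivative_transform_within_open[OF has_vector_derivative_Fp[OF d] J(1) t])
        (simp add: G[OF _ c])
    then have "d *\<^sub>R Np (\<nu> t) x = (- (1 / (e * Hv))) *\<^sub>R (e *\<^sub>R Np (\<nu> t) x)"
      using vector_derivative_unique_at[OF der[OF t c]] by (simp add: HM Mx Hv_def)
    also have "\<dots> = (- (1 / Hv)) *\<^sub>R Np (\<nu> t) x" using e(1) by auto
    finally have "(d + 1 / Hv) *\<^sub>R Np (\<nu> t) x = 0" by (simp add: scaleR_left_distrib)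
    moreover have "Np (\<nu> t) x \<noteq> 0"
      using P.L.NN[of y] y c(2) in_chart_at[OF charts[OF c(1)] c(2), of "Np (\<nu> t)"]
      by (auto simp: \<Omega>_def y_def)
    ultimately have "d = - (1 / Hv)" by (simp add: eq_neg_iff_add_eq_0)
    then have "d = - tan (fa.\<phi>0 - real g * \<nu> t) / (real g * real m)" by (simp add: Hv)
    then show ?thesis using d s cosne by simp
  qed
  show ?thesis
    by (rule fa.unique_\<mu>[where \<nu> = \<nu> and J = J, OF J(2,3) \<nu>0 _ _ t]) (use main in blast)+
qed

lemma Fp_tendsto:
  fixes \<mu> :: "real \<Rightarrow> real"
  assumes "(\<mu> \<longlongrightarrow> u) \<F>"
  shows "((\<lambda>t. Fp (\<mu> t) x) \<longlongrightarrow> Fp u x) \<F>"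
  unfolding Fp_def
  by (intro tendsto_add tendsto_scaleR tendsto_const tendsto_cos[OF assms] tendsto_sin[OF assms])

lemma norm_Fp:
  assumes "x \<in> topspace X"
  shows "norm (Fp u x) = 1"
proof -
  obtain c where c: "c \<in> A" "x \<in> fst c" using chart_at[OF assms] by blast
  interpret isosurf "snd c ` fst c" "in_chart c F" "in_chart c N" k g m by (rule iso[OF c(1)])
  have y: "snd c x \<in> snd c ` fst c" using c by simp
  have ip: "F x \<bullet> F x = 1" "N x \<bullet> N x = 1" "N x \<bullet> F x = 0" "F x \<bullet> N x = 0"
    using FF[OF y] NN[OF y] NF[OF y] unfolding in_chart_at[OF charts[OF c(1)] c(2)]
    by (simp_all add: inner_commute)
  have "Fp u x \<bullet> Fp u x = cos u * cos u + sin u * sin u"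
    by (simp add: Fp_def inner_add_left inner_add_right ip)
  then show ?thesis
    using sin_cos_squared_add2[of u] by (simp add: norm_eq_1 power2_eq_square)
qed

lemma smooth_map_Fp: "smooth_map A (Fp u)"
  unfolding smooth_map_def in_chart_Fp
  using isosurf.smooth_FN[OF iso] by blast

section \<open>The backward limit: the focal submanifold\<close>

definition "focal_angle = fa.\<phi>0 / real g"

text \<open>Which factor of h vanishes is left open; all multiplicities are m, so the rank of the
  limit map does not depend on it.\<close>

lemma focal_root:
  obtains i where "i \<in> {1..g}" "sin focal_angle \<noteq> 0" "cos focal_angle = k i * sin focal_angle"
proof -
  have "C.h focal_angle = 0" using g_pos by (simp add: h_angle focal_angle_def)
  then obtain i where i: "i \<in> {1..g}" "cos focal_angle - k i * sin focal_angle = 0"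
    using C.h_nonzero_iff by blast
  then have "sin focal_angle \<noteq> 0" using sin_cos_squared_add[of focal_angle] by auto
  then show thesis using that[of i] i by simp
qed

lemma focal_rank_chart:
  assumes "c \<in> A" "y \<in> snd c ` fst c"
  shows "dim (range (dd (in_chart c (Fp focal_angle)) y)) = m * (g - 1)"
proof -
  interpret isosurf "snd c ` fst c" "in_chart c F" "in_chart c N" k g m by (rule iso[OF assms(1)])
  obtain i where "i \<in> {1..g}" "sin focal_angle \<noteq> 0" "cos focal_angle = k i * sin focal_angle"
    by (rule focal_root)
  then show ?thesis unfolding in_chart_Fp using focal_rank[OF assms(2)] by blast
qed

lemma focal_embedded:
  assumes "x \<in> topspace X"
  shows "\<exists>U. openin X U \<and> x \<in> U \<and> embedded_submanifold (m * (g - 1)) (Fp focal_angle ` U)"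
proof -
  obtain c where c: "c \<in> A" "x \<in> fst c" using chart_at[OF assms] by blast
  have sm: "smooth_on (snd c ` fst c) (in_chart c (Fp focal_angle))"
    using smooth_map_Fp c(1) by (simp add: smooth_map_def)
  obtain U where U: "open U" "snd c x \<in> U" "U \<subseteq> snd c ` fst c"
    "embedded_submanifold (m * (g - 1)) (in_chart c (Fp focal_angle) ` U)"
    by (rule embedded_submanifold_constant_rank_image[OF chart_facts(2)[OF charts[OF c(1)]] sm])
      (use c focal_rank_chart[OF c(1)] in auto)
  show ?thesis
    by (rule exI[of _ "{z \<in> fst c. snd c z \<in> U}"])
      (use U c chart_facts(5)[OF charts[OF c(1)] U(1)] in \<open>simp add: in_chart_image[OF charts[OF c(1)] U(3)]\<close>)
qed

text \<open>For g = 1 the limit map has rank 0, hence is locally constant, and connectedness makes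
  it constant.\<close>

lemma focal_point:
  assumes "g = 1"
  shows "\<exists>p. Fp focal_angle ` topspace X = {p}"
proof -
  have "\<exists>U b. openin X U \<and> x \<in> U \<and> (\<forall>z\<in>U. Fp focal_angle z = b)" if x: "x \<in> topspace X" for x
  proof -
    obtain c where c: "c \<in> A" "x \<in> fst c" using chart_at[OF x] by blast
    note ch = charts[OF c(1)]
    have sm: "smooth_on (snd c ` fst c) (in_chart c (Fp focal_angle))"
      using smooth_map_Fp c(1) by (simp add: smooth_map_def)
    obtain e where e: "e > 0" "ball (snd c x) e \<subseteq> snd c ` fst c"
      using chart_facts(2)[OF ch] c(2) open_contains_ball by blast
    have "in_chart c (Fp focal_angle) (snd c x) = in_chart c (Fp focal_angle) y"
      if y: "y \<in> ball (snd c x) e" for y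
    proof (rule convex_dd_zero_eq[OF convex_ball smooth_on_subset[OF sm e(2)] _ y])
      show "snd c x \<in> ball (snd c x) e" using e by simp
      fix w assume "w \<in> ball (snd c x) e"
      then have "w \<in> snd c ` fst c" using e(2) by blast
      moreover have "m * (g - 1) = 0" using assms by simp
      ultimately have "dim (range (dd (in_chart c (Fp focal_angle)) w)) = 0"
        using focal_rank_chart[OF c(1)] by presburger
      then show "dd (in_chart c (Fp focal_angle)) w (y - snd c x) = 0"
        unfolding dim_eq_0 by blast
    qed
    then have const: "Fp focal_angle z = Fp focal_angle x"
      if "z \<in> fst c" "snd c z \<in> ball (snd c x) e" for z
      using that(2) in_chart_at[OF ch that(1), of "Fp focal_angle"] in_chart_at[OF ch c(2), of "Fp focal_angle"]
      by metis
    have "x \<in> {z \<in> fst c. snd c z \<in> ball (snd c x) e}" using c(2) e(1) by simp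
    moreover have "\<forall>z\<in>{z \<in> fst c. snd c z \<in> ball (snd c x) e}. Fp focal_angle z = Fp focal_angle x"
      using const by blast
    ultimately show ?thesis
      using chart_facts(5)[OF ch open_ball, of "snd c x" e] by blast
  qed
  then obtain b where "\<And>x. x \<in> topspace X \<Longrightarrow> Fp focal_angle x = b"
    using locally_constant_choice[OF conn ne, of "\<lambda>x b. Fp focal_angle x = b"] by blast
  then have "Fp focal_angle ` topspace X = {b}" using ne by (auto simp only: image_iff)
  then show ?thesis by blast
qed

section \<open>The forward limit: the minimal hypersurface\<close>

definition "minimal_angle = (fa.\<phi>0 - pi / 2) / real g"

lemma minimal_angle: "fa.\<phi>0 - real g * minimal_angle = pi / 2"
  using g_pos by (simp add: minimal_angle_def)

abbreviation "kmin \<equiv> C.kpar minimal_angle"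

lemma minimal_chart: "c \<in> A \<Longrightarrow> isosurf_chart X c (Fp minimal_angle) (Np minimal_angle) kmin g m"
  by (rule parallel_chart) (simp_all add: minimal_angle)

lemma sum_kmin: "(\<Sum>i\<in>{1..g}. kmin i) = 0"
proof -
  have "C.h minimal_angle \<noteq> 0" "C.h1 minimal_angle = 0"
    using fa.R_pos by (simp_all add: h_angle h1_angle minimal_angle)
  then show ?thesis using C.sum_kpar by simp
qed

lemma sum_kmin_sq: "(\<Sum>i\<in>{1..g}. (kmin i)\<^sup>2) = real g * (real g - 1)"
proof -
  have "C.h minimal_angle \<noteq> 0" using fa.R_pos by (simp add: h_angle minimal_angle)
  from C.sum_kpar_sq[OF this] show ?thesis unfolding sum_kmin by simp
qed

lemma inj_kmin: "inj_on kmin {1..g}"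
proof -
  obtain c where "c \<in> A" using ne chart_at by blast
  then show ?thesis using minimal_chart isosurf.inj_k isosurf_chart.iso by blast
qed

lemma minimal_oriented: "oriented_hypersurface A (Fp minimal_angle) (Np minimal_angle)"
  by (rule parallel_oriented) (simp add: minimal_angle)

lemma minimal_minimal: "minimal_hypersurface A (Fp minimal_angle) (Np minimal_angle)"
  unfolding minimal_hypersurface_def
  using minimal_oriented isosurf_chart.mean_curvature_eq[OF minimal_chart] sum_kmin by simp

lemma minimal_sq_norm:
  assumes "c \<in> A" "x \<in> fst c"
  shows "sq_norm_second_form c (Fp minimal_angle) (Np minimal_angle) x = real m * real g * (real g - 1)"
  using isosurf_chart.sq_norm_eq[OF minimal_chart[OF assms(1)] assms(2)] sum_kmin_sq by simp

text \<open>With vanishing trace the Gauss equation leaves n (n - 1) - |A|^2, and |A|^2 = n (g -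
  1).\<close>

lemma minimal_scalar_curvature:
  assumes "c \<in> A" "x \<in> fst c"
  shows "scalar_curvature c (Fp minimal_angle) x = real m * (real m - 1) * (real g)\<^sup>2"
proof -
  have "scalar_curvature c (Fp minimal_angle) x
      = - (real m * (real g * (real g - 1))) + real g * real m * (real g * real m - 1)"
    using isosurf_chart.scalar_curvature_chart[OF minimal_chart[OF assms(1)] assms(2)]
      sum_kmin sum_kmin_sq by (simp add: dime)
  then show ?thesis by (simp add: power2_eq_square algebra_simps)
qed

lemma minimal_totally_geodesic:
  assumes "g = 1"
  shows "totally_geodesic A (Fp minimal_angle) (Np minimal_angle)"
  unfolding totally_geodesic_def
proof (intro conjI minimal_oriented ballI allI)
  fix c x v w assume c: "c \<in> A" "x \<in> fst c"
  interpret P: isosurf_chart X c "Fp minimal_angle" "Np minimal_angle" kmin g m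
    by (rule minimal_chart[OF c(1)])
  have y: "snd c x \<in> snd c ` fst c" using c by simp
  have set1: "{1..g} = {1}" using assms by simp
  have 0: "kmin 1 = 0" using sum_kmin unfolding set1 by simp
  have "(\<Union>i\<in>{1}. P.L.PD (kmin i) (snd c x)) = P.L.PD 0 (snd c x)"
    unfolding 0[symmetric] by blast
  then have "span (P.L.PD 0 (snd c x)) = UNIV"
    using P.L.span_PD[OF y] unfolding set1 by metis
  then have "v \<in> P.L.PD 0 (snd c x)"
    using P.L.subspace_PD[OF y] span_eq_iff by blast
  then show "second_form c (Fp minimal_angle) (Np minimal_angle) x v w = 0"
    by (simp add: P.L.PD_def second_form_def differential_def)
qed

lemma minimal_cartan_type:
  assumes "g \<in> {3, 4, 6}"
  shows "cartan_type A (Fp minimal_angle) (Np minimal_angle) g m"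
proof -
  have pc: "principal_curvatures c (Fp minimal_angle) (Np minimal_angle) x = kmin ` {1..g}"
    "\<kappa> \<in> kmin ` {1..g} \<Longrightarrow> curvature_mult c (Fp minimal_angle) (Np minimal_angle) x \<kappa> = m"
    if "c \<in> A" "x \<in> fst c" for c x \<kappa>
    using isosurf_chart.principal_curvatures_eq[OF minimal_chart[OF that(1)] that(2)]
      isosurf_chart.curvature_mult_eq[OF minimal_chart[OF that(1)] that(2)] by blast+
  have "isoparametric A (Fp minimal_angle) (Np minimal_angle)"
    unfolding isoparametric_def
    using minimal_oriented pc by (intro conjI exI[of _ "kmin ` {1..g}"] exI[of _ "\<lambda>_. m"]) blast+
  moreover have "card (kmin ` {1..g}) = g" using card_image[OF inj_kmin] by simp
  ultimately show ?thesis
    unfolding cartan_type_def using assms minimal_minimal pc by (metis (no_types, lifting))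
qed

text \<open>Two numbers with sum 0 and sum of squares 2 are 1 and -1; which index carries which sign
  depends on the enumeration k.\<close>

lemma minimal_clifford:
  assumes "g = 2"
  shows "clifford_hypersurface m (Fp minimal_angle ` topspace X)"
proof (rule clifford_global[OF conn ne charts cover])
  have set2: "{1..g} = {1, 2}" using assms by auto
  have s: "kmin 1 + kmin 2 = 0" "(kmin 1)\<^sup>2 + (kmin 2)\<^sup>2 = 2"
    using sum_kmin sum_kmin_sq unfolding set2 by (simp_all add: assms)
  then have "kmin 2 = - kmin 1" by linarith
  moreover from this have "(kmin 1)\<^sup>2 = 1" using s(2) by simp
  ultimately have pm: "(kmin 1 = 1 \<and> kmin 2 = -1) \<or> (kmin 1 = -1 \<and> kmin 2 = 1)"
    by (auto simp: power2_eq_1_iff)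
  show "DIM('b) = 2 * m + 2" using dimb dime assms by simp
  fix c assume c: "c \<in> A"
  interpret P: isosurf_chart X c "Fp minimal_angle" "Np minimal_angle" kmin g m
    by (rule minimal_chart[OF c])
  have dims: "dim (P.L.PD (kmin 1) y) = m" "dim (P.L.PD (kmin 2) y) = m" if "y \<in> snd c ` fst c" for y
    using P.L.dim_PD[OF that, of 1] P.L.dim_PD[OF that, of 2] assms by simp_all
  then show "dim (hsurf.PD (in_chart c (Fp minimal_angle)) (in_chart c (Np minimal_angle)) 1 y) = m \<and>
      dim (hsurf.PD (in_chart c (Fp minimal_angle)) (in_chart c (Np minimal_angle)) (-1) y) = m"
    if "y \<in> snd c ` fst c" for y
    using that pm by metis
  have "span (P.L.PD 1 y \<union> P.L.PD (-1) y) = UNIV" if "y \<in> snd c ` fst c" for y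
  proof -
    have *: "span (P.L.PD (kmin 1) y \<union> P.L.PD (kmin 2) y) = UNIV"
      using P.L.span_PD[OF that] unfolding set2 by (simp only: UN_insert UN_empty Un_empty_right)
    from pm show ?thesis
    proof
      assume e: "kmin 1 = 1 \<and> kmin 2 = -1"
      show ?thesis using * unfolding conjunct1[OF e] conjunct2[OF e] .
    next
      assume e: "kmin 1 = -1 \<and> kmin 2 = 1"
      show ?thesis using * unfolding conjunct1[OF e] conjunct2[OF e] Un_commute[of "P.L.PD 1 y"] .
    qed
  qed
  then show "clifford_local (snd c ` fst c) (in_chart c (Fp minimal_angle)) (in_chart c (Np minimal_angle))"
    by (intro clifford_local.intro P.L.hsurf_axioms clifford_local_axioms.intro)
qed

end

text \<open>The clause over all J expresses maximality of the interval together with uniqueness. The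
  backward limit is called a submanifold locally, since F is an immersion whose image may cross
  itself.\<close>

theorem theorem3p7:
  fixes X :: "'m topology"
    and A :: "('m, 'e::euclidean_space) chart set"
    and F N :: "'m \<Rightarrow> 'b::euclidean_space"
    and g m n :: nat
    and k :: "nat \<Rightarrow> real"
    and a ts :: real
    and q :: "real \<Rightarrow> real"
  assumes "smooth_manifold X A" and "connected_space X" and "topspace X \<noteq> {}"
    and "n = DIM('e)" and "DIM('b) = n + 2" and "n = g * m"
    and "g \<in> {1, 2, 3, 4, 6}"
    and "isoparametric A F N"
    and "\<forall>c\<in>A. \<forall>x\<in>fst c. mean_curvature c F N x > 0"
    and "inj_on k {1..g}"
    and "\<forall>c\<in>A. \<forall>x\<in>fst c. principal_curvatures c F N x = k ` {1..g}"
    and "\<forall>c\<in>A. \<forall>x\<in>fst c. \<forall>i\<in>{1..g}. curvature_mult c F N x (k i) = m"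
    and "a = (\<Sum>i=1..g. k i) / real g"
    and "q = (\<lambda>t. a\<^sup>2 + 1 - exp (2 * t / real m))"
    and "ts = real m / 2 * ln (a\<^sup>2 + 1)"
  shows "(\<forall>c\<in>A. \<forall>x\<in>fst c. a = mean_curvature c F N x / real n) \<and> 0 < ts \<and>
    (\<exists>\<mu> Ft Nt.
       (\<forall>t x. Ft t x = cos (\<mu> t) *\<^sub>R F x + sin (\<mu> t) *\<^sub>R N x) \<and>
       (\<forall>t x. Nt t x = - sin (\<mu> t) *\<^sub>R F x + cos (\<mu> t) *\<^sub>R N x) \<and>
       (\<forall>t<ts. cos (real g * \<mu> t) = (exp (t / real m) + a * sqrt (q t)) / (a\<^sup>2 + 1) \<and>
               sin (real g * \<mu> t) = (- a * exp (t / real m) + sqrt (q t)) / (a\<^sup>2 + 1)) \<and>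
       parallel_imcf_solution A F N {..<ts} \<mu> Ft Nt \<and>
       (\<forall>J \<nu> Gt Mt. parallel_imcf_solution A F N J \<nu> Gt Mt \<longrightarrow>
          J \<subseteq> {..<ts} \<and> (\<forall>t\<in>J. \<nu> t = \<mu> t)) \<and>
       (\<exists>Fm. (\<forall>x\<in>topspace X. ((\<lambda>t. Ft t x) \<longlongrightarrow> Fm x) at_bot \<and> norm (Fm x) = 1) \<and>
          smooth_map A Fm \<and>
          (\<forall>c\<in>A. \<forall>x\<in>fst c. dim (range (differential c Fm x)) = m * (g - 1)) \<and>
          (\<forall>x\<in>topspace X. \<exists>U. openin X U \<and> x \<in> U \<and> embedded_submanifold (m * (g - 1)) (Fm ` U)) \<and>
          (g = 1 \<longrightarrow> (\<exists>p. Fm ` topspace X = {p}))) \<and>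
       (\<exists>Fs Ns. (\<forall>x\<in>topspace X. ((\<lambda>t. Ft t x) \<longlongrightarrow> Fs x) (at_left ts)) \<and>
          minimal_hypersurface A Fs Ns \<and>
          (\<forall>c\<in>A. \<forall>x\<in>fst c.
             sq_norm_second_form c Fs Ns x = real m * real g * (real g - 1) \<and>
             sq_norm_second_form c Fs Ns x = real n * (real g - 1) \<and>
             scalar_curvature c Fs x = real m * (real m - 1) * (real g)\<^sup>2 \<and>
             scalar_curvature c Fs x = real n * (real n - real g)) \<and>
          (g = 1 \<longrightarrow> totally_geodesic A Fs Ns) \<and>
          (g = 2 \<longrightarrow> clifford_hypersurface m (Fs ` topspace X)) \<and>
          (g \<in> {3, 4, 6} \<longrightarrow> cartan_type A Fs Ns g m)))"
proof -
  have charts: "\<And>c. c \<in> A \<Longrightarrow> is_chart X c" and cover: "(\<Union>c\<in>A. fst c) = topspace X"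
    using assms(1) by (simp_all add: smooth_manifold_def)
  have ori: "oriented_hypersurface A F N" using assms(8) by (simp add: isoparametric_def)
  have iso: "isosurf (snd c ` fst c) (in_chart c F) (in_chart c N) k g m" if c: "c \<in> A" for c
  proof -
    interpret hsurf "snd c ` fst c" "in_chart c F" "in_chart c N"
      by (rule hsurf_chart[OF ori c charts[OF c]])
    show ?thesis
    proof
      show "inj_on k {1..g}" "DIM('e) = g * m" using assms by simp_all
      fix y i assume "y \<in> snd c ` fst c" and i: "i \<in> {1..g}"
      then obtain x where x: "x \<in> fst c" "y = snd c x" by auto
      have "curvature_space c F N x (k i) = PD (k i) y"
        using PD_eq_form[of y "k i"] x
        by (simp add: curvature_space_def second_form_def first_form_def differential_def)
      then show "dim (PD (k i) y) = m"
        using assms(12) c x(1) i by (metis curvature_mult_def)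
    qed
  qed
  have ic: "isosurf_chart X c F N k g m" if "c \<in> A" for c
    by (intro isosurf_chart.intro charts iso that)
  have mean: "mean_curvature c F N x = real m * (\<Sum>i\<in>{1..g}. k i)" if "c \<in> A" "x \<in> fst c" for c x
    by (rule isosurf_chart.mean_curvature_eq[OF ic[OF that(1)] that(2)])
  obtain c1 x1 where c1: "c1 \<in> A" "x1 \<in> fst c1" using assms(3) cover by blast
  have "real m * (\<Sum>i\<in>{1..g}. k i) > 0" using mean[OF c1] assms(9) c1 by metis
  then have pos: "(\<Sum>i\<in>{1..g}. k i) > 0" by (simp add: zero_less_mult_iff)
  interpret isoparametric_flow X A F N k g m
    by (intro isoparametric_flow.intro charts cover assms(2,3) iso pos)
  have a: "a = C.a" by (simp add: assms(13) C.a_def)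
  have ts: "ts = fa.ts" by (simp add: assms(15) fa.ts_def a)
  have q: "q t = C.a\<^sup>2 + 1 - exp (2 * t / real m)" for t by (simp add: assms(14) a)
  have n: "real n = real g * real m" by (simp add: assms(6))
  show ?thesis
    unfolding ts
  proof (intro conjI exI[of _ fa.\<mu>], goal_cases)
    case 1
    show ?case using mean m_pos g_pos by (simp add: n assms(13) field_simps)
  next
    case 2
    show ?case by (rule fa.ts_pos)
  next
    case 3
    show ?case
    proof (rule exI[of _ "\<lambda>t. Fp (fa.\<mu> t)"], rule exI[of _ "\<lambda>t. Np (fa.\<mu> t)"], intro conjI, goal_cases)
      case 3
      show ?case unfolding a q using fa.cos_sin_g_\<mu> by blast
    next
      case 4
      show ?case by (rule flow_solution)
    next
      case 5
      show ?case using flow_unique by blast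
    next
      case 6
      show ?case
      proof (rule exI[of _ "Fp focal_angle"], intro conjI ballI impI)
        show "((\<lambda>t. Fp (fa.\<mu> t) x) \<longlongrightarrow> Fp focal_angle x) at_bot" for x
          unfolding focal_angle_def by (rule Fp_tendsto[OF fa.\<mu>_at_bot])
        show "dim (range (differential c (Fp focal_angle) x)) = m * (g - 1)" if "c \<in> A" "x \<in> fst c" for c x
          unfolding differential_def by (rule focal_rank_chart) (use that in auto)
      qed (fact norm_Fp smooth_map_Fp focal_embedded focal_point)+
    next
      case 7
      show ?case
      proof (rule exI[of _ "Fp minimal_angle"], rule exI[of _ "Np minimal_angle"], intro conjI ballI impI)
        show "((\<lambda>t. Fp (fa.\<mu> t) x) \<longlongrightarrow> Fp minimal_angle x) (at_left fa.ts)" for x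
          unfolding minimal_angle_def by (rule Fp_tendsto[OF fa.\<mu>_at_ts])
        show "sq_norm_second_form c (Fp minimal_angle) (Np minimal_angle) x = real n * (real g - 1)"
          if "c \<in> A" "x \<in> fst c" for c x
          using minimal_sq_norm[OF that] by (simp add: n)
        show "scalar_curvature c (Fp minimal_angle) x = real n * (real n - real g)"
          if "c \<in> A" "x \<in> fst c" for c x
          using minimal_scalar_curvature[OF that] by (simp add: n power2_eq_square algebra_simps)
      qed (fact minimal_minimal minimal_sq_norm minimal_scalar_curvature minimal_totally_geodesic
          minimal_clifford minimal_cartan_type)+
    qed (simp_all add: Fp_def Np_def)
  qed
qed

end
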